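(* Let $\mu$ be a positive Borel measure on $[0,1]$ and let $\beta\in(0,1)$. Let $\Lambda=(\lambda_k)_{k\geqslant0}$ be a quasi-lacunary and subgeometric sequence with parameters $q,N$. Then the following assertions are equivalent: (i) \[\int_{[0,1]}\Big(\int_{[0,1]}\frac{\mathrm{d}\mu(t)}{1-\rho t}\Big)^{\frac{1}{1-\beta}}\mathrm{d}\rho<+\infty;\] (ii) for every $p\geqslant1$ the embedding $M_\Lambda^{p/\beta}\hookrightarrow L^p(\mathrm{d}\mu)$ is continuous, i.e. there is $C>0$ with $\|f\|_{L^p(\mathrm{d}\mu)}\leqslant C\|f\|_{L^{p/\beta}([0,1])}$ for all $f\in M_\Lambda$; (iii) for every $p\geqslant1$, \[\sum_{k\geqslant0}\lambda_k^{\frac{\beta}{1-\beta}}\Big(\int_{[0,1]}t^{p\lambda_k}\,\mathrm{d}\mu(t)\Big)^{\frac{1}{1-\beta}}<+\infty.\]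
   Context: $\Lambda=(\lambda_k)_{k\geqslant0}$ is an increasing sequence of positive reals with $\sum_k 1/\lambda_k<\infty$. $M_\Lambda$ is the set of finite sums $\sum_{k=0}^K a_k t^{\lambda_k}$ on $[0,1]$ ($a_k\in\mathbb{C}$), and $M^r_\Lambda$ is the closure of $M_\Lambda$ in $L^r([0,1])$ (Lebesgue measure). $\Lambda$ is quasi-lacunary with parameters $q>1$, $N\geqslant1$ if $\Lambda$ is partitioned into consecutive disjoint blocks $E_k=\{\lambda_j: n_k\leqslant j<n_{k+1}\}$ ($0=n_0<n_1<\dots$) with $\#E_k\leqslant N$ and $q\leqslant \lambda_{n_{k+1}}/\lambda_{n_k}\leqslant q^{2N}$ for all $k$. $\Lambda$ is subgeometric if there is $C>0$ with $\lambda_{k+1}\leqslant C\lambda_k$ for all $k$.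
   Formalization: The measure μ is assumed finite; for infinite μ the equivalence can fail: with dμ = dt/t, (iii) holds (its sum is a constant times Σ1/λ_k) while (i) fails because 1/(1-ρt) ≥ 1 and μ has infinite mass. *)

theory Defs
  imports "HOL-Analysis.Analysis"
begin

definition ennpowr :: "ennreal \<Rightarrow> real \<Rightarrow> ennreal" where
  "ennpowr x a = (if x = \<infinity> then \<infinity> else ennreal (enn2real x powr a))"

definition Muntz :: "(nat \<Rightarrow> real) \<Rightarrow> (real \<Rightarrow> complex) set" where
  "Muntz lam = {f. \<exists>(K::nat) (a::nat \<Rightarrow> complex).
       f = (\<lambda>t. \<Sum>k\<le>K. a k * complex_of_real (t powr lam k))}"

text \<open>Quasi-lacunary with parameters q, N: consecutive blocks E_k = {lam j : n_k <= j < n_(k+1)},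
  n_0 = 0, with #E_k <= N and q <= lam(n_(k+1))/lam(n_k) <= q^(2N).\<close>
definition quasi_lacunary :: "(nat \<Rightarrow> real) \<Rightarrow> real \<Rightarrow> nat \<Rightarrow> bool" where
  "quasi_lacunary lam q N \<longleftrightarrow> q > 1 \<and> N \<ge> 1 \<and>
     (\<exists>n::nat \<Rightarrow> nat. n 0 = 0 \<and> strict_mono n \<and>
        (\<forall>k. n (Suc k) - n k \<le> N \<and>
             q \<le> lam (n (Suc k)) / lam (n k) \<and>
             lam (n (Suc k)) / lam (n k) \<le> q ^ (2 * N)))"

definition subgeometric :: "(nat \<Rightarrow> real) \<Rightarrow> bool" where
  "subgeometric lam \<longleftrightarrow> (\<exists>C>0. \<forall>k. lam (Suc k) \<le> C * lam k)"

end

theory Submission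
  imports Defs "HOL-Complex_Analysis.Complex_Analysis"
begin

text \<open>Write t = exp (- x), so that a Muntz polynomial f becomes an exponential sum
  F x = sum of a_k exp (- lam_k x). Its Laplace transform has its poles at the points - lam_k;
  multiplying by the product of the factors (u + v + lam_k) / (u - lam_k) moves them to the points
  lam_k. Cauchy's formula on the rays arg u = pi/4 and arg u = - pi/4 therefore recovers the
  transform in the left half-plane from its values in the right one, and quasi-lacunarity bounds
  the product on these rays. The result is a bound of F x by the integral of F against a kernel
  which is homogeneous of degree -1 and decreasing in x, so Schur's test produces a decreasing
  majorant W of the r-th power of F whose integral is at most a constant times the r-th power of
  the L^r norm of f. This gives (i) => (ii), because an increasing U satisfies
  U t <= 2 (integral of U rho / (1 - rho t) d rho), by Fubini and Hoelder.

  In the other direction, sums with nonnegative coefficients satisfy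
  ||sum a_k t^lam_k||_r^r <= C sum a_k^r / lam_k. Testing (ii) for p = 1 with
  a_k = (lam_k m_k)^(beta / (1 - beta)), m_k being the moments of mu, gives (iii). Finally
  1 / (1 - tau) <= C (1 + sum lam_k tau^lam_k), and the same norm estimate with
  a_k = lam_k m_k gives (iii) => (i).\<close>

section \<open>Quasi-lacunary sequences on the logarithmic scale\<close>

text \<open>The hard direction is (i) => (ii): \<open>\<mu>\<close> is arbitrary, so estimates in
  Lebesgue norms do not suffice and f must be controlled pointwise, although its complex
  coefficients may cancel. Monotonicity is the remedy: the kernel in (i) dominates increasing
  functions, so |f|^(p / \<beta>) is replaced by an increasing function of comparable integral.
  Schur's test supplies one because the quantity that it bounds before the last integration is
  already monotone. The angle pi/4 is a compromise. On these rays |u - lam_k| is comparable to |u| +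
  lam_k, which keeps the product bounded, and Re u is comparable to |u|, which makes exp (- u x) and
  the Laplace integral decay. Quasi-lacunarity enters as a scale-invariant count of the lam_k, with
  exponent 1 in the product and exponent 1 / (2 r) in the sums with nonnegative
  coefficients.\<close>

definition bump :: "real \<Rightarrow> real" where
  "bump u = u / (1 + u)^2"

text \<open>\<open>bump\<close> is invariant under u -> 1 / u and comparable to the minimum of u and
  1 / u. The sum therefore counts the \<open>lam k\<close> near y, with a weight that decays like
  the e-th power of their ratio to y; the bound is uniform in the scale y.\<close>

definition log_sparse :: "(nat \<Rightarrow> real) \<Rightarrow> bool" where
  "log_sparse lam \<longleftrightarrow>
     (\<forall>e>0. \<exists>D. \<forall>K. \<forall>y>0. (\<Sum>k<K. bump ((lam k / y) powr e)) \<le> D)"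

lemma bump_nonneg: "0 \<le> u \<Longrightarrow> 0 \<le> bump u"
  by (simp add: bump_def)

text \<open>The summands are dominated by increments of the bounded function u / (1 + u).\<close>
lemma lacunary_bump_sum:
  fixes nu :: "nat \<Rightarrow> real"
  assumes q: "1 < q" and pos: "\<And>k. 0 < nu k" and gap: "\<And>k. q * nu k \<le> nu (Suc k)"
  shows "(\<Sum>k<K. bump (nu k)) \<le> q / (q - 1)"
proof -
  define phi where "phi u = u / (1 + u)" for u :: real
  have mono: "phi u \<le> phi v" if "0 < u" "u \<le> v" for u v
    using that by (simp add: phi_def divide_simps) argo
  have step: "bump (nu k) \<le> q / (q - 1) * (phi (nu (Suc k)) - phi (nu k))" for k
  proof -
    define u where "u = nu k"
    have u: "0 < u" using pos by (simp add: u_def)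
    have "phi (q * u) - phi u = (q - 1) * u / ((1 + u) * (1 + q * u))"
    proof -
      have "1 + u \<noteq> 0" "1 + q * u \<noteq> 0"
        using u q by (auto intro!: less_imp_neq[symmetric] add_pos_pos mult_pos_pos)
      then show ?thesis by (simp add: phi_def divide_simps) (simp add: algebra_simps)
    qed
    moreover have "(q - 1) * u / ((1 + u) * (q * (1 + u))) \<le> (q - 1) * u / ((1 + u) * (1 + q * u))"
    proof (rule divide_left_mono)
      show "(1 + u) * (1 + q * u) \<le> (1 + u) * (q * (1 + u))"
        using u q by (intro mult_left_mono) (auto simp: algebra_simps)
      show "0 < (1 + u) * (q * (1 + u)) * ((1 + u) * (1 + q * u))"
        using u q by (simp add: add_pos_pos)
    qed (use u q in auto)
    moreover have "(q - 1) * u / ((1 + u) * (q * (1 + u))) = (q - 1) / q * bump u"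
      using q u by (simp add: bump_def divide_simps power2_eq_square)
    ultimately have "(q - 1) / q * bump u \<le> phi (q * u) - phi u" by simp
    also have "\<dots> \<le> phi (nu (Suc k)) - phi u"
      using mono[of "q * u" "nu (Suc k)"] u q gap[of k] by (simp add: u_def)
    finally have "q / (q - 1) * ((q - 1) / q * bump u) \<le> q / (q - 1) * (phi (nu (Suc k)) - phi u)"
      using q by (intro mult_left_mono) auto
    then show ?thesis using q by (simp add: u_def)
  qed
  have "(\<Sum>k<K. bump (nu k)) \<le> (\<Sum>k<K. q / (q - 1) * (phi (nu (Suc k)) - phi (nu k)))"
    by (intro sum_mono step)
  also have "\<dots> = q / (q - 1) * (phi (nu K) - phi (nu 0))"
    by (simp only: sum_distrib_left[symmetric] sum_lessThan_telescope[of "\<lambda>k. phi (nu k)"])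
  also have "\<dots> \<le> q / (q - 1) * 1"
  proof (rule mult_left_mono)
    have "phi (nu K) \<le> 1" "0 \<le> phi (nu 0)"
      using pos[of K] pos[of 0] by (auto simp: phi_def divide_simps)
    then show "phi (nu K) - phi (nu 0) \<le> 1" by simp
  qed (use q in auto)
  finally show ?thesis by simp
qed

lemma sum_blocks:
  fixes n :: "nat \<Rightarrow> nat" and h :: "nat \<Rightarrow> 'a::comm_monoid_add"
  assumes "n 0 = 0" "mono n"
  shows "(\<Sum>j<n K. h j) = (\<Sum>k<K. \<Sum>j\<in>{n k..<n (Suc k)}. h j)"
proof (induction K)
  case (Suc K)
  have "{..<n (Suc K)} = {..<n K} \<union> {n K..<n (Suc K)}"
    using monoD[OF assms(2), of K "Suc K"] by auto
  then have "(\<Sum>j<n (Suc K). h j) = (\<Sum>j<n K. h j) + (\<Sum>j\<in>{n K..<n (Suc K)}. h j)"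
    by (simp add: sum.union_disjoint ivl_disj_int)
  then show ?case using Suc by simp
qed (simp add: assms)

text \<open>A block has at most N terms, all comparable to its first term up to the factor q^(2N).
  The first terms of the blocks form a lacunary sequence, and the power e turns its ratio q into q^e
  > 1.\<close>

lemma quasi_lacunary_log_sparse:
  assumes ql: "quasi_lacunary lam q N" and pos: "\<And>k. 0 < lam k" and inc: "strict_mono lam"
  shows "log_sparse lam"
  unfolding log_sparse_def
proof (intro allI impI)
  fix e :: real assume e: "0 < e"
  obtain n where n0: "n 0 = 0" and n: "strict_mono n"
    and card: "\<And>k. n (Suc k) - n k \<le> N" and lower: "\<And>k. q \<le> lam (n (Suc k)) / lam (n k)"
    and upper: "\<And>k. lam (n (Suc k)) / lam (n k) \<le> q ^ (2 * N)"
    and q: "1 < q"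
    using ql unfolding quasi_lacunary_def by blast
  define Q where "Q = q ^ (2 * N)"
  have Q: "1 \<le> Q" using q by (simp add: Q_def)
  have qe: "1 < q powr e" using q e by simp
  show "\<exists>D. \<forall>K. \<forall>y>0. (\<Sum>k<K. bump ((lam k / y) powr e)) \<le> D"
  proof (intro exI allI impI)
    fix K :: nat and y :: real assume y: "0 < y"
    have block_term: "bump ((lam j / y) powr e) \<le> Q powr e * bump ((lam (n k) / y) powr e)"
      if j: "j \<in> {n k..<n (Suc k)}" for j k
    proof -
      have 1: "lam (n k) \<le> lam j" using j inc by (simp add: strict_mono_less_eq)
      have "lam j \<le> lam (n (Suc k))" using j inc by (simp add: strict_mono_less_eq)
      also have "\<dots> \<le> Q * lam (n k)" using upper[of k] pos[of "n k"] by (simp add: Q_def divide_simps)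
      finally have 2: "lam j \<le> Q * lam (n k)" .
      have 3: "(lam (n k) / y) powr e \<le> (lam j / y) powr e"
        using 1 y pos[of "n k"] e by (intro powr_mono2 divide_right_mono) auto
      have "(lam j / y) powr e \<le> (Q * (lam (n k) / y)) powr e"
        using 2 y pos[of j] e by (intro powr_mono2) (auto simp: divide_simps)
      also have "\<dots> = Q powr e * (lam (n k) / y) powr e"
        using Q by (subst powr_mult) auto
      finally have 4: "(lam j / y) powr e \<le> Q powr e * (lam (n k) / y) powr e" .
      \<comment> \<open>Since \<open>bump\<close> is not monotone, the upper bound for lam j is used
        in the numerator and the lower bound in the denominator.\<close>
      have "bump ((lam j / y) powr e) \<le> Q powr e * (lam (n k) / y) powr e / (1 + (lam (n k) / y) powr e)^2"
        unfolding bump_def using 3 4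
        by (intro frac_le power_mono zero_less_power add_pos_nonneg) auto
      then show ?thesis by (simp add: bump_def)
    qed
    \<comment> \<open>A strictly increasing n satisfies K <= n K, so the first K blocks cover the
      first K indices.\<close>
    have "(\<Sum>k<K. bump ((lam k / y) powr e)) \<le> (\<Sum>k<n K. bump ((lam k / y) powr e))"
      using strict_mono_imp_increasing[OF n, of K]
      by (intro sum_mono2) (auto simp: bump_nonneg)
    also have "\<dots> = (\<Sum>k<K. \<Sum>j\<in>{n k..<n (Suc k)}. bump ((lam j / y) powr e))"
      using n0 n by (intro sum_blocks) (auto simp: strict_mono_mono)
    also have "\<dots> \<le> (\<Sum>k<K. N * (Q powr e * bump ((lam (n k) / y) powr e)))"
    proof (rule sum_mono)
      fix k
      have "(\<Sum>j\<in>{n k..<n (Suc k)}. bump ((lam j / y) powr e))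
          \<le> (\<Sum>j\<in>{n k..<n (Suc k)}. Q powr e * bump ((lam (n k) / y) powr e))"
        by (intro sum_mono block_term)
      also have "\<dots> = real (n (Suc k) - n k) * (Q powr e * bump ((lam (n k) / y) powr e))" by simp
      also have "\<dots> \<le> N * (Q powr e * bump ((lam (n k) / y) powr e))"
        using card[of k] by (intro mult_right_mono) (auto simp: bump_nonneg)
      finally show "(\<Sum>j\<in>{n k..<n (Suc k)}. bump ((lam j / y) powr e))
        \<le> N * (Q powr e * bump ((lam (n k) / y) powr e))" .
    qed
    also have "\<dots> = N * Q powr e * (\<Sum>k<K. bump ((lam (n k) / y) powr e))"
      by (simp add: sum_distrib_left mult.assoc)
    also have "\<dots> \<le> N * Q powr e * (q powr e / (q powr e - 1))"
    proof (intro mult_left_mono lacunary_bump_sum qe)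
      fix k
      show "0 < (lam (n k) / y) powr e" using pos[of "n k"] y by simp
      have "q powr e * (lam (n k) / y) powr e = (q * (lam (n k) / y)) powr e"
        using q by (subst powr_mult) auto
      also have "\<dots> \<le> (lam (n (Suc k)) / y) powr e"
        using lower[of k] y pos[of "n k"] e q
        by (intro powr_mono2) (auto simp: divide_simps)
      finally show "q powr e * (lam (n k) / y) powr e \<le> (lam (n (Suc k)) / y) powr e" .
    qed auto
    finally show "(\<Sum>k<K. bump ((lam k / y) powr e)) \<le> N * Q powr e * (q powr e / (q powr e - 1))" .
  qed
qed

section \<open>Integral inequalities and elementary integrals\<close>

text \<open>Real bounds A and B in place of norms avoid powers of extended reals. Young's inequality
  normalises by A and B, so their zero values are treated first: there one factor vanishes almost
  everywhere.\<close>

lemma nn_integral_Holder: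
  fixes f g :: "'a \<Rightarrow> real"
  assumes f [measurable]: "f \<in> borel_measurable M" and g [measurable]: "g \<in> borel_measurable M"
    and nonneg: "\<And>x. 0 \<le> f x" "\<And>x. 0 \<le> g x"
    and pq: "1 < p" "1 < q" "1 / p + 1 / q = 1"
    and A: "(\<integral>\<^sup>+x. ennreal (f x powr p) \<partial>M) \<le> ennreal A" "0 \<le> A"
    and B: "(\<integral>\<^sup>+x. ennreal (g x powr q) \<partial>M) \<le> ennreal B" "0 \<le> B"
  shows "(\<integral>\<^sup>+x. ennreal (f x * g x) \<partial>M) \<le> ennreal (A powr (1 / p) * B powr (1 / q))"
proof -
  have null: "AE x in M. h x = 0" if "(\<integral>\<^sup>+x. ennreal (h x powr e) \<partial>M) \<le> ennreal 0"
      "h \<in> borel_measurable M" for h :: "'a \<Rightarrow> real" and e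
  proof -
    have [measurable]: "h \<in> borel_measurable M" by fact
    have "(\<integral>\<^sup>+x. ennreal (h x powr e) \<partial>M) = 0" using that(1) by simp
    then have "AE x in M. ennreal (h x powr e) = 0" by (subst (asm) nn_integral_0_iff_AE) auto
    then show ?thesis by eventually_elim (auto simp: ennreal_eq_0_iff not_le powr_def split: if_splits)
  qed
  consider "A = 0" | "B = 0" | "0 < A" "0 < B" using A(2) B(2) by fastforce
  then show ?thesis
  proof cases
    case 1
    have "AE x in M. f x = 0" by (rule null) (use A 1 in auto)
    then have "AE x in M. ennreal (f x * g x) = 0" by eventually_elim simp
    then have "(\<integral>\<^sup>+x. ennreal (f x * g x) \<partial>M) = 0" by (subst nn_integral_0_iff_AE) auto
    then show ?thesis by simp
  next
    case 2
    have "AE x in M. g x = 0" by (rule null) (use B 2 in auto)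
    then have "AE x in M. ennreal (f x * g x) = 0" by eventually_elim simp
    then have "(\<integral>\<^sup>+x. ennreal (f x * g x) \<partial>M) = 0" by (subst nn_integral_0_iff_AE) auto
    then show ?thesis by simp
  next
    case 3
    define c where "c = A powr (1 / p) * B powr (1 / q)"
    have c: "0 < c" using 3 by (simp add: c_def)
    have young: "f x * g x \<le> c / (p * A) * f x powr p + c / (q * B) * g x powr q" for x
    proof -
      have "f x / A powr (1 / p) * (g x / B powr (1 / q))
          \<le> (f x / A powr (1 / p)) powr p / p + (g x / B powr (1 / q)) powr q / q"
        using pq nonneg 3 by (intro Youngs_inequality) auto
      also have "(f x / A powr (1 / p)) powr p = f x powr p / A"
        using pq nonneg 3 by (simp add: powr_divide powr_powr)
      also have "(g x / B powr (1 / q)) powr q = g x powr q / B"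
        using pq nonneg 3 by (simp add: powr_divide powr_powr)
      finally have "f x * g x / c \<le> f x powr p / A / p + g x powr q / B / q" by (simp add: c_def)
      then have "f x * g x \<le> c * (f x powr p / A / p + g x powr q / B / q)"
        using c by (simp add: divide_simps mult_ac)
      then show ?thesis by (simp add: algebra_simps)
    qed
    have "(\<integral>\<^sup>+x. ennreal (f x * g x) \<partial>M)
        \<le> (\<integral>\<^sup>+x. ennreal (c / (p * A)) * ennreal (f x powr p) + ennreal (c / (q * B)) * ennreal (g x powr q) \<partial>M)"
      using young c 3 pq
      by (intro nn_integral_mono) (simp add: ennreal_mult[symmetric] ennreal_plus[symmetric] del: ennreal_plus)
    also have "\<dots> = ennreal (c / (p * A)) * (\<integral>\<^sup>+x. ennreal (f x powr p) \<partial>M)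
        + ennreal (c / (q * B)) * (\<integral>\<^sup>+x. ennreal (g x powr q) \<partial>M)"
      by (simp add: nn_integral_add nn_integral_cmult)
    also have "\<dots> \<le> ennreal (c / (p * A)) * ennreal A + ennreal (c / (q * B)) * ennreal B"
      by (intro add_mono mult_left_mono A B) auto
    also have "\<dots> = ennreal (c / (p * A) * A + c / (q * B) * B)"
      using c 3 pq by (simp add: ennreal_mult[symmetric] ennreal_plus[symmetric] del: ennreal_plus)
    also have "c / (p * A) * A + c / (q * B) * B = c * (1 / p + 1 / q)"
      using 3 by (simp add: algebra_simps)
    finally show ?thesis using pq by (simp add: c_def)
  qed
qed

text \<open>Hoelder after splitting w as w^(1/r) w^(1/q). It drives Schur's test below and, for
  counting measure, the estimate of sums with nonnegative coefficients.\<close>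

lemma nn_integral_weighted_power_mean:
  fixes w h :: "'a \<Rightarrow> real"
  assumes [measurable]: "w \<in> borel_measurable M" "h \<in> borel_measurable M"
    and nonneg: "\<And>x. 0 \<le> w x" "\<And>x. 0 \<le> h x" and r: "1 < r"
    and W: "(\<integral>\<^sup>+x. ennreal (w x) \<partial>M) \<le> ennreal W" "0 \<le> W"
    and B: "(\<integral>\<^sup>+x. ennreal (w x * h x powr r) \<partial>M) \<le> ennreal B" "0 \<le> B"
  shows "(\<integral>\<^sup>+x. ennreal (w x * h x) \<partial>M) \<le> ennreal (W powr (1 - 1 / r) * B powr (1 / r))"
proof -
  define q where "q = r / (r - 1)"
  have q: "1 < q" "1 / r + 1 / q = 1" "1 / q = 1 - 1 / r" using r by (auto simp: q_def field_simps)
  have "(\<integral>\<^sup>+x. ennreal (w x * h x) \<partial>M) = (\<integral>\<^sup>+x. ennreal ((w x powr (1 / r) * h x) * w x powr (1 / q)) \<partial>M)"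
  proof (intro nn_integral_cong arg_cong[where f = ennreal])
    fix x
    have "w x = w x powr (1 / r) * w x powr (1 / q)"
      using nonneg(1)[of x] q by (simp add: powr_add[symmetric])
    then show "w x * h x = (w x powr (1 / r) * h x) * w x powr (1 / q)" by (metis mult.assoc mult.commute)
  qed
  also have "\<dots> \<le> ennreal (B powr (1 / r) * W powr (1 / q))"
  proof (rule nn_integral_Holder)
    have "(w x powr (1 / r) * h x) powr r = w x * h x powr r" for x
      using nonneg r by (simp add: powr_mult powr_powr)
    then show "(\<integral>\<^sup>+x. ennreal ((w x powr (1 / r) * h x) powr r) \<partial>M) \<le> ennreal B" using B by simp
    have "(w x powr (1 / q)) powr q = w x" for x using nonneg(1)[of x] q(1) by (simp add: powr_powr)
    then show "(\<integral>\<^sup>+x. ennreal ((w x powr (1 / q)) powr q) \<partial>M) \<le> ennreal W" using W by simp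
  qed (use nonneg r q W B in auto)
  finally show ?thesis by (simp add: q mult.commute)
qed

lemma sum_weighted_power_mean:
  fixes w h :: "nat \<Rightarrow> real"
  assumes nonneg: "\<And>k. 0 \<le> w k" "\<And>k. 0 \<le> h k" and r: "1 < r"
  shows "(\<Sum>k<K. w k * h k) powr r \<le> (\<Sum>k<K. w k) powr (r - 1) * (\<Sum>k<K. w k * h k powr r)"
proof -
  let ?M = "count_space {..<K}"
  have eq: "(\<integral>\<^sup>+k. ennreal (f k) \<partial>?M) = ennreal (\<Sum>k<K. f k)" if "\<And>k. 0 \<le> f k" for f
    using that by (subst nn_integral_count_space_finite) auto
  have "(\<integral>\<^sup>+k. ennreal (w k * h k) \<partial>?M)
      \<le> ennreal ((\<Sum>k<K. w k) powr (1 - 1 / r) * (\<Sum>k<K. w k * h k powr r) powr (1 / r))"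
    using nonneg r by (intro nn_integral_weighted_power_mean) (auto simp: eq sum_nonneg)
  then have "(\<Sum>k<K. w k * h k) \<le> (\<Sum>k<K. w k) powr (1 - 1 / r) * (\<Sum>k<K. w k * h k powr r) powr (1 / r)"
    using nonneg by (subst (asm) eq) auto
  then have "(\<Sum>k<K. w k * h k) powr r
      \<le> ((\<Sum>k<K. w k) powr (1 - 1 / r) * (\<Sum>k<K. w k * h k powr r) powr (1 / r)) powr r"
    using r nonneg by (intro powr_mono2) (auto simp: sum_nonneg)
  also have "\<dots> = (\<Sum>k<K. w k) powr ((1 - 1 / r) * r) * (\<Sum>k<K. w k * h k powr r)"
    using r nonneg by (simp add: powr_mult powr_powr sum_nonneg)
  also have "(1 - 1 / r) * r = r - 1" using r by (simp add: field_simps)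
  finally show ?thesis .
qed

section \<open>Changes of variables, Gamma integrals and integrals of powers\<close>

lemma nn_integral_reflect_shift:
  fixes f :: "real \<Rightarrow> ennreal"
  assumes [measurable]: "f \<in> borel_measurable borel"
  shows "(\<integral>\<^sup>+x. f (c - x) \<partial>lborel) = (\<integral>\<^sup>+x. f x \<partial>lborel)"
  using nn_integral_real_affine[of f "-1" c] by simp

lemma nn_integral_exp_substitution:
  fixes f :: "real \<Rightarrow> ennreal"
  assumes [measurable]: "f \<in> borel_measurable borel"
  shows "(\<integral>\<^sup>+t\<in>{0<..<1}. f t \<partial>lborel) = (\<integral>\<^sup>+x\<in>{0<..}. f (exp (- x)) * ennreal (exp (- x)) \<partial>lborel)"
proof -
  \<comment> \<open>The substitution is made on the compact intervals [exp (- Suc n), 1], which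
    exhaust (0, 1]; \<open>Suc n\<close> keeps each of them nondegenerate.\<close>
  have sub: "(\<integral>\<^sup>+t. f t * indicator {exp (- real (Suc n))..exp 0} t \<partial>lborel)
      = (\<integral>\<^sup>+x. f (exp x) * ennreal (exp x) * indicator {- real (Suc n)..0} x \<partial>lborel)" for n
    by (rule nn_integral_substitution_aux) (auto intro!: derivative_eq_intros continuous_intros)
  have "(\<integral>\<^sup>+t\<in>{0<..<1}. f t \<partial>lborel) = (\<integral>\<^sup>+t\<in>{0<..1}. f t \<partial>lborel)"
    by (rule nn_integral_cong_AE, use AE_lborel_singleton[of "1::real"] in eventually_elim)
       (auto split: split_indicator)
  also have "\<dots> = (\<integral>\<^sup>+t. (SUP n. f t * indicator {exp (- real (Suc n))..exp 0} t) \<partial>lborel)"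
  proof (intro nn_integral_cong)
    fix t :: real
    show "f t * indicator {0<..1} t = (SUP n. f t * indicator {exp (- real (Suc n))..exp 0} t)"
    proof (cases "t \<in> {0<..1}")
      case True
      obtain n :: nat where "- ln t \<le> n" using real_arch_simple by blast
      then have "- real (Suc n) \<le> ln t" by simp
      then have "exp (- real (Suc n)) \<le> t" using True by (metis exp_le_cancel_iff exp_ln greaterThanAtMost_iff)
      then have "f t * indicator {0<..1} t \<le> (SUP n. f t * indicator {exp (- real (Suc n))..exp 0} t)"
        using True by (intro SUP_upper2[of n]) auto
      moreover have "(SUP n. f t * indicator {exp (- real (Suc n))..exp 0} t) \<le> f t * indicator {0<..1} t"
        using True by (intro SUP_least) (auto split: split_indicator)
      ultimately show ?thesis by (rule antisym)
    next
      case False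
      have "indicator {exp (- real (Suc n))..exp 0} t = (0::ennreal)" for n
        using False less_le_trans[OF exp_gt_zero, of "- real (Suc n)" t] by (auto split: split_indicator)
      then show ?thesis using False by simp
    qed
  qed
  also have "\<dots> = (SUP n. \<integral>\<^sup>+t. f t * indicator {exp (- real (Suc n))..exp 0} t \<partial>lborel)"
  proof (intro nn_integral_monotone_convergence_SUP incseq_SucI le_funI mult_left_mono)
    fix n and t :: real
    have "exp (- real (Suc (Suc n))) \<le> exp (- real (Suc n))" by simp
    then have "exp (- real (Suc (Suc n))) \<le> t" if "exp (- real (Suc n)) \<le> t"
      using that by linarith
    then show "indicator {exp (- real (Suc n))..exp 0} t
        \<le> (indicator {exp (- real (Suc (Suc n)))..exp 0} t :: ennreal)"
      by (auto simp: indicator_def simp del: of_nat_Suc)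
  qed auto
  also have "\<dots> = (SUP n. \<integral>\<^sup>+x. f (exp x) * ennreal (exp x) * indicator {- real (Suc n)..0} x \<partial>lborel)"
    by (simp only: sub)
  also have "\<dots> = (\<integral>\<^sup>+x. (SUP n. f (exp x) * ennreal (exp x) * indicator {- real (Suc n)..0} x) \<partial>lborel)"
    by (intro nn_integral_monotone_convergence_SUP[symmetric] incseq_SucI le_funI mult_left_mono)
       (auto split: split_indicator)
  also have "\<dots> = (\<integral>\<^sup>+x. f (exp x) * ennreal (exp x) * indicator {..0} x \<partial>lborel)"
  proof (intro nn_integral_cong)
    fix x :: real
    show "(SUP n. f (exp x) * ennreal (exp x) * indicator {- real (Suc n)..0} x)
        = f (exp x) * ennreal (exp x) * indicator {..0} x" (is "?l = ?r")
    proof (rule antisym)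
      obtain n :: nat where "- x \<le> n" using real_arch_simple by blast
      then show "?r \<le> ?l" by (intro SUP_upper2[of n]) (auto split: split_indicator)
      show "?l \<le> ?r" by (intro SUP_least) (auto split: split_indicator)
    qed
  qed
  also have "\<dots> = (\<integral>\<^sup>+x. f (exp (0 - x)) * ennreal (exp (0 - x)) * indicator {..0} (0 - x) \<partial>lborel)"
    by (rule nn_integral_reflect_shift[symmetric]) simp
  also have "\<dots> = (\<integral>\<^sup>+x\<in>{0<..}. f (exp (- x)) * ennreal (exp (- x)) \<partial>lborel)"
    by (rule nn_integral_cong_AE, use AE_lborel_singleton[of "0::real"] in eventually_elim)
       (auto split: split_indicator)
  finally show ?thesis .
qed

lemma nn_integral_powr_exp:
  fixes a c :: real
  assumes a: "0 < a" and c: "0 < c"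
  shows "(\<integral>\<^sup>+x\<in>{0<..}. ennreal (x powr (c - 1) * exp (- a * x)) \<partial>lborel) = ennreal (Gamma c * a powr (- c))"
proof -
  have G: "0 \<le> Gamma c" using Gamma_real_pos[OF c] by simp
  have "ennreal (Gamma c) = (\<integral>\<^sup>+t. ennreal (indicator {0..} t * t powr (c - 1) / exp t) \<partial>lborel)"
    by (rule Gamma_conv_nn_integral_real[OF c])
  also have "\<dots> = (\<integral>\<^sup>+t. ennreal (indicator {0<..} t * t powr (c - 1) / exp t) \<partial>lborel)"
    by (rule nn_integral_cong_AE, use AE_lborel_singleton[of "0::real"] in eventually_elim)
       (auto split: split_indicator)
  also have "\<dots> = ennreal a * (\<integral>\<^sup>+x. ennreal (indicator {0<..} (a * x) * (a * x) powr (c - 1) / exp (a * x)) \<partial>lborel)"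
    using nn_integral_real_affine[of "\<lambda>t. ennreal (indicator {0<..} t * t powr (c - 1) / exp t)" a 0] a by simp
  also have "\<dots> = ennreal a * (\<integral>\<^sup>+x. ennreal (a powr (c - 1)) * (ennreal (x powr (c - 1) * exp (- a * x)) * indicator {0<..} x) \<partial>lborel)"
    using a by (intro arg_cong2[where f = "(*)"] refl nn_integral_cong)
      (auto split: split_indicator simp: zero_less_mult_iff powr_mult ennreal_mult[symmetric] exp_minus field_simps)
  also have "\<dots> = ennreal a * (ennreal (a powr (c - 1)) * (\<integral>\<^sup>+x\<in>{0<..}. ennreal (x powr (c - 1) * exp (- a * x)) \<partial>lborel))"
    by (subst nn_integral_cmult) auto
  also have "\<dots> = ennreal (a powr c) * (\<integral>\<^sup>+x\<in>{0<..}. ennreal (x powr (c - 1) * exp (- a * x)) \<partial>lborel)"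
    using a by (simp add: mult.assoc[symmetric] ennreal_mult[symmetric] powr_diff)
  finally have "ennreal (a powr (- c)) * ennreal (Gamma c) = ennreal (a powr (- c)) * (ennreal (a powr c)
      * (\<integral>\<^sup>+x\<in>{0<..}. ennreal (x powr (c - 1) * exp (- a * x)) \<partial>lborel))" by simp
  also have "\<dots> = (\<integral>\<^sup>+x\<in>{0<..}. ennreal (x powr (c - 1) * exp (- a * x)) \<partial>lborel)"
    using a by (simp add: mult.assoc[symmetric] ennreal_mult[symmetric] powr_add[symmetric])
  finally show ?thesis using G by (simp add: ennreal_mult[symmetric] mult.commute)
qed

lemma nn_integral_powr_from_0:
  fixes c x :: real
  assumes "- 1 < c" "0 \<le> x"
  shows "(\<integral>\<^sup>+s\<in>{0..x}. ennreal (s powr c) \<partial>lborel) = ennreal (x powr (c + 1) / (c + 1))"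
proof -
  have "((\<lambda>s. s powr c) has_integral (x powr (c + 1) / (c + 1))) {0..x}"
    using assms by (rule has_integral_powr_from_0)
  then have "((\<lambda>s. s powr c * indicator {0..x} s) has_integral (x powr (c + 1) / (c + 1))) UNIV"
    by (subst (asm) has_integral_restrict_UNIV[symmetric]) (simp add: indicator_def of_bool_def if_distrib cong: if_cong)
  from nn_integral_has_integral_lborel[OF _ _ this]
  show ?thesis by (simp add: ennreal_mult' ennreal_indicator mult.commute)
qed

lemma nn_integral_powr_to_inf:
  fixes c x :: real
  assumes "c < - 1" "0 < x"
  shows "(\<integral>\<^sup>+s\<in>{x..}. ennreal (s powr c) \<partial>lborel) = ennreal (x powr (c + 1) / (- c - 1))"
proof -
  have "((\<lambda>s. s powr c) has_integral - (x powr (c + 1)) / (c + 1)) {x..}"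
    using assms by (rule has_integral_powr_to_inf)
  then have "((\<lambda>s. s powr c * indicator {x..} s) has_integral - (x powr (c + 1)) / (c + 1)) UNIV"
    by (subst (asm) has_integral_restrict_UNIV[symmetric]) (simp add: indicator_def of_bool_def if_distrib cong: if_cong)
  from nn_integral_has_integral_lborel[OF _ _ this]
  have "(\<integral>\<^sup>+s\<in>{x..}. ennreal (s powr c) \<partial>lborel) = ennreal (- (x powr (c + 1)) / (c + 1))"
    by (simp add: ennreal_mult' ennreal_indicator mult.commute)
  also have "- (x powr (c + 1)) / (c + 1) = x powr (c + 1) / (- c - 1)"
    by (metis minus_diff_eq minus_divide_left minus_divide_right diff_minus_eq_add add.commute)
  finally show ?thesis .
qed

section \<open>Sums with nonnegative coefficients\<close>

lemma powr_le_exp_minus: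
  fixes t l :: real
  assumes "0 < t" "0 \<le> l"
  shows "t powr l \<le> exp (- l * (1 - t))"
proof -
  have "l * ln t \<le> l * (t - 1)" using assms ln_le_minus_one by (intro mult_left_mono) auto
  then show ?thesis using assms by (simp add: powr_def algebra_simps)
qed

text \<open>With z = lam_k x and w = z^e a term equals x^(- e) w exp (- z). The condition e <= 1/2
  gives w^2 <= 1 + z, hence (1 + w)^2 <= 4 exp z, and the term is dominated by \<open>bump\<close> w
  at the scale y = 1 / x.\<close>

lemma log_sparse_exp_sum:
  assumes sparse: "log_sparse lam" and pos: "\<And>k. 0 < lam k" and e: "0 < e" "e \<le> 1 / 2"
  obtains D where "0 \<le> D" "\<And>K x. 0 < x \<Longrightarrow> (\<Sum>k<K. lam k powr e * exp (- lam k * x)) \<le> D * x powr (- e)"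
proof -
  obtain D where D: "\<And>K y. 0 < y \<Longrightarrow> (\<Sum>k<K. bump ((lam k / y) powr e)) \<le> D"
    using sparse e(1) unfolding log_sparse_def by blast
  have "(\<Sum>k<K. lam k powr e * exp (- lam k * x)) \<le> 4 * D * x powr (- e)" if x: "0 < x" for K x
  proof -
    have term_le: "lam k powr e * exp (- lam k * x) \<le> 4 * x powr (- e) * bump ((lam k / (1 / x)) powr e)" for k
    proof -
      define z where "z = lam k * x"
      have z: "0 < z" using pos x by (simp add: z_def)
      define w where "w = z powr e"
      have w: "0 < w" using z by (simp add: w_def)
      have "w^2 = z powr (2 * e)" using z by (simp add: w_def powr_power)
      also have "\<dots> \<le> 1 + z"
      proof (cases "z \<le> 1")
        case True
        have "z powr (2 * e) \<le> 1" using True z e by (intro powr_le1) auto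
        then show ?thesis using z by simp
      next
        case False
        have "z powr (2 * e) \<le> z powr 1" using False e by (intro powr_mono) auto
        then show ?thesis using z by simp
      qed
      finally have w2: "w^2 \<le> 1 + z" .
      have "(1 + w)^2 \<le> 2 * (1 + w^2)" using sum_squares_bound[of 1 w] by (simp add: power2_sum)
      also have "\<dots> \<le> 2 * (2 + z)" using w2 by (intro mult_left_mono) auto
      also have "\<dots> \<le> 4 * (1 + z)" using z by simp
      also have "\<dots> \<le> 4 * exp z" by (intro mult_left_mono exp_ge_add_one_self) auto
      finally have "(1 + w)^2 \<le> 4 * exp z" .
      then have "w * exp (- z) \<le> 4 * bump w"
        using w by (simp add: bump_def exp_minus divide_simps mult_ac add_pos_pos)
      then have "x powr (- e) * (w * exp (- z)) \<le> x powr (- e) * (4 * bump w)"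
        by (intro mult_left_mono) auto
      moreover have "x powr (- e) * w = lam k powr e"
        using x pos[of k] by (simp add: w_def z_def powr_mult powr_minus)
      ultimately have "lam k powr e * exp (- z) \<le> x powr (- e) * 4 * bump w"
        by (simp only: mult.assoc[symmetric])
      then show ?thesis by (simp add: z_def w_def mult_ac)
    qed
    have "(\<Sum>k<K. lam k powr e * exp (- lam k * x))
        \<le> (\<Sum>k<K. 4 * x powr (- e) * bump ((lam k / (1 / x)) powr e))"
      by (intro sum_mono term_le)
    also have "\<dots> \<le> 4 * x powr (- e) * D"
      unfolding sum_distrib_left[symmetric] using D[of "1 / x" K] x by (intro mult_left_mono) auto
    finally show ?thesis by (simp add: mult_ac)
  qed
  moreover have "0 \<le> 4 * D" using D[of 1 0] by simp
  ultimately show ?thesis using that by blast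
qed

text \<open>A power mean with the weights lam_k^e exp (- lam_k x), where x = 1 - t, moves the power
  r onto the coefficients; the sum of the weights is at most D x^(- e). Each term is then a Gamma
  integral, and the powers of lam_k combine to 1 / lam_k.\<close>

lemma Muntz_norm_upper_bound:
  assumes sparse: "log_sparse lam" and pos: "\<And>k. 0 < lam k" and r: "1 < r"
  obtains C where "0 \<le> C" "\<And>K a. (\<And>k. 0 \<le> a k) \<Longrightarrow>
    (\<integral>\<^sup>+t\<in>{0..1}. ennreal ((\<Sum>k<K. a k * t powr lam k) powr r) \<partial>lborel)
      \<le> ennreal (C * (\<Sum>k<K. a k powr r / lam k))"
proof -
  \<comment> \<open>Any e in (0, 1/2] with e (r - 1) < 1 would do; the second condition makes x^(- e
    (r - 1)) integrable at 0.\<close>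
  define e where "e = 1 / (2 * r)"
  have e: "0 < e" "e \<le> 1 / 2" using r by (auto simp: e_def divide_simps)
  define c where "c = e * (r - 1)"
  have c: "0 < c" "c < 1" using r by (auto simp: e_def c_def field_simps)
  obtain D where D: "0 \<le> D" "\<And>K x. 0 < x \<Longrightarrow> (\<Sum>k<K. lam k powr e * exp (- lam k * x)) \<le> D * x powr (- e)"
    using log_sparse_exp_sum[OF sparse pos e] by blast
  define C where "C = D powr (r - 1) * Gamma (1 - c)"
  have C: "0 \<le> C" using Gamma_real_pos[of "1 - c"] c by (simp add: C_def)
  have "(\<integral>\<^sup>+t\<in>{0..1}. ennreal ((\<Sum>k<K. a k * t powr lam k) powr r) \<partial>lborel)
      \<le> ennreal (C * (\<Sum>k<K. a k powr r / lam k))" if a: "\<And>k. 0 \<le> a k" for K and a :: "nat \<Rightarrow> real"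
  proof -
    define h where "h x k = lam k powr (- c) * a k powr r * (x powr ((1 - c) - 1) * exp (- lam k * x))" for x k
    have h: "0 \<le> h x k" for x k by (simp add: h_def)
    have point: "(\<Sum>k<K. a k * t powr lam k) powr r \<le> D powr (r - 1) * (\<Sum>k<K. h (1 - t) k)"
      if t: "0 < t" "t < 1" for t
    proof -
      define x where "x = 1 - t"
      have x: "0 < x" using t by (simp add: x_def)
      define w where "w k = lam k powr e * exp (- lam k * x)" for k
      define b where "b k = a k * lam k powr (- e)" for k
      have "(\<Sum>k<K. a k * t powr lam k) \<le> (\<Sum>k<K. w k * b k)"
      proof (rule sum_mono)
        fix k
        have "a k * t powr lam k \<le> a k * exp (- lam k * x)"
          using powr_le_exp_minus[of t "lam k"] t pos[of k] a by (intro mult_left_mono) (auto simp: x_def)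
        also have "\<dots> = w k * b k" using pos[of k] by (simp add: w_def b_def powr_minus)
        finally show "a k * t powr lam k \<le> w k * b k" .
      qed
      then have "(\<Sum>k<K. a k * t powr lam k) powr r \<le> (\<Sum>k<K. w k * b k) powr r"
        using a r by (intro powr_mono2) (auto intro!: sum_nonneg)
      also have "\<dots> \<le> (\<Sum>k<K. w k) powr (r - 1) * (\<Sum>k<K. w k * b k powr r)"
        using a r by (intro sum_weighted_power_mean) (auto simp: w_def b_def)
      also have "\<dots> \<le> (D * x powr (- e)) powr (r - 1) * (\<Sum>k<K. w k * b k powr r)"
        using D x r by (intro mult_right_mono powr_mono2 sum_nonneg) (auto simp: w_def)
      also have "(D * x powr (- e)) powr (r - 1) = D powr (r - 1) * x powr (- c)"
        using D x by (simp add: powr_mult powr_powr c_def)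
      also have "D powr (r - 1) * x powr (- c) * (\<Sum>k<K. w k * b k powr r)
          = D powr (r - 1) * (\<Sum>k<K. h x k)"
      proof -
        have "x powr (- c) * (w k * b k powr r) = h x k" for k
        proof -
          have "b k powr r = a k powr r * lam k powr (- e * r)"
            using a pos[of k] by (simp add: b_def powr_mult powr_powr)
          moreover have "lam k powr e * lam k powr (- e * r) = lam k powr (- c)"
            by (simp add: powr_add[symmetric] c_def algebra_simps)
          ultimately show ?thesis by (simp add: h_def w_def mult_ac)
        qed
        then show ?thesis by (simp add: mult.assoc sum_distrib_left)
      qed
      finally show ?thesis by (simp add: x_def)
    qed
    have "(\<integral>\<^sup>+t\<in>{0..1}. ennreal ((\<Sum>k<K. a k * t powr lam k) powr r) \<partial>lborel)
        = (\<integral>\<^sup>+t\<in>{0<..<1}. ennreal ((\<Sum>k<K. a k * t powr lam k) powr r) \<partial>lborel)"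
      by (rule nn_integral_cong_AE, use AE_lborel_singleton[of "0::real"] AE_lborel_singleton[of "1::real"] in eventually_elim)
         (auto split: split_indicator)
    also have "\<dots> \<le> (\<integral>\<^sup>+t. ennreal (D powr (r - 1)) * (\<Sum>k<K. ennreal (h (1 - t) k) * indicator {0<..} (1 - t)) \<partial>lborel)"
      using point by (intro nn_integral_mono)
        (auto split: split_indicator simp: sum_ennreal h ennreal_mult[symmetric] sum_nonneg lessThan_def)
    also have "\<dots> = (\<integral>\<^sup>+x. ennreal (D powr (r - 1)) * (\<Sum>k<K. ennreal (h x k) * indicator {0<..} x) \<partial>lborel)"
      by (rule nn_integral_reflect_shift) (simp add: h_def)
    also have "\<dots> = ennreal (D powr (r - 1)) * (\<Sum>k<K. \<integral>\<^sup>+x\<in>{0<..}. ennreal (h x k) \<partial>lborel)"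
      by (subst nn_integral_cmult, simp add: h_def, subst nn_integral_sum) (simp_all add: h_def)
    also have "\<dots> = ennreal (D powr (r - 1)) * (\<Sum>k<K. ennreal (Gamma (1 - c) * (a k powr r / lam k)))"
    proof (intro arg_cong2[where f = "(*)"] refl sum.cong)
      fix k
      have "(\<integral>\<^sup>+x\<in>{0<..}. ennreal (h x k) \<partial>lborel)
          = (\<integral>\<^sup>+x. ennreal (lam k powr (- c) * a k powr r) * (ennreal (x powr ((1 - c) - 1) * exp (- lam k * x)) * indicator {0<..} x) \<partial>lborel)"
        by (simp add: h_def ennreal_mult mult.assoc)
      also have "\<dots> = ennreal (lam k powr (- c) * a k powr r) * ennreal (Gamma (1 - c) * lam k powr (- (1 - c)))"
        using pos[of k] c by (subst nn_integral_cmult, simp, subst nn_integral_powr_exp) auto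
      also have "\<dots> = ennreal (Gamma (1 - c) * (a k powr r * (lam k powr (- c) * lam k powr (- (1 - c)))))"
        using Gamma_real_pos[of "1 - c"] c by (simp add: ennreal_mult[symmetric] mult_ac)
      also have "lam k powr (- c) * lam k powr (- (1 - c)) = lam k powr (- 1)"
        by (simp only: powr_add[symmetric]) simp
      also have "\<dots> = 1 / lam k"
        using pos[of k] by (simp add: powr_minus divide_inverse)
      finally show "(\<integral>\<^sup>+x\<in>{0<..}. ennreal (h x k) \<partial>lborel) = ennreal (Gamma (1 - c) * (a k powr r / lam k))"
        by simp
    qed
    also have "(\<Sum>k<K. ennreal (Gamma (1 - c) * (a k powr r / lam k)))
        = ennreal (Gamma (1 - c) * (\<Sum>k<K. a k powr r / lam k))"
      unfolding sum_distrib_left using Gamma_real_pos[of "1 - c"] c pos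
      by (intro sum_ennreal) (auto simp: less_imp_le)
    also have "ennreal (D powr (r - 1)) * \<dots> = ennreal (C * (\<Sum>k<K. a k powr r / lam k))"
      using Gamma_real_pos[of "1 - c"] c pos
      by (simp add: C_def ennreal_mult[symmetric] sum_nonneg less_imp_le mult.assoc)
    finally show ?thesis .
  qed
  with C show ?thesis using that by blast
qed

section \<open>A kernel bound for exponential sums\<close>

lemma norm_integral_le_nn_integral:
  fixes h :: "real \<Rightarrow> complex"
  assumes "continuous_on {0..R} h"
  shows "ennreal (norm (integral {0..R} h)) \<le> (\<integral>\<^sup>+s\<in>{0<..R}. ennreal (norm (h s)) \<partial>lborel)"
proof -
  have int: "(\<lambda>s. norm (h s)) integrable_on {0..R}" "h integrable_on {0..R}"
    using assms by (auto intro!: integrable_continuous_interval continuous_intros)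
  have "norm (integral {0..R} h) \<le> integral {0..R} (\<lambda>s. norm (h s))"
    using int by (intro integral_norm_bound_integral) auto
  then have "ennreal (norm (integral {0..R} h)) \<le> ennreal (integral {0..R} (\<lambda>s. norm (h s)))"
    by (rule ennreal_leI)
  also have "ennreal (integral {0..R} (\<lambda>s. norm (h s)))
      = (\<integral>\<^sup>+s. ennreal (indicator {0..R} s * norm (h s)) \<partial>lborel)"
  proof (rule nn_integral_has_integral_lborel[symmetric])
    show "(\<lambda>s. indicator {0..R} s * norm (h s)) \<in> borel_measurable borel"
      using borel_measurable_continuous_on_indicator[OF _ continuous_on_norm[OF assms]] by simp
    show "((\<lambda>s. indicator {0..R} s * norm (h s)) has_integral integral {0..R} (\<lambda>s. norm (h s))) UNIV"
      using integrable_integral[OF int(1)]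
      by (subst (asm) has_integral_restrict_UNIV[symmetric])
         (simp add: indicator_def of_bool_def if_distrib[of "\<lambda>x. x * _"] cong: if_cong)
  qed auto
  also have "\<dots> = (\<integral>\<^sup>+s\<in>{0<..R}. ennreal (norm (h s)) \<partial>lborel)"
    by (rule nn_integral_cong_AE, use AE_lborel_singleton[of "0::real"] in eventually_elim)
       (auto split: split_indicator)
  finally show ?thesis .
qed

lemma contour_integral_segment_le_nn_integral:
  fixes h :: "complex \<Rightarrow> complex" and d :: complex
  assumes R: "0 < R" and cont: "continuous_on {0..R} (\<lambda>s. h (of_real s * d))"
  shows "ennreal (norm (contour_integral (linepath 0 (of_real R * d)) h))
    \<le> ennreal (norm d) * (\<integral>\<^sup>+s\<in>{0<..}. ennreal (norm (h (of_real s * d))) \<partial>lborel)"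
proof -
  let ?h = "\<lambda>s. h (of_real s * d) * d"
  have cont': "continuous_on {0..R} ?h" using cont by (intro continuous_intros)
  then have "(?h has_integral integral {0..R} ?h) {0..R}"
    by (intro integrable_integral integrable_continuous_interval)
  from has_integral_stretch_real[OF this, of R]
  have "((\<lambda>x. h (of_real (R * x) * d) * d) has_integral (1 / R) *\<^sub>R integral {0..R} ?h) {0..1}"
    using R by (simp add: image_divide_atLeastAtMost)
  from has_integral_mult_right[OF this, of "of_real R"]
  have "((\<lambda>x. h (linepath 0 (of_real R * d) x) * (of_real R * d)) has_integral integral {0..R} ?h) {0..1}"
    using R by (simp add: linepath_def scaleR_conv_of_real mult_ac)
  then have "contour_integral (linepath 0 (of_real R * d)) h = integral {0..R} ?h"
    by (intro contour_integral_unique) (simp add: has_contour_integral_linepath)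
  then have "ennreal (norm (contour_integral (linepath 0 (of_real R * d)) h))
      \<le> (\<integral>\<^sup>+s\<in>{0<..R}. ennreal (norm (?h s)) \<partial>lborel)"
    using norm_integral_le_nn_integral[OF cont'] by simp
  also have "\<dots> = (\<integral>\<^sup>+s. ennreal (norm d) * (ennreal (norm (h (of_real s * d))) * indicator {0<..R} s) \<partial>lborel)"
    by (intro nn_integral_cong) (simp add: norm_mult ennreal_mult mult_ac)
  also have "\<dots> = ennreal (norm d) * (\<integral>\<^sup>+s\<in>{0<..R}. ennreal (norm (h (of_real s * d))) \<partial>lborel)"
  proof (rule nn_integral_cmult)
    have "(\<lambda>s. indicator {0..R} s *\<^sub>R h (of_real s * d)) \<in> borel_measurable borel"
      using borel_measurable_continuous_on_indicator[OF _ cont] by simp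
    then have "(\<lambda>s. ennreal (norm (indicator {0..R} s *\<^sub>R h (of_real s * d))) * indicator {0<..R} s) \<in> borel_measurable lborel"
      by measurable
    also have "(\<lambda>s. ennreal (norm (indicator {0..R} s *\<^sub>R h (of_real s * d))) * indicator {0<..R} s)
       = (\<lambda>s. ennreal (norm (h (of_real s * d))) * indicator {0<..R} s)"
      by (auto split: split_indicator)
    finally show "(\<lambda>s. ennreal (norm (h (of_real s * d))) * indicator {0<..R} s) \<in> borel_measurable lborel" .
  qed
  also have "\<dots> \<le> ennreal (norm d) * (\<integral>\<^sup>+s\<in>{0<..}. ennreal (norm (h (of_real s * d))) \<partial>lborel)"
    by (intro mult_left_mono nn_integral_mono) (auto split: split_indicator)
  finally show ?thesis .
qed

text \<open>The triangle is traversed counterclockwise and has a vertex at 0; this is why g has to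
  be holomorphic slightly beyond the imaginary axis.\<close>

lemma sector_Cauchy_formula:
  fixes l R :: real and g :: "complex \<Rightarrow> complex"
  assumes hol: "g holomorphic_on {z. - \<delta> < Re z}" and \<delta>: "0 < \<delta>" and l: "0 < l" "l < R"
  shows "((\<lambda>w. g w / (w - of_real l)) has_contour_integral 2 * pi * \<i> * g (of_real l))
    (linepath 0 (Complex R (- R)) +++ linepath (Complex R (- R)) (Complex R R) +++ linepath (Complex R R) 0)"
proof -
  let ?b = "Complex R (- R)" and ?c = "Complex R R"
  let ?p = "linepath 0 ?b +++ linepath ?b ?c +++ linepath ?c 0"
  have seg: "of_real l \<notin> closed_segment 0 ?b" "of_real l \<notin> closed_segment ?b ?c" "of_real l \<notin> closed_segment ?c 0"
    using l by (auto simp: closed_segment_def complex_eq_iff algebra_simps)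
  \<comment> \<open>These barycentric coordinates place l in the closed triangle. As l lies on none
    of the sides, it is an interior point, where the winding number is 1.\<close>
  have "of_real l = (1 - l / R) *\<^sub>R 0 + (l / (2 * R)) *\<^sub>R ?b + (l / (2 * R)) *\<^sub>R ?c"
    using l by (simp add: complex_eq_iff)
  moreover have "(1 - l / R) + l / (2 * R) + l / (2 * R) = 1" "0 \<le> 1 - l / R" "0 \<le> l / (2 * R)"
    using l by (simp_all add: field_simps)
  ultimately have "of_real l \<in> convex hull {0, ?b, ?c}"
    unfolding convex_hull_3 by blast
  then have "of_real l \<in> interior (convex hull {0, ?b, ?c})"
    using seg by (simp add: interior_of_triangle closed_segment_commute)
  from winding_number_triangle[OF this]
  have wind: "winding_number ?p (of_real l) = 1" using l by (simp add: algebra_simps)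
  have half: "{z. - \<delta> < Re z} = interior {z. - \<delta> < Re z}"
    by (simp add: interior_open open_halfspace_Re_gt)
  have conv: "convex {z. - \<delta> < Re z}" by (rule convex_halfspace_Re_gt)
  have "path_image ?p \<subseteq> {z. - \<delta> < Re z} - {of_real l}"
  proof -
    have "closed_segment x y \<subseteq> {z. - \<delta> < Re z}" if "x \<in> {0, ?b, ?c}" "y \<in> {0, ?b, ?c}" for x y
      using that conv \<delta> l by (intro closed_segment_subset) auto
    then show ?thesis using seg by (auto simp: path_image_join)
  qed
  moreover have "of_real l \<in> interior {z. - \<delta> < Re z}" using l \<delta> half by auto
  ultimately have "((\<lambda>w. g w / (w - of_real l)) has_contour_integral
      (2 * pi * \<i> * winding_number ?p (of_real l) * g (of_real l))) ?p"
    using conv hol by (intro Cauchy_integral_formula_convex_simple) auto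
  then show ?thesis by (simp add: wind)
qed

text \<open>The two rays bound the sector which contains the points lam k; the third side of the
  triangle is pushed to infinity, where g decays.\<close>
lemma sector_sum_bound:
  fixes lam :: "nat \<Rightarrow> real" and K :: nat and b :: "nat \<Rightarrow> complex" and g :: "complex \<Rightarrow> complex"
  assumes hol: "g holomorphic_on {z. - \<delta> < Re z}" and \<delta>: "0 < \<delta>" and pos: "\<And>k. 0 < lam k"
    and decay: "\<And>z. 0 < Re z \<Longrightarrow> norm (g z) \<le> m (Re z)" "(m \<longlongrightarrow> 0) at_top"
  defines "S \<equiv> \<lambda>w. \<Sum>k<K. b k / (w - of_real (lam k))"
  shows "ennreal (norm (\<Sum>k<K. b k * g (of_real (lam k))))
    \<le> (\<Sum>d\<in>{Complex 1 1, Complex 1 (- 1)}.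
        \<integral>\<^sup>+s\<in>{0<..}. ennreal (norm (g (of_real s * d)) * norm (S (of_real s * d))) \<partial>lborel)"
proof -
  define h where "h w = g w * S w" for w
  have norm_h: "norm (h w) = norm (g w) * norm (S w)" for w by (simp add: h_def norm_mult)
  define A where "A d = (\<integral>\<^sup>+s\<in>{0<..}. ennreal (norm (g (of_real s * d)) * norm (S (of_real s * d))) \<partial>lborel)" for d
  let ?d = "Complex 1 (- 1)" and ?e = "Complex 1 1"
  define V where "V = norm (\<Sum>k<K. b k * g (of_real (lam k)))"
  define B where "B = (\<Sum>k<K. norm (b k))"
  \<comment> \<open>A crude upper bound for all \<open>lam k\<close> with k < K: a triangle of size
    R > L contains every pole.\<close>
  define L where "L = (\<Sum>k<K. lam k)"
  have lam_L: "lam k \<le> L" if "k < K" for k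
    unfolding L_def using that pos by (intro member_le_sum) (auto simp: less_imp_le)
  have L: "0 \<le> L" unfolding L_def using pos by (intro sum_nonneg) (simp add: less_imp_le)
  have B: "0 \<le> B" unfolding B_def by (intro sum_nonneg) simp
  \<comment> \<open>The last summand comes from the vertical side, which has length 2 R and where
    |g| <= m R and |S| <= B / (R - L). The decay of S offsets the length, so m may tend to 0 at any
    rate.\<close>
  have main: "ennreal (2 * pi * V) \<le> ennreal (sqrt 2) * (A ?e + A ?d) + ennreal (2 * R * (m R * (B / (R - L))))"
    if R: "L < R" for R
  proof -
    let ?b = "Complex R (- R)" and ?c = "Complex R R"
    let ?p = "linepath 0 ?b +++ linepath ?b ?c +++ linepath ?c 0"
    have R0: "0 < R" using R L by simp
    have "((\<lambda>w. \<Sum>k<K. b k * (g w / (w - of_real (lam k)))) has_contour_integral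
        (\<Sum>k<K. b k * (2 * pi * \<i> * g (of_real (lam k))))) ?p"
      using lam_L R pos
      by (intro has_contour_integral_sum has_contour_integral_lmul sector_Cauchy_formula[OF hol \<delta>])
         (auto intro: le_less_trans)
    then have ci: "(h has_contour_integral (2 * pi * \<i> * (\<Sum>k<K. b k * g (of_real (lam k))))) ?p"
      by (simp add: h_def[abs_def] S_def sum_distrib_left mult_ac)
    have cont: "continuous_on X h" if "X \<subseteq> {z. 0 \<le> Re z}" "\<And>k. k < K \<Longrightarrow> of_real (lam k) \<notin> X" for X
    proof -
      have "continuous_on X g"
        using that(1) \<delta> by (intro continuous_on_subset[OF holomorphic_on_imp_continuous_on[OF hol]]) auto
      then show ?thesis
        unfolding h_def S_def using that(2) by (intro continuous_intros) auto
    qed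
    have ray: "continuous_on {0..R} (\<lambda>s. h (of_real s * d))" if d: "d \<in> {?d, ?e}" for d
    proof (rule continuous_on_compose2[of "(\<lambda>s. of_real s * d) ` {0..R}" h])
      show "continuous_on ((\<lambda>s. of_real s * d) ` {0..R}) h"
      proof (rule cont)
        show "(\<lambda>s. of_real s * d) ` {0..R} \<subseteq> {z. 0 \<le> Re z}" using d by auto
        fix k show "of_real (lam k) \<notin> (\<lambda>s. of_real s * d) ` {0..R}"
          using d pos[of k] by (auto simp: complex_eq_iff)
      qed
    qed (auto intro!: continuous_intros)
    have bc: "?b = of_real R * ?d" "?c = of_real R * ?e" by (simp_all add: complex_eq_iff)
    have norm_de: "norm ?d = sqrt 2" "norm ?e = sqrt 2" by (simp_all add: cmod_def)
    have i1: "ennreal (norm (contour_integral (linepath 0 ?b) h)) \<le> ennreal (sqrt 2) * A ?d"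
      unfolding bc using contour_integral_segment_le_nn_integral[OF R0 ray[of ?d]]
      by (simp add: norm_de A_def norm_h)
    have i3: "ennreal (norm (contour_integral (linepath ?c 0) h)) \<le> ennreal (sqrt 2) * A ?e"
    proof -
      have "continuous_on (closed_segment 0 ?c) h"
      proof (rule cont)
        show "closed_segment 0 ?c \<subseteq> {z. 0 \<le> Re z}"
          using R0 by (intro closed_segment_subset convex_halfspace_Re_ge) auto
        fix k show "of_real (lam k) \<notin> closed_segment 0 ?c"
          using pos[of k] by (auto simp: closed_segment_def complex_eq_iff)
      qed
      then have "contour_integral (linepath ?c 0) h = - contour_integral (linepath 0 ?c) h"
        using contour_integral_reverse_linepath[of 0 ?c h] by (simp add: minus_equation_iff)
      then show ?thesis
        unfolding bc using contour_integral_segment_le_nn_integral[OF R0 ray[of ?e]]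
        by (simp add: norm_de A_def norm_h)
    qed
    have cont2: "continuous_on (closed_segment ?b ?c) h"
    proof (rule cont)
      show "closed_segment ?b ?c \<subseteq> {z. 0 \<le> Re z}"
        using R0 by (intro closed_segment_subset convex_halfspace_Re_ge) auto
      fix k assume "k < K" then show "of_real (lam k) \<notin> closed_segment ?b ?c"
        using lam_L[of k] R by (auto simp: closed_segment_def complex_eq_iff algebra_simps)
    qed
    have mR: "0 \<le> m R" using decay(1)[of "of_real R"] R0 order_trans[OF norm_ge_zero] by simp
    have i2: "norm (contour_integral (linepath ?b ?c) h) \<le> (m R * (B / (R - L))) * norm (?c - ?b)"
    proof (rule contour_integral_bound_linepath)
      show "h contour_integrable_on linepath ?b ?c"
        by (rule contour_integrable_continuous_linepath[OF cont2])
      show "0 \<le> m R * (B / (R - L))" using mR B R by simp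
      fix w assume "w \<in> closed_segment ?b ?c"
      then obtain u where u: "w = (1 - u) *\<^sub>R ?b + u *\<^sub>R ?c" by (auto simp: closed_segment_def)
      have w: "Re w = R" unfolding u by (simp add: algebra_simps)
      have "norm (S w) \<le> (\<Sum>k<K. norm (b k) / (R - L))"
        unfolding S_def
      proof (rule sum_norm_le)
        fix k assume "k \<in> {..<K}"
        then have "R - L \<le> Re (w - of_real (lam k))" using lam_L[of k] w by simp
        also have "\<dots> \<le> norm (w - of_real (lam k))" by (rule complex_Re_le_cmod)
        finally show "norm (b k / (w - of_real (lam k))) \<le> norm (b k) / (R - L)"
          using R by (simp add: norm_divide frac_le)
      qed
      also have "\<dots> = B / (R - L)" by (simp add: B_def sum_divide_distrib)
      finally show "norm (h w) \<le> m R * (B / (R - L))"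
        unfolding h_def norm_mult using decay(1)[of w] w R0 mR by (intro mult_mono) auto
    qed
    have "norm (?c - ?b) = 2 * R" using R0 by (simp add: cmod_def real_sqrt_mult)
    with i2 have i2': "norm (contour_integral (linepath ?b ?c) h) \<le> 2 * R * (m R * (B / (R - L)))"
      by (simp add: mult_ac)
    have "h contour_integrable_on ?p" using ci by (auto simp: contour_integrable_on_def)
    then have eq: "contour_integral ?p h = contour_integral (linepath 0 ?b) h
        + (contour_integral (linepath ?b ?c) h + contour_integral (linepath ?c 0) h)"
      by simp
    have "2 * pi * V \<le> norm (contour_integral (linepath 0 ?b) h)
        + (norm (contour_integral (linepath ?b ?c) h) + norm (contour_integral (linepath ?c 0) h))"
    proof -
      have "2 * pi * V = norm (contour_integral ?p h)"
        using contour_integral_unique[OF ci] by (simp add: V_def norm_mult)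
      then show ?thesis using eq
        by (metis add_left_mono norm_triangle_ineq order_trans)
    qed
    then have "ennreal (2 * pi * V) \<le> ennreal (norm (contour_integral (linepath 0 ?b) h))
        + (ennreal (norm (contour_integral (linepath ?b ?c) h)) + ennreal (norm (contour_integral (linepath ?c 0) h)))"
      by (simp add: ennreal_plus[symmetric] ennreal_leI del: ennreal_plus)
    also have "\<dots> \<le> ennreal (sqrt 2) * A ?d
        + (ennreal (2 * R * (m R * (B / (R - L)))) + ennreal (sqrt 2) * A ?e)"
      using i2' by (intro add_mono i1 i3 ennreal_leI)
    finally show ?thesis by (simp add: algebra_simps)
  qed
  have "((\<lambda>R. 2 * (m R * B) * (1 / (1 - L / R))) \<longlongrightarrow> 2 * (0 * B) * (1 / (1 - 0))) at_top"
    using decay(2) by (intro tendsto_intros real_tendsto_divide_at_top filterlim_ident) auto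
  moreover have "eventually (\<lambda>R. 2 * (m R * B) * (1 / (1 - L / R)) = 2 * R * (m R * (B / (R - L)))) at_top"
    using eventually_gt_at_top[of L] eventually_gt_at_top[of 0]
    by eventually_elim (simp add: field_simps)
  ultimately have "((\<lambda>R. 2 * R * (m R * (B / (R - L)))) \<longlongrightarrow> 0) at_top"
    by (simp add: tendsto_cong)
  then have "((\<lambda>R. ennreal (sqrt 2) * (A ?e + A ?d) + ennreal (2 * R * (m R * (B / (R - L)))))
      \<longlongrightarrow> ennreal (sqrt 2) * (A ?e + A ?d) + ennreal 0) at_top"
    by (intro tendsto_intros tendsto_ennrealI)
  then have "ennreal (2 * pi * V) \<le> ennreal (sqrt 2) * (A ?e + A ?d) + ennreal 0"
  proof (rule tendsto_lowerbound)
    show "\<forall>\<^sub>F R in at_top. ennreal (2 * pi * V)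
        \<le> ennreal (sqrt 2) * (A ?e + A ?d) + ennreal (2 * R * (m R * (B / (R - L))))"
      using eventually_gt_at_top[of L] by (rule eventually_mono) (rule main)
  qed simp
  \<comment> \<open>The speed sqrt 2 of the parametrisation s -> s (1 +- i) is absorbed by the
    factor 2 pi of Cauchy's formula, which leaves the constant 1.\<close>
  moreover have "sqrt 2 \<le> 2 * pi"
    using pi_gt3 real_sqrt_le_mono[of 2 4] by simp
  ultimately have "ennreal (2 * pi) * ennreal V \<le> ennreal (2 * pi) * (A ?e + A ?d)"
    by (simp add: ennreal_mult[symmetric] V_def)
       (meson ennreal_leI mult_right_mono order_trans zero_le)
  then have "ennreal V \<le> A ?e + A ?d"
    by (subst (asm) ennreal_mult_le_mult_iff) auto
  then show ?thesis by (simp add: V_def A_def complex_eq_iff)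
qed

text \<open>For u = s (1 +- i) and l = lam_k, the squared modulus of a factor is 1 + (2 l + v) (2 s
  + v) / P with P = |u - l|^2 >= (s^2 + l^2) / 3. Its excess over 1 is at most a constant times
  \<open>bump\<close> (l / s) + v / l. Sparsity with exponent 1 sums the first part uniformly in s,
  and convergence of the series of 1 / lam_k sums the second.\<close>

lemma ray_quotient_bound:
  fixes lam :: "nat \<Rightarrow> real"
  assumes sparse: "log_sparse lam" and pos: "\<And>k. 0 < lam k" and inc: "strict_mono lam"
    and summ: "summable (\<lambda>k. 1 / lam k)" and v: "0 \<le> v"
  obtains M where "0 < M" "\<And>K s d. 0 < s \<Longrightarrow> d \<in> {Complex 1 1, Complex 1 (- 1)} \<Longrightarrow>
     (\<Prod>k<K. norm ((of_real s * d + of_real v + of_real (lam k)) / (of_real s * d - of_real (lam k)))) \<le> M"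
proof -
  obtain D where D: "\<And>K y. 0 < y \<Longrightarrow> (\<Sum>k<K. bump ((lam k / y) powr 1)) \<le> D"
    using sparse zero_less_one unfolding log_sparse_def by blast
  \<comment> \<open>Chosen so that 2 l + v <= c l whenever l >= lam 0.\<close>
  define c where "c = 2 + v / lam 0"
  have c: "2 \<le> c" using v pos[of 0] by (simp add: c_def)
  define T where "T = (\<Sum>k. 1 / lam k)"
  define M where "M = exp (c / 2 * (12 * D + 3 * v * T))"
  have bound: "(\<Prod>k<K. norm ((of_real s * d + of_real v + of_real (lam k)) / (of_real s * d - of_real (lam k)))) \<le> M"
    if s: "0 < s" and d: "d \<in> {Complex 1 1, Complex 1 (- 1)}" for K s d
  proof -
    have factor: "norm ((of_real s * d + of_real v + of_real (lam k)) / (of_real s * d - of_real (lam k)))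
        \<le> exp (c / 2 * (12 * bump ((lam k / s) powr 1) + 3 * v * (1 / lam k)))" for k
    proof -
      define l where "l = lam k"
      have l: "0 < l" "lam 0 \<le> l" using pos inc by (auto simp: l_def strict_mono_less_eq)
      define P where "P = (s - l)^2 + s^2"
      have P0: "0 < P" using s by (simp add: P_def add_nonneg_pos)
      have P: "s^2 + l^2 \<le> 3 * P"
      proof -
        \<comment> \<open>The right side is five times 3 P - (s^2 + l^2), written as a sum of
          squares.\<close>
        have "0 \<le> (5 * s - 3 * l)^2 + l^2" by simp
        then have "0 \<le> 5 * s^2 - 6 * (s * l) + 2 * l^2" by (simp add: power2_eq_square algebra_simps)
        then show ?thesis by (simp add: P_def power2_eq_square algebra_simps)
      qed
      have sq: "(norm ((of_real s * d + of_real v + of_real l) / (of_real s * d - of_real l)))^2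
          = 1 + (2 * l + v) * (2 * s + v) / P"
      proof -
        have "(norm (of_real s * d + of_real v + of_real l))^2 = (s + v + l)^2 + s^2"
          using d by (auto simp: cmod_power2)
        moreover have "(norm (of_real s * d - of_real l))^2 = P"
          using d by (auto simp: cmod_power2 P_def)
        ultimately have "(norm ((of_real s * d + of_real v + of_real l) / (of_real s * d - of_real l)))^2
            = ((s + v + l)^2 + s^2) / P" by (simp add: norm_divide power_divide)
        also have "(s + v + l)^2 + s^2 = P + (2 * l + v) * (2 * s + v)"
          by (simp add: P_def power2_eq_square algebra_simps)
        finally show ?thesis using P0 by (simp add: add_divide_distrib)
      qed
      have "v / lam 0 * l \<ge> v" using l v pos[of 0] by (simp add: divide_simps mult_left_mono)
      then have "2 * l + v \<le> c * l" by (simp add: c_def algebra_simps)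
      then have "(2 * l + v) * (2 * s + v) / P \<le> (c * l) * (2 * s + v) / P"
        using s v P0 by (intro divide_right_mono mult_right_mono) auto
      also have "\<dots> = c * (2 * (s * l / P) + v * (l / P))" by (simp add: algebra_simps add_divide_distrib)
      also have "\<dots> \<le> c * (2 * (6 * bump (l / s)) + v * (3 * (1 / l)))"
      proof (intro mult_left_mono add_mono)
        have "(s + l)^2 \<le> 2 * (s^2 + l^2)" using sum_squares_bound[of s l] by (simp add: power2_sum)
        also have "\<dots> \<le> 2 * (3 * P)" using P by (intro mult_left_mono) auto
        also have "\<dots> = 6 * P" by simp
        finally have "(s + l)^2 \<le> 6 * P" .
        then have "s * l / P \<le> 6 * (s * l / (s + l)^2)"
          using s l P0 by (simp add: divide_simps mult_left_mono)
        also have "s * l / (s + l)^2 = bump (l / s)"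
          using s l by (simp add: bump_def divide_simps power2_eq_square)
        finally show "s * l / P \<le> 6 * bump (l / s)" .
        have "l^2 \<le> 3 * P" using P s by (smt (verit) zero_le_power2)
        then show "l / P \<le> 3 * (1 / l)" using l P0 by (simp add: divide_simps power2_eq_square)
      qed (use c v in auto)
      also have "\<dots> = c * (12 * bump (l / s) + 3 * v * (1 / l))" by simp
      finally have "(norm ((of_real s * d + of_real v + of_real l) / (of_real s * d - of_real l)))^2
          \<le> exp (c * (12 * bump (l / s) + 3 * v * (1 / l)))"
        unfolding sq using exp_ge_add_one_self[of "c * (12 * bump (l / s) + 3 * v * (1 / l))"] by linarith
      also have "\<dots> = (exp (c / 2 * (12 * bump (l / s) + 3 * v * (1 / l))))^2"
        by (simp add: power2_eq_square exp_add[symmetric])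
      finally have "norm ((of_real s * d + of_real v + of_real l) / (of_real s * d - of_real l))
          \<le> exp (c / 2 * (12 * bump (l / s) + 3 * v * (1 / l)))"
        by (rule power2_le_imp_le) simp
      moreover have "(l / s) powr 1 = l / s" using l s by simp
      ultimately show ?thesis by (simp only: l_def)
    qed
    have "(\<Prod>k<K. norm ((of_real s * d + of_real v + of_real (lam k)) / (of_real s * d - of_real (lam k))))
        \<le> (\<Prod>k<K. exp (c / 2 * (12 * bump ((lam k / s) powr 1) + 3 * v * (1 / lam k))))"
      by (intro prod_mono conjI norm_ge_zero factor)
    also have "\<dots> = exp (c / 2 * (12 * (\<Sum>k<K. bump ((lam k / s) powr 1)) + 3 * v * (\<Sum>k<K. 1 / lam k)))"
      by (simp only: exp_sum[OF finite_lessThan, symmetric] sum_distrib_left[symmetric] sum.distrib)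
    also have "\<dots> \<le> M"
    proof -
      have "(\<Sum>k<K. bump ((lam k / s) powr 1)) \<le> D" by (rule D[OF s])
      moreover have "(\<Sum>k<K. 1 / lam k) \<le> T"
        unfolding T_def using pos by (intro sum_le_suminf[OF summ]) (auto simp: less_imp_le)
      ultimately have "c / 2 * (12 * (\<Sum>k<K. bump ((lam k / s) powr 1)) + 3 * v * (\<Sum>k<K. 1 / lam k))
          \<le> c / 2 * (12 * D + 3 * v * T)"
        using c v by (intro mult_left_mono add_mono) auto
      then show ?thesis by (simp add: M_def)
    qed
    finally show ?thesis .
  qed
  have "0 < M" by (simp add: M_def)
  with bound show ?thesis using that by blast
qed

text \<open>There is no constant term, so such a function vanishes at infinity. Every point
  \<open>lam k\<close> is excluded, not only those with k < K, so that the domain stays the same in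
  inductions on K.\<close>

definition pole_sum :: "(nat \<Rightarrow> real) \<Rightarrow> nat \<Rightarrow> (complex \<Rightarrow> complex) \<Rightarrow> bool" where
  "pole_sum lam K f \<longleftrightarrow> (\<exists>c. \<forall>u. (\<forall>k. u \<noteq> of_real (lam k)) \<longrightarrow> f u = (\<Sum>k<K. c k / (u - of_real (lam k))))"

lemma pole_sum_cong:
  assumes "pole_sum lam K f" "\<And>u. (\<And>k. u \<noteq> of_real (lam k)) \<Longrightarrow> f u = g u"
  shows "pole_sum lam K g"
  using assms unfolding pole_sum_def by metis

lemma pole_sum_add:
  assumes "pole_sum lam K f" "pole_sum lam K g"
  shows "pole_sum lam K (\<lambda>u. f u + g u)"
proof -
  obtain c d where "\<And>u. (\<And>k. u \<noteq> of_real (lam k)) \<Longrightarrow> f u = (\<Sum>k<K. c k / (u - of_real (lam k)))"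
    "\<And>u. (\<And>k. u \<noteq> of_real (lam k)) \<Longrightarrow> g u = (\<Sum>k<K. d k / (u - of_real (lam k)))"
    using assms unfolding pole_sum_def by blast
  then show ?thesis unfolding pole_sum_def
    by (intro exI[of _ "\<lambda>k. c k + d k"]) (simp add: add_divide_distrib sum.distrib)
qed

lemma pole_sum_cmult:
  assumes "pole_sum lam K f"
  shows "pole_sum lam K (\<lambda>u. b * f u)"
proof -
  obtain c where "\<And>u. (\<And>k. u \<noteq> of_real (lam k)) \<Longrightarrow> f u = (\<Sum>k<K. c k / (u - of_real (lam k)))"
    using assms unfolding pole_sum_def by blast
  then show ?thesis unfolding pole_sum_def
    by (intro exI[of _ "\<lambda>k. b * c k"]) (simp add: sum_distrib_left)
qed

lemma pole_sum_Suc: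
  assumes "pole_sum lam K f"
  shows "pole_sum lam (Suc K) f"
proof -
  obtain c where "\<And>u. (\<And>k. u \<noteq> of_real (lam k)) \<Longrightarrow> f u = (\<Sum>k<K. c k / (u - of_real (lam k)))"
    using assms unfolding pole_sum_def by blast
  then show ?thesis unfolding pole_sum_def
    by (intro exI[of _ "c(K := 0)"]) simp
qed

lemma pole_sum_simple: "pole_sum lam (Suc K) (\<lambda>u. 1 / (u - of_real (lam K)))"
  unfolding pole_sum_def by (intro exI[of _ "\<lambda>k. if k = K then 1 else 0"]) simp

text \<open>Injectivity of \<open>lam\<close> keeps the poles distinct, so each product of two
  simple poles splits into a difference; the new pole at lam K collects minus the sum of the
  coefficients \<open>d k\<close>.\<close>

lemma pole_sum_divide:
  assumes "pole_sum lam K f" and inj: "inj lam"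
  shows "pole_sum lam (Suc K) (\<lambda>u. f u / (u - of_real (lam K)))"
proof -
  obtain c where c: "\<And>u. (\<And>k. u \<noteq> of_real (lam k)) \<Longrightarrow> f u = (\<Sum>k<K. c k / (u - of_real (lam k)))"
    using assms unfolding pole_sum_def by blast
  define d where "d k = c k / of_real (lam k - lam K)" for k
  show ?thesis unfolding pole_sum_def
  proof (intro exI[of _ "d(K := - (\<Sum>k<K. d k))"] allI impI)
    fix u :: complex assume u: "\<forall>k. u \<noteq> of_real (lam k)"
    have split: "c k / (u - of_real (lam k)) / (u - of_real (lam K))
        = d k / (u - of_real (lam k)) - d k / (u - of_real (lam K))" if "k < K" for k
    proof -
      have "lam k \<noteq> lam K" using inj that by (auto dest: injD)
      moreover define A B where "A = u - of_real (lam k)" and "B = u - of_real (lam K)"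
      ultimately have "A \<noteq> 0" "B \<noteq> 0" "B - A \<noteq> 0" "of_real (lam k - lam K) = B - A" using u by auto
      then have "c k / A / B = d k / A - d k / B" by (simp add: d_def divide_simps) (simp add: algebra_simps)
      then show ?thesis by (simp add: A_def B_def)
    qed
    have "f u / (u - of_real (lam K)) = (\<Sum>k<K. d k / (u - of_real (lam k)) - d k / (u - of_real (lam K)))"
      unfolding c[OF u[rule_format]] sum_divide_distrib by (intro sum.cong refl split) simp
    also have "\<dots> = (\<Sum>k<Suc K. (d(K := - (\<Sum>k<K. d k))) k / (u - of_real (lam k)))"
      by (simp add: sum_subtractf sum_divide_distrib)
    finally show "f u / (u - of_real (lam K)) = (\<Sum>k<Suc K. (d(K := - (\<Sum>k<K. d k))) k / (u - of_real (lam k)))" .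
  qed
qed

text \<open>The numerators of the product cancel the poles - v - lam_k of the sum. Induction avoids
  explicit residues: a new factor equals 1 + (v + 2 lam_K) / (u - lam_K), and division by u - lam_K
  preserves the shape at the price of one more pole.\<close>

lemma partial_fractions:
  fixes lam :: "nat \<Rightarrow> real" and a :: "nat \<Rightarrow> complex"
  assumes inj: "inj lam"
  obtains c where "\<And>u. (\<And>k. u \<noteq> of_real (lam k)) \<Longrightarrow> (\<And>k. u + of_real v + of_real (lam k) \<noteq> 0) \<Longrightarrow>
    (\<Sum>k<K. a k / (u + of_real v + of_real (lam k)))
      * (\<Prod>k<K. (u + of_real v + of_real (lam k)) / (u - of_real (lam k)))
    = (\<Sum>k<K. c k / (u - of_real (lam k)))"
proof -
  define P :: "nat \<Rightarrow> complex \<Rightarrow> complex" where "P K u = (\<Prod>k<K. (u + of_real v + of_real (lam k)) / (u - of_real (lam k)))" for K u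
  define F :: "nat \<Rightarrow> complex \<Rightarrow> complex" where "F K u = (\<Sum>k<K. a k / (u + of_real v + of_real (lam k)))" for K u
  have F_Suc: "F (Suc K) u = F K u + a K / (u + of_real v + of_real (lam K))" for K u
    by (simp add: F_def)
  have P_Suc': "P (Suc K) u = P K u * ((u + of_real v + of_real (lam K)) / (u - of_real (lam K)))" for K u
    by (simp add: P_def)
  have P_Suc: "P (Suc K) u = P K u + of_real (v + 2 * lam K) * (P K u / (u - of_real (lam K)))"
    if "\<And>k. u \<noteq> of_real (lam k)" for K u
  proof -
    have "u - of_real (lam K) \<noteq> 0" using that by simp
    then show ?thesis by (simp add: P_def field_simps)
  qed
  \<comment> \<open>The product tends to 1 at infinity, so the constant 1 has to be subtracted to
    obtain a pure sum of poles.\<close>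
  have one: "pole_sum lam K (\<lambda>u. P K u - 1)" for K
  proof (induction K)
    case 0
    show ?case by (simp add: pole_sum_def P_def)
  next
    case (Suc K)
    let ?f = "\<lambda>u. (P K u - 1) + of_real (v + 2 * lam K) * ((P K u - 1) / (u - of_real (lam K)) + 1 / (u - of_real (lam K)))"
    have "pole_sum lam (Suc K) ?f"
      using Suc inj by (intro pole_sum_add pole_sum_cmult pole_sum_simple pole_sum_divide pole_sum_Suc)
    then show ?case
      by (rule pole_sum_cong) (simp add: P_Suc diff_divide_distrib)
  qed
  have "\<exists>g. pole_sum lam K g \<and> (\<forall>u. (\<forall>k. u \<noteq> of_real (lam k)) \<longrightarrow>
      (\<forall>k. u + of_real v + of_real (lam k) \<noteq> 0) \<longrightarrow> F K u * P K u = g u)"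
  proof (induction K)
    case 0
    show ?case by (intro exI[of _ "\<lambda>_. 0"]) (simp add: F_def pole_sum_def)
  next
    case (Suc K)
    then obtain g where g: "pole_sum lam K g"
      and gF: "\<And>u. (\<forall>k. u \<noteq> of_real (lam k)) \<Longrightarrow>
        (\<forall>k. u + of_real v + of_real (lam k) \<noteq> 0) \<Longrightarrow> F K u * P K u = g u"
      by blast
    let ?f = "\<lambda>u. (g u + of_real (v + 2 * lam K) * (g u / (u - of_real (lam K))))
      + a K * ((P K u - 1) / (u - of_real (lam K)) + 1 / (u - of_real (lam K)))"
    have "pole_sum lam (Suc K) ?f"
      using g one inj by (intro pole_sum_add pole_sum_cmult pole_sum_simple pole_sum_divide pole_sum_Suc)
    moreover have "F (Suc K) u * P (Suc K) u = ?f u"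
      if "\<forall>k. u \<noteq> of_real (lam k)" "\<forall>k. u + of_real v + of_real (lam k) \<noteq> 0" for u
    proof -
      have gu: "g u = F K u * P K u" using gF that by simp
      have "F (Suc K) u * P (Suc K) u = F K u * P (Suc K) u
          + a K / (u + of_real v + of_real (lam K)) * (P K u * ((u + of_real v + of_real (lam K)) / (u - of_real (lam K))))"
        unfolding F_Suc distrib_right by (simp only: P_Suc')
      also have "a K / (u + of_real v + of_real (lam K)) * (P K u * ((u + of_real v + of_real (lam K)) / (u - of_real (lam K))))
          = a K * (P K u / (u - of_real (lam K)))" using that by simp
      also have "F K u * P (Suc K) u = g u + of_real (v + 2 * lam K) * (g u / (u - of_real (lam K)))"
        using that by (simp add: P_Suc gu distrib_left)
      finally show ?thesis by (simp add: diff_divide_distrib)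
    qed
    ultimately show ?case by blast
  qed
  then obtain g where g: "pole_sum lam K g"
    and gF: "\<And>u. (\<forall>k. u \<noteq> of_real (lam k)) \<Longrightarrow>
      (\<forall>k. u + of_real v + of_real (lam k) \<noteq> 0) \<Longrightarrow> F K u * P K u = g u"
    by blast
  obtain c where "\<And>u. (\<forall>k. u \<noteq> of_real (lam k)) \<Longrightarrow> g u = (\<Sum>k<K. c k / (u - of_real (lam k)))"
    using g unfolding pole_sum_def by blast
  with gF show ?thesis by (intro that[of c]) (simp add: F_def P_def)
qed

text \<open>On the left is the modulus of the Laplace transform of the exponential sum at u. The
  integral up to R has an explicit primitive, and the boundary terms exp (- (u + lam_k) R) vanish as
  R grows.\<close>

lemma Laplace_transform_bound:
  fixes lam :: "nat \<Rightarrow> real" and a :: "nat \<Rightarrow> complex"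
  assumes pos: "\<And>k. 0 < lam k" and u: "0 \<le> Re u"
  shows "ennreal (norm (\<Sum>k<K. a k / (u + of_real (lam k))))
    \<le> (\<integral>\<^sup>+s\<in>{0<..}. ennreal (norm (\<Sum>k<K. a k * of_real (exp (- lam k * s))) * exp (- Re u * s)) \<partial>lborel)"
    (is "_ \<le> ?I")
proof -
  define h where "h s = (\<Sum>k<K. a k * exp (- (u + of_real (lam k)) * of_real s))" for s :: real
  have norm_h: "norm (h s) = norm (\<Sum>k<K. a k * of_real (exp (- lam k * s))) * exp (- Re u * s)" for s
  proof -
    have "h s = (\<Sum>k<K. a k * of_real (exp (- lam k * s))) * exp (- u * of_real s)"
      unfolding h_def sum_distrib_right
      by (intro sum.cong refl) (simp add: exp_of_real[symmetric] exp_add[symmetric] algebra_simps)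
    then show ?thesis by (simp add: norm_mult)
  qed
  have nz: "u + of_real (lam k) \<noteq> 0" for k using pos[of k] u by (auto simp: complex_eq_iff)
  have trunc: "ennreal (norm (\<Sum>k<K. a k / (u + of_real (lam k)) * (1 - exp (- (u + of_real (lam k)) * of_real R)))) \<le> ?I"
    if R: "0 < R" for R
  proof -
    define H where "H s = (\<Sum>k<K. - (a k / (u + of_real (lam k)) * exp (- (u + of_real (lam k)) * of_real s)))" for s :: real
    have "(h has_integral (H R - H 0)) {0..R}"
    proof (rule fundamental_theorem_of_calculus)
      fix s assume "s \<in> {0..R}"
      show "(H has_vector_derivative h s) (at s within {0..R})"
        unfolding H_def h_def using nz
        by (auto intro!: derivative_eq_intros has_vector_derivative_real_field sum.cong simp: divide_simps)
          (simp add: algebra_simps)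
    qed (use R in auto)
    then have "norm (\<Sum>k<K. a k / (u + of_real (lam k)) * (1 - exp (- (u + of_real (lam k)) * of_real R)))
        = norm (integral {0..R} h)"
      by (simp add: integral_unique H_def sum_negf right_diff_distrib sum_subtractf)
    also have "ennreal \<dots> \<le> (\<integral>\<^sup>+s\<in>{0<..R}. ennreal (norm (h s)) \<partial>lborel)"
      unfolding h_def by (intro norm_integral_le_nn_integral continuous_intros)
    also have "\<dots> \<le> ?I" unfolding norm_h by (intro nn_integral_mono) (auto split: split_indicator)
    finally show ?thesis .
  qed
  have "((\<lambda>R. \<Sum>k<K. a k / (u + of_real (lam k)) * (1 - exp (- (u + of_real (lam k)) * of_real R)))
      \<longlongrightarrow> (\<Sum>k<K. a k / (u + of_real (lam k)) * (1 - 0))) at_top"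
  proof (intro tendsto_intros)
    fix k
    have "((\<lambda>R. exp (- (Re u + lam k) * R)) \<longlongrightarrow> 0) at_top"
      using pos[of k] u by real_asymp
    moreover have "norm (exp (- (u + of_real (lam k)) * of_real R)) = exp (- (Re u + lam k) * R)" for R
      by simp
    ultimately have "((\<lambda>R. norm (exp (- (u + of_real (lam k)) * of_real R))) \<longlongrightarrow> 0) at_top"
      by presburger
    then show "((\<lambda>R. exp (- (u + of_real (lam k)) * of_real R)) \<longlongrightarrow> 0) at_top"
      by (rule tendsto_norm_zero_cancel)
  qed
  then have "((\<lambda>R. ennreal (norm (\<Sum>k<K. a k / (u + of_real (lam k)) * (1 - exp (- (u + of_real (lam k)) * of_real R)))))
      \<longlongrightarrow> ennreal (norm (\<Sum>k<K. a k / (u + of_real (lam k))))) at_top"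
    by (intro tendsto_ennrealI tendsto_norm) simp
  then show ?thesis
  proof (rule tendsto_upperbound)
    show "\<forall>\<^sub>F R in at_top. ennreal (norm (\<Sum>k<K. a k / (u + of_real (lam k))
        * (1 - exp (- (u + of_real (lam k)) * of_real R)))) \<le> ?I"
      using eventually_gt_at_top[of 0] by (rule eventually_mono) (rule trunc)
  qed simp
qed

text \<open>Cauchy's formula is used twice: for exp (- w x), which writes the sum through its transform at
  - w, and for 1 / (u + w + v), which expresses the transform at - w through its values at u + v.
  The shift v leaves room for the weight exp (- v y) that comes from dt = exp (- y) dy.\<close>
lemma exponential_sum_kernel_bound:
  fixes lam :: "nat \<Rightarrow> real"
  assumes sparse: "log_sparse lam" and pos: "\<And>k. 0 < lam k" and inc: "strict_mono lam"
    and summ: "summable (\<lambda>k. 1 / lam k)" and v: "0 \<le> v"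
  obtains C where "0 < C" "\<And>K a x. 0 < x \<Longrightarrow>
    ennreal (norm (\<Sum>k<K. a k * of_real (exp (- lam k * x)) :: complex)) \<le> ennreal C *
      (\<integral>\<^sup>+s\<in>{0<..}. (\<integral>\<^sup>+r\<in>{0<..}. ennreal (exp (- s * x) / (s + r)) *
         (\<integral>\<^sup>+y\<in>{0<..}. ennreal (norm (\<Sum>k<K. a k * of_real (exp (- lam k * y)) :: complex) * exp (- (v + r) * y)) \<partial>lborel)
       \<partial>lborel) \<partial>lborel)"
proof -
  let ?D = "{Complex 1 1, Complex 1 (- 1)}"
  obtain M where M: "0 < M" and quot: "\<And>K s d. 0 < s \<Longrightarrow> d \<in> ?D \<Longrightarrow>
     (\<Prod>k<K. norm ((of_real s * d + of_real v + of_real (lam k)) / (of_real s * d - of_real (lam k)))) \<le> M"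
    using ray_quotient_bound[OF sparse pos inc summ v] by blast
  have inj: "inj lam" using inc by (rule strict_mono_imp_inj_on)
  \<comment> \<open>Each of the two applications of Cauchy's formula contributes two rays, and the
    product is estimated by M twice: this is the constant 4 M^2.\<close>
  have "ennreal (norm (\<Sum>k<K. a k * of_real (exp (- lam k * x)) :: complex)) \<le> ennreal (4 * M^2) *
      (\<integral>\<^sup>+s\<in>{0<..}. (\<integral>\<^sup>+r\<in>{0<..}. ennreal (exp (- s * x) / (s + r)) *
         (\<integral>\<^sup>+y\<in>{0<..}. ennreal (norm (\<Sum>k<K. a k * of_real (exp (- lam k * y)) :: complex) * exp (- (v + r) * y)) \<partial>lborel)
       \<partial>lborel) \<partial>lborel)" if x: "0 < x" for K a x
  proof -
    define f where "f y = (\<Sum>k<K. a k * of_real (exp (- lam k * y)) :: complex)" for y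
    have [measurable]: "f \<in> borel_measurable borel" unfolding f_def by measurable
    define I where "I r = (\<integral>\<^sup>+y\<in>{0<..}. ennreal (norm (f y) * exp (- (v + r) * y)) \<partial>lborel)" for r
    have [measurable]: "I \<in> borel_measurable borel" unfolding I_def by measurable
    define J where "J s = (\<integral>\<^sup>+r\<in>{0<..}. ennreal (1 / (s + r)) * I r \<partial>lborel)" for s
    have [measurable]: "J \<in> borel_measurable borel" unfolding J_def by measurable
    obtain c where c: "\<And>u. (\<And>k. u \<noteq> of_real (lam k)) \<Longrightarrow> (\<And>k. u + of_real v + of_real (lam k) \<noteq> 0) \<Longrightarrow>
      (\<Sum>k<K. a k / (u + of_real v + of_real (lam k)))
        * (\<Prod>k<K. (u + of_real v + of_real (lam k)) / (u - of_real (lam k)))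
      = (\<Sum>k<K. c k / (u - of_real (lam k)))"
      using partial_fractions[OF inj] by blast
    define S where "S w = (\<Sum>k<K. a k / (w - of_real (lam k)))" for w
    define T where "T w = (\<Sum>k<K. c k / (w - of_real (lam k)))" for w
    have off: "of_real s * d \<noteq> of_real (lam k)" "of_real s * d + of_real v + of_real (lam k) \<noteq> 0"
      if "0 < s" "d \<in> ?D" for s d k
      using that by (auto simp: complex_eq_iff)
    \<comment> \<open>T is the Laplace transform at u + v times the product. The first factor is at
      most I r because Re (u + v) = v + r, the second at most M.\<close>
    have T_bound: "ennreal (norm (T (of_real r * d))) \<le> ennreal M * I r" if r: "0 < r" and d: "d \<in> ?D" for r d
    proof -
      let ?u = "of_real r * d"
      have "norm (T ?u) = norm (\<Sum>k<K. a k / (?u + of_real v + of_real (lam k)))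
          * (\<Prod>k<K. norm ((?u + of_real v + of_real (lam k)) / (?u - of_real (lam k))))"
        using c[of ?u] off[OF r d] by (simp add: T_def norm_mult[symmetric] prod_norm)
      also have "\<dots> \<le> norm (\<Sum>k<K. a k / (?u + of_real v + of_real (lam k))) * M"
        by (intro mult_left_mono quot r d) auto
      finally have T_le: "ennreal (norm (T ?u)) \<le> ennreal M * ennreal (norm (\<Sum>k<K. a k / ((?u + of_real v) + of_real (lam k))))"
        using M by (simp add: ennreal_mult[symmetric] mult.commute ennreal_leI)
      have "ennreal (norm (\<Sum>k<K. a k / ((?u + of_real v) + of_real (lam k))))
          \<le> (\<integral>\<^sup>+y\<in>{0<..}. ennreal (norm (\<Sum>k<K. a k * of_real (exp (- lam k * y))) * exp (- Re (?u + of_real v) * y)) \<partial>lborel)"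
        using r d v pos by (intro Laplace_transform_bound) auto
      also have "Re (?u + of_real v) = v + r" using d by auto
      finally have "ennreal (norm (\<Sum>k<K. a k / ((?u + of_real v) + of_real (lam k)))) \<le> I r"
        by (simp only: I_def f_def)
      then show ?thesis by (rule order_trans[OF T_le mult_left_mono]) simp
    qed
    have S_bound: "ennreal (norm (S (of_real s * d))) \<le> ennreal (2 * M^2) * J s" if s: "0 < s" and d: "d \<in> ?D" for s d
    proof -
      let ?w = "of_real s * d"
      \<comment> \<open>S is minus the transform at - w. The reflection w -> - w - v exchanges
        numerator and denominator of each factor up to sign, so the product at \<open>?u\<close> is
        the reciprocal of the product at w. Dividing by it thus costs only the bound M on the ray
        again.\<close>
      let ?u = "- ?w - of_real v"
      define g where "g u = 1 / (u + ?w + of_real v)" for u :: complex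
      have "norm (S ?w) = norm (\<Sum>k<K. a k / (?u + of_real v + of_real (lam k)))"
      proof -
        have "a k / (?u + of_real v + of_real (lam k)) = - (a k / (?w - of_real (lam k)))" for k
          by (metis (no_types) add.commute diff_add_cancel minus_diff_eq minus_divide_right uminus_add_conv_diff)
        then show ?thesis by (simp add: S_def sum_negf)
      qed
      moreover have "(\<Sum>k<K. a k / (?u + of_real v + of_real (lam k)))
          = (\<Sum>k<K. c k / (?u - of_real (lam k))) * (\<Prod>k<K. (?w + of_real v + of_real (lam k)) / (?w - of_real (lam k)))"
      proof -
        have "?u \<noteq> of_real (lam k)" "?u + of_real v + of_real (lam k) \<noteq> 0" for k
          using s d v pos[of k] by (auto simp: complex_eq_iff)
        then have "(\<Sum>k<K. c k / (?u - of_real (lam k)))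
          = (\<Sum>k<K. a k / (?u + of_real v + of_real (lam k)))
           * (\<Prod>k<K. (?u + of_real v + of_real (lam k)) / (?u - of_real (lam k)))"
          using c[of ?u] by simp
        moreover have "(\<Prod>k<K. (?u + of_real v + of_real (lam k)) / (?u - of_real (lam k)))
          * (\<Prod>k<K. (?w + of_real v + of_real (lam k)) / (?w - of_real (lam k))) = 1"
          unfolding prod.distrib[symmetric]
        proof (intro prod.neutral ballI)
          fix k
          define A B where "A = ?w - of_real (lam k)" and "B = ?w + of_real v + of_real (lam k)"
          have "A \<noteq> 0" "B \<noteq> 0" using off[OF s d, of k] by (auto simp: A_def B_def)
          moreover have "?u + of_real v + of_real (lam k) = - A" "?u - of_real (lam k) = - B"
            by (auto simp: A_def B_def)
          ultimately show "(?u + of_real v + of_real (lam k)) / (?u - of_real (lam k))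
            * ((?w + of_real v + of_real (lam k)) / (?w - of_real (lam k))) = 1"
            by (simp add: A_def[symmetric] B_def[symmetric])
        qed
        ultimately show ?thesis by (simp add: mult.assoc)
      qed
      ultimately have "norm (S ?w) = norm (\<Sum>k<K. c k / (?u - of_real (lam k)))
          * (\<Prod>k<K. norm ((?w + of_real v + of_real (lam k)) / (?w - of_real (lam k))))"
        by (simp add: norm_mult prod_norm)
      also have "\<dots> \<le> norm (\<Sum>k<K. c k / (?u - of_real (lam k))) * M"
        by (intro mult_left_mono quot s d) auto
      also have "(\<Sum>k<K. c k / (?u - of_real (lam k))) = - (\<Sum>k<K. c k * g (of_real (lam k)))"
      proof -
        have "c k / (?u - of_real (lam k)) = - (c k * g (of_real (lam k)))" for k
        proof -
          have "?u - of_real (lam k) = - (of_real (lam k) + ?w + of_real v)" by simp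
          then show ?thesis unfolding g_def by (metis minus_divide_right mult.right_neutral times_divide_eq_right)
        qed
        then show ?thesis by (simp add: sum_negf)
      qed
      finally have "ennreal (norm (S ?w)) \<le> ennreal M * ennreal (norm (\<Sum>k<K. c k * g (of_real (lam k))))"
        using M by (simp add: ennreal_mult[symmetric] mult.commute ennreal_leI)
      also have "ennreal (norm (\<Sum>k<K. c k * g (of_real (lam k))))
        \<le> (\<Sum>e\<in>?D. \<integral>\<^sup>+r\<in>{0<..}. ennreal (norm (g (of_real r * e)) * norm (\<Sum>k<K. c k / (of_real r * e - of_real (lam k)))) \<partial>lborel)"
      proof (rule sector_sum_bound[where \<delta> = s and m = "\<lambda>R. 1 / R"])
        show "g holomorphic_on {z. - s < Re z}"
          unfolding g_def
        proof (intro holomorphic_intros)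
          fix u assume "u \<in> {z. - s < Re z}"
          then have "0 < Re (u + ?w + of_real v)" using d v by auto
          then show "u + ?w + of_real v \<noteq> 0" by (metis less_irrefl zero_complex.sel(1))
        qed
        fix z :: complex assume z: "0 < Re z"
        have "Re z \<le> Re (z + ?w + of_real v)" using d s v by auto
        also have "\<dots> \<le> norm (z + ?w + of_real v)" by (rule complex_Re_le_cmod)
        finally show "norm (g z) \<le> 1 / Re z" using z by (simp add: g_def norm_divide frac_le)
      next
        show "((\<lambda>R::real. 1 / R) \<longlongrightarrow> 0) at_top"
          by (intro real_tendsto_divide_at_top[OF tendsto_const] filterlim_ident)
      qed (use s pos in auto)
      also have "\<dots> \<le> (\<Sum>e\<in>?D. ennreal M * J s)"
      proof (rule sum_mono)
        fix e assume e: "e \<in> ?D"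
        have "(\<integral>\<^sup>+r\<in>{0<..}. ennreal (norm (g (of_real r * e)) * norm (T (of_real r * e))) \<partial>lborel)
            \<le> (\<integral>\<^sup>+r. ennreal M * (ennreal (1 / (s + r)) * I r * indicator {0<..} r) \<partial>lborel)"
        proof (rule nn_integral_mono)
          fix r :: real
          show "ennreal (norm (g (of_real r * e)) * norm (T (of_real r * e))) * indicator {0<..} r
              \<le> ennreal M * (ennreal (1 / (s + r)) * I r * indicator {0<..} r)"
          proof (cases "0 < r")
            case True
            have "s + r \<le> Re (of_real r * e + ?w + of_real v)" using d e v by auto
            also have "\<dots> \<le> norm (of_real r * e + ?w + of_real v)" by (rule complex_Re_le_cmod)
            finally have "norm (g (of_real r * e)) \<le> 1 / (s + r)"
              using s True by (simp add: g_def norm_divide frac_le)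
            then have "ennreal (norm (g (of_real r * e))) * ennreal (norm (T (of_real r * e)))
                \<le> ennreal (1 / (s + r)) * (ennreal M * I r)"
              by (intro mult_mono ennreal_leI T_bound True e) auto
            then show ?thesis using True by (simp add: ennreal_mult mult_ac)
          qed simp
        qed
        also have "\<dots> = ennreal M * J s" unfolding J_def by (rule nn_integral_cmult) measurable
        finally show "(\<integral>\<^sup>+r\<in>{0<..}. ennreal (norm (g (of_real r * e)) * norm (\<Sum>k<K. c k / (of_real r * e - of_real (lam k)))) \<partial>lborel)
          \<le> ennreal M * J s" by (simp add: T_def)
      qed
      also have "\<dots> = 2 * (ennreal M * J s)" by (simp add: complex_eq_iff)
      also have "ennreal M * (2 * (ennreal M * J s)) = ennreal (2 * M^2) * J s"
        using M by (simp add: power2_eq_square ennreal_mult mult_ac)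
      finally show ?thesis by (simp add: mult_left_mono)
    qed
    have "ennreal (norm (f x)) = ennreal (norm (\<Sum>k<K. a k * exp (- of_real (lam k) * of_real x)))"
      by (simp add: f_def exp_of_real[symmetric])
    also have "\<dots> \<le> (\<Sum>d\<in>?D. \<integral>\<^sup>+s\<in>{0<..}. ennreal (norm (exp (- (of_real s * d) * of_real x))
        * norm (\<Sum>k<K. a k / (of_real s * d - of_real (lam k)))) \<partial>lborel)"
    proof (rule sector_sum_bound[where \<delta> = 1 and m = "\<lambda>R. exp (- R * x)"])
      show "(\<lambda>w. exp (- w * of_real x)) holomorphic_on {z. - 1 < Re z}" by (intro holomorphic_intros)
      show "((\<lambda>R. exp (- R * x)) \<longlongrightarrow> 0) at_top" using x by real_asymp
    qed (use pos in auto)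
    also have "\<dots> \<le> (\<Sum>d\<in>?D. ennreal (2 * M^2) * (\<integral>\<^sup>+s\<in>{0<..}. ennreal (exp (- s * x)) * J s \<partial>lborel))"
    proof (rule sum_mono)
      fix d assume d: "d \<in> ?D"
      have "(\<integral>\<^sup>+s\<in>{0<..}. ennreal (norm (exp (- (of_real s * d) * of_real x)) * norm (S (of_real s * d))) \<partial>lborel)
          \<le> (\<integral>\<^sup>+s. ennreal (2 * M^2) * (ennreal (exp (- s * x)) * J s * indicator {0<..} s) \<partial>lborel)"
      proof (rule nn_integral_mono)
        fix s :: real
        show "ennreal (norm (exp (- (of_real s * d) * of_real x)) * norm (S (of_real s * d))) * indicator {0<..} s
            \<le> ennreal (2 * M^2) * (ennreal (exp (- s * x)) * J s * indicator {0<..} s)"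
        proof (cases "0 < s")
          case True
          have "norm (exp (- (of_real s * d) * of_real x)) = exp (- s * x)" using d by auto
          then have "ennreal (norm (exp (- (of_real s * d) * of_real x)) * norm (S (of_real s * d)))
              \<le> ennreal (exp (- s * x)) * (ennreal (2 * M^2) * J s)"
            by (simp only: ennreal_mult norm_ge_zero exp_ge_zero) (intro mult_left_mono S_bound True d, simp)
          then show ?thesis using True by (simp add: mult_ac)
        qed simp
      qed
      also have "\<dots> = ennreal (2 * M^2) * (\<integral>\<^sup>+s\<in>{0<..}. ennreal (exp (- s * x)) * J s \<partial>lborel)"
        by (rule nn_integral_cmult) measurable
      finally show "(\<integral>\<^sup>+s\<in>{0<..}. ennreal (norm (exp (- (of_real s * d) * of_real x))
        * norm (\<Sum>k<K. a k / (of_real s * d - of_real (lam k)))) \<partial>lborel)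
        \<le> ennreal (2 * M^2) * (\<integral>\<^sup>+s\<in>{0<..}. ennreal (exp (- s * x)) * J s \<partial>lborel)"
        by (simp add: S_def)
    qed
    also have "\<dots> = 2 * (ennreal (2 * M^2) * (\<integral>\<^sup>+s\<in>{0<..}. ennreal (exp (- s * x)) * J s \<partial>lborel))"
      by (simp add: complex_eq_iff)
    also have "\<dots> = ennreal (4 * M^2) * (\<integral>\<^sup>+s\<in>{0<..}. ennreal (exp (- s * x)) * J s \<partial>lborel)"
    proof -
      have "ennreal 2 * ennreal (2 * M^2) = ennreal (2 * (2 * M^2))"
        by (rule ennreal_mult[symmetric]) auto
      then show ?thesis by (simp add: mult.assoc[symmetric])
    qed
    also have "(\<integral>\<^sup>+s\<in>{0<..}. ennreal (exp (- s * x)) * J s \<partial>lborel)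
        = (\<integral>\<^sup>+s\<in>{0<..}. (\<integral>\<^sup>+r\<in>{0<..}. ennreal (exp (- s * x) / (s + r)) * I r \<partial>lborel) \<partial>lborel)"
    proof (rule nn_integral_cong)
      fix s :: real
      have "ennreal (exp (- s * x)) * J s
          = (\<integral>\<^sup>+r. ennreal (exp (- s * x)) * (ennreal (1 / (s + r)) * I r * indicator {0<..} r) \<partial>lborel)"
        unfolding J_def by (rule nn_integral_cmult[symmetric]) measurable
      also have "\<dots> = (\<integral>\<^sup>+r\<in>{0<..}. ennreal (exp (- s * x) / (s + r)) * I r \<partial>lborel)" if "0 < s"
        using that by (intro nn_integral_cong)
          (auto split: split_indicator simp: mult.assoc[symmetric] ennreal_mult[symmetric])
      finally show "ennreal (exp (- s * x)) * J s * indicator {0<..} s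
        = (\<integral>\<^sup>+r\<in>{0<..}. ennreal (exp (- s * x) / (s + r)) * I r \<partial>lborel) * indicator {0<..} s"
        by (auto split: split_indicator)
    qed
    finally show ?thesis by (simp only: f_def I_def)
  qed
  moreover have "0 < 4 * M^2" using M by simp
  ultimately show ?thesis using that by blast
qed

section \<open>Schur test and increasing majorants\<close>

text \<open>The inequality s^b r^(1 - b) <= s + r separates the variables into two Gamma integrals.
  The double integral is homogeneous of degree -1 in (x, y), as is every bound x^(b - 1) y^(- b);
  the freedom in b is exploited by the next kernel.\<close>

lemma double_Laplace_kernel_bound:
  fixes x y b :: real
  assumes xy: "0 < x" "0 < y" and b: "0 < b" "b < 1"
  shows "(\<integral>\<^sup>+s\<in>{0<..}. (\<integral>\<^sup>+r\<in>{0<..}. ennreal (exp (- s * x) / (s + r) * exp (- r * y)) \<partial>lborel) \<partial>lborel)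
    \<le> ennreal (Gamma (1 - b) * Gamma b * (x powr (b - 1) * y powr (- b)))"
proof -
  have G: "0 < Gamma b" "0 < Gamma (1 - b)" using b by (auto intro: Gamma_real_pos)
  have split: "exp (- s * x) / (s + r) * exp (- r * y)
      \<le> (s powr ((1 - b) - 1) * exp (- x * s)) * (r powr (b - 1) * exp (- y * r))" if sr: "0 < s" "0 < r" for s r
  proof -
    have "s powr b * r powr (1 - b) \<le> (s + r) powr b * (s + r) powr (1 - b)"
      using sr b by (intro mult_mono powr_mono2) auto
    also have "\<dots> = s + r" using sr by (simp add: powr_add[symmetric])
    finally have "1 / (s + r) \<le> 1 / (s powr b * r powr (1 - b))"
      using sr by (intro divide_left_mono) (auto intro!: mult_pos_pos)
    also have "\<dots> = s powr (- b) * r powr (- (1 - b))"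
      by (simp only: powr_minus divide_inverse inverse_mult_distrib mult_1)
    also have "- (1 - b) = b - 1" by simp
    finally have "1 / (s + r) * (exp (- s * x) * exp (- r * y)) \<le> s powr (- b) * r powr (b - 1) * (exp (- s * x) * exp (- r * y))"
      by (intro mult_right_mono) auto
    then show ?thesis by (simp add: mult_ac)
  qed
  have "(\<integral>\<^sup>+s\<in>{0<..}. (\<integral>\<^sup>+r\<in>{0<..}. ennreal (exp (- s * x) / (s + r) * exp (- r * y)) \<partial>lborel) \<partial>lborel)
      \<le> (\<integral>\<^sup>+s. (ennreal (s powr ((1 - b) - 1) * exp (- x * s)) * indicator {0<..} s)
          * (\<integral>\<^sup>+r\<in>{0<..}. ennreal (r powr (b - 1) * exp (- y * r)) \<partial>lborel) \<partial>lborel)"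
  proof (rule nn_integral_mono)
    fix s :: real
    show "(\<integral>\<^sup>+r\<in>{0<..}. ennreal (exp (- s * x) / (s + r) * exp (- r * y)) \<partial>lborel) * indicator {0<..} s
      \<le> (ennreal (s powr ((1 - b) - 1) * exp (- x * s)) * indicator {0<..} s)
          * (\<integral>\<^sup>+r\<in>{0<..}. ennreal (r powr (b - 1) * exp (- y * r)) \<partial>lborel)"
    proof (cases "0 < s")
      case True
      have "(\<integral>\<^sup>+r\<in>{0<..}. ennreal (exp (- s * x) / (s + r) * exp (- r * y)) \<partial>lborel)
          \<le> (\<integral>\<^sup>+r. ennreal (s powr ((1 - b) - 1) * exp (- x * s)) * (ennreal (r powr (b - 1) * exp (- y * r)) * indicator {0<..} r) \<partial>lborel)"
        using split[OF True] by (intro nn_integral_mono)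
          (auto split: split_indicator simp: ennreal_mult[symmetric] intro!: ennreal_leI simp del: minus_diff_eq)
      also have "\<dots> = ennreal (s powr ((1 - b) - 1) * exp (- x * s)) * (\<integral>\<^sup>+r\<in>{0<..}. ennreal (r powr (b - 1) * exp (- y * r)) \<partial>lborel)"
        by (rule nn_integral_cmult) measurable
      finally show ?thesis using True by simp
    qed simp
  qed
  also have "\<dots> = (\<integral>\<^sup>+s\<in>{0<..}. ennreal (s powr ((1 - b) - 1) * exp (- x * s)) \<partial>lborel)
      * (\<integral>\<^sup>+r\<in>{0<..}. ennreal (r powr (b - 1) * exp (- y * r)) \<partial>lborel)"
    by (rule nn_integral_multc) measurable
  also have "\<dots> = ennreal (Gamma (1 - b) * x powr (- (1 - b))) * ennreal (Gamma b * y powr (- b))"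
    using xy b by (subst (1 2) nn_integral_powr_exp) auto
  also have "\<dots> = ennreal (Gamma (1 - b) * Gamma b * (x powr (b - 1) * y powr (- b)))"
    using G by (simp add: ennreal_mult[symmetric] mult_ac)
  finally show ?thesis .
qed

text \<open>The minimum of the bounds of the previous lemma for b = (1 - a) / 2 and b = 1 - a / 2: the
  exponents lie on both sides of 1 - a, so the kernel can be integrated against the weights of
  Schur's test both near 0 and near infinity.\<close>
definition schur_kernel :: "real \<Rightarrow> real \<Rightarrow> real \<Rightarrow> real" where
  "schur_kernel a x y = min (x powr ((1 - a) / 2 - 1) * y powr (- ((1 - a) / 2)))
     (x powr (- a / 2) * y powr (a / 2 - 1))"

lemma schur_kernel_nonneg: "0 \<le> schur_kernel a x y"
  by (simp add: schur_kernel_def)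

lemma schur_kernel_measurable [measurable]:
  "(\<lambda>(x, y). schur_kernel a x y) \<in> borel_measurable (borel \<Otimes>\<^sub>M borel)"
  unfolding schur_kernel_def by measurable

lemma schur_kernel_antimono:
  assumes "0 < a" "a < 1" "0 < x" "x \<le> x'"
  shows "schur_kernel a x' y \<le> schur_kernel a x y"
  unfolding schur_kernel_def using assms
  by (intro min.mono mult_right_mono powr_mono2') auto

text \<open>Interchanging the integrals makes y outermost, and the inner two form the double Laplace
  kernel. C adds the Gamma factors belonging to both values of b, so that one constant serves both
  entries of the minimum.\<close>

lemma triple_Laplace_bound:
  fixes a x :: real and f :: "real \<Rightarrow> real"
  assumes a: "0 < a" "a < 1" and x: "0 < x"
    and f [measurable]: "f \<in> borel_measurable borel" "\<And>y. 0 \<le> f y"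
  defines "C \<equiv> Gamma ((1 - a) / 2) * Gamma (1 - (1 - a) / 2) + Gamma (a / 2) * Gamma (1 - a / 2)"
  shows "(\<integral>\<^sup>+s\<in>{0<..}. (\<integral>\<^sup>+r\<in>{0<..}. ennreal (exp (- s * x) / (s + r)) *
      (\<integral>\<^sup>+y\<in>{0<..}. ennreal (f y * exp (- r * y)) \<partial>lborel) \<partial>lborel) \<partial>lborel)
    \<le> ennreal C * (\<integral>\<^sup>+y\<in>{0<..}. ennreal (schur_kernel a x y * f y) \<partial>lborel)"
proof -
  have G: "0 < Gamma ((1 - a) / 2)" "0 < Gamma (1 - (1 - a) / 2)" "0 < Gamma (a / 2)" "0 < Gamma (1 - a / 2)"
    using a by (auto intro!: Gamma_real_pos simp: field_simps)
  define i where "i = (indicator {0<..} :: real \<Rightarrow> ennreal)"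
  define k where "k s r y = ennreal (exp (- s * x) / (s + r) * exp (- r * y))" for s r y
  have [measurable]: "i \<in> borel_measurable borel" by (simp add: i_def)
  have "(\<integral>\<^sup>+s\<in>{0<..}. (\<integral>\<^sup>+r\<in>{0<..}. ennreal (exp (- s * x) / (s + r)) *
      (\<integral>\<^sup>+y\<in>{0<..}. ennreal (f y * exp (- r * y)) \<partial>lborel) \<partial>lborel) \<partial>lborel)
     = (\<integral>\<^sup>+s. (\<integral>\<^sup>+r. (\<integral>\<^sup>+y. (i s * i r * k s r y) * (i y * ennreal (f y)) \<partial>lborel) \<partial>lborel) \<partial>lborel)"
  proof -
    have "ennreal (exp (- s * x) / (s + r)) * (\<integral>\<^sup>+y\<in>{0<..}. ennreal (f y * exp (- r * y)) \<partial>lborel) * i r * i s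
      = (\<integral>\<^sup>+y. (i s * i r * k s r y) * (i y * ennreal (f y)) \<partial>lborel)" for s r
    proof (cases "0 < s \<and> 0 < r")
      case True
      have "ennreal (exp (- s * x) / (s + r)) * (\<integral>\<^sup>+y\<in>{0<..}. ennreal (f y * exp (- r * y)) \<partial>lborel)
          = (\<integral>\<^sup>+y. ennreal (exp (- s * x) / (s + r)) * (ennreal (f y * exp (- r * y)) * indicator {0<..} y) \<partial>lborel)"
        by (rule nn_integral_cmult[symmetric]) measurable
      also have "\<dots> = (\<integral>\<^sup>+y. k s r y * (i y * ennreal (f y)) \<partial>lborel)"
      proof (rule nn_integral_cong)
        fix y
        have "k s r y = ennreal (exp (- s * x) / (s + r)) * ennreal (exp (- r * y))"
          unfolding k_def using True by (intro ennreal_mult) auto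
        then show "ennreal (exp (- s * x) / (s + r)) * (ennreal (f y * exp (- r * y)) * indicator {0<..} y)
            = k s r y * (i y * ennreal (f y))"
          using f(2) by (simp add: i_def ennreal_mult mult_ac)
      qed
      finally show ?thesis using True by (simp add: i_def)
    qed (auto simp: i_def)
    then show ?thesis by (simp add: nn_integral_multc[symmetric] i_def[symmetric])
  qed
  also have "\<dots> = (\<integral>\<^sup>+s. (\<integral>\<^sup>+y. (\<integral>\<^sup>+r. (i s * i r * k s r y) * (i y * ennreal (f y)) \<partial>lborel) \<partial>lborel) \<partial>lborel)"
    unfolding k_def by (intro nn_integral_cong lborel_pair.Fubini') measurable
  also have "\<dots> = (\<integral>\<^sup>+y. (\<integral>\<^sup>+s. (\<integral>\<^sup>+r. (i s * i r * k s r y) * (i y * ennreal (f y)) \<partial>lborel) \<partial>lborel) \<partial>lborel)"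
    unfolding k_def by (intro lborel_pair.Fubini') measurable
  also have "\<dots> = (\<integral>\<^sup>+y. (\<integral>\<^sup>+s. (\<integral>\<^sup>+r. i s * i r * k s r y \<partial>lborel) \<partial>lborel) * (i y * ennreal (f y)) \<partial>lborel)"
    unfolding k_def by (simp add: nn_integral_multc)
  also have "\<dots> \<le> (\<integral>\<^sup>+y. ennreal C * (ennreal (schur_kernel a x y * f y) * indicator {0<..} y) \<partial>lborel)"
  proof (rule nn_integral_mono)
    fix y :: real
    show "(\<integral>\<^sup>+s. (\<integral>\<^sup>+r. i s * i r * k s r y \<partial>lborel) \<partial>lborel) * (i y * ennreal (f y))
      \<le> ennreal C * (ennreal (schur_kernel a x y * f y) * indicator {0<..} y)"
    proof (cases "0 < y")
      case True
      have eq: "(\<integral>\<^sup>+s. (\<integral>\<^sup>+r. i s * i r * k s r y \<partial>lborel) \<partial>lborel)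
          = (\<integral>\<^sup>+s\<in>{0<..}. (\<integral>\<^sup>+r\<in>{0<..}. ennreal (exp (- s * x) / (s + r) * exp (- r * y)) \<partial>lborel) \<partial>lborel)"
        unfolding k_def i_def by (intro nn_integral_cong) (auto split: split_indicator simp: mult.commute)
      have "(\<integral>\<^sup>+s. (\<integral>\<^sup>+r. i s * i r * k s r y \<partial>lborel) \<partial>lborel) \<le> ennreal (C * (x powr (b - 1) * y powr (- b)))"
        if b: "b = (1 - a) / 2 \<or> b = 1 - a / 2" for b
      proof -
        have "(\<integral>\<^sup>+s. (\<integral>\<^sup>+r. i s * i r * k s r y \<partial>lborel) \<partial>lborel)
            \<le> ennreal (Gamma (1 - b) * Gamma b * (x powr (b - 1) * y powr (- b)))"
          unfolding eq using b a by (intro double_Laplace_kernel_bound x True) auto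
        also have "\<dots> \<le> ennreal (C * (x powr (b - 1) * y powr (- b)))"
        proof (intro ennreal_leI mult_right_mono)
          have "0 \<le> Gamma ((1 - a) / 2) * Gamma (1 - (1 - a) / 2)" "0 \<le> Gamma (a / 2) * Gamma (1 - a / 2)"
            using G by auto
          moreover from b have "Gamma (1 - b) * Gamma b = Gamma ((1 - a) / 2) * Gamma (1 - (1 - a) / 2)
            \<or> Gamma (1 - b) * Gamma b = Gamma (a / 2) * Gamma (1 - a / 2)"
            by (elim disjE) (simp_all only: mult.commute diff_diff_cancel, simp_all)
          ultimately show "Gamma (1 - b) * Gamma b \<le> C" unfolding C_def by linarith
        qed auto
        finally show ?thesis .
      qed
      from this[of "(1 - a) / 2"] this[of "1 - a / 2"]
      have "(\<integral>\<^sup>+s. (\<integral>\<^sup>+r. i s * i r * k s r y \<partial>lborel) \<partial>lborel) \<le> ennreal (C * schur_kernel a x y)"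
        by (simp add: schur_kernel_def min_def)
      then have "(\<integral>\<^sup>+s. (\<integral>\<^sup>+r. i s * i r * k s r y \<partial>lborel) \<partial>lborel) * ennreal (f y)
          \<le> ennreal (C * schur_kernel a x y) * ennreal (f y)" by (rule mult_right_mono) simp
      moreover have "0 \<le> C" using G by (simp add: C_def)
      ultimately show ?thesis using True f(2)[of y] schur_kernel_nonneg[of a x y]
        by (simp add: i_def ennreal_mult[symmetric] mult.assoc)
    qed (simp add: i_def)
  qed
  also have "\<dots> = ennreal C * (\<integral>\<^sup>+y\<in>{0<..}. ennreal (schur_kernel a x y * f y) \<partial>lborel)"
    by (rule nn_integral_cmult) measurable
  finally show ?thesis .
qed

text \<open>For y <= x the first entry of the minimum leaves the exponent - (1 + a) / 2 > - 1, and
  for y >= x the second leaves - a / 2 - 1 < - 1, so both pieces converge.\<close>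

lemma schur_kernel_integral_right:
  assumes a: "0 < a" "a < 1" and x: "0 < x"
  shows "(\<integral>\<^sup>+y\<in>{0<..}. ennreal (schur_kernel a x y * y powr (- a)) \<partial>lborel)
    \<le> ennreal ((2 / (1 - a) + 2 / a) * x powr (- a))"
proof -
  let ?p = "x powr ((1 - a) / 2 - 1)" and ?q = "x powr (- a / 2)"
  have "(\<integral>\<^sup>+y\<in>{0<..}. ennreal (schur_kernel a x y * y powr (- a)) \<partial>lborel)
      \<le> (\<integral>\<^sup>+y. ennreal ?p * (ennreal (y powr (- (1 + a) / 2)) * indicator {0..x} y)
         + ennreal ?q * (ennreal (y powr (- a / 2 - 1)) * indicator {x..} y) \<partial>lborel)"
  proof (rule nn_integral_mono)
    fix y :: real
    have 1: "schur_kernel a x y * y powr (- a) \<le> ?p * y powr (- (1 + a) / 2)"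
    proof -
      have "schur_kernel a x y * y powr (- a) \<le> (?p * y powr (- ((1 - a) / 2))) * y powr (- a)"
        by (intro mult_right_mono) (auto simp: schur_kernel_def)
      also have "\<dots> = ?p * y powr (- ((1 - a) / 2) + - a)" by (simp only: mult.assoc powr_add[symmetric])
      also have "- ((1 - a) / 2) + - a = - (1 + a) / 2" by (simp add: field_simps)
      finally show ?thesis .
    qed
    have 2: "schur_kernel a x y * y powr (- a) \<le> ?q * y powr (- a / 2 - 1)"
    proof -
      have "schur_kernel a x y * y powr (- a) \<le> (?q * y powr (a / 2 - 1)) * y powr (- a)"
        by (intro mult_right_mono) (auto simp: schur_kernel_def)
      also have "\<dots> = ?q * y powr ((a / 2 - 1) + - a)" by (simp only: mult.assoc powr_add[symmetric])
      also have "(a / 2 - 1) + - a = - a / 2 - 1" by (simp add: field_simps)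
      finally show ?thesis .
    qed
    show "ennreal (schur_kernel a x y * y powr (- a)) * indicator {0<..} y
      \<le> ennreal ?p * (ennreal (y powr (- (1 + a) / 2)) * indicator {0..x} y)
         + ennreal ?q * (ennreal (y powr (- a / 2 - 1)) * indicator {x..} y)"
      using ennreal_leI[OF 1] ennreal_leI[OF 2]
      by (cases "0 < y"; cases "y \<le> x") (auto simp: ennreal_mult intro: order_trans split: split_indicator)
  qed
  also have "\<dots> = ennreal ?p * (\<integral>\<^sup>+y\<in>{0..x}. ennreal (y powr (- (1 + a) / 2)) \<partial>lborel)
      + ennreal ?q * (\<integral>\<^sup>+y\<in>{x..}. ennreal (y powr (- a / 2 - 1)) \<partial>lborel)"
    by (subst nn_integral_add) (simp_all add: nn_integral_cmult)
  also have "\<dots> = ennreal ?p * ennreal (x powr ((1 - a) / 2) / ((1 - a) / 2))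
      + ennreal ?q * ennreal (x powr (- a / 2) / (a / 2))"
  proof -
    have e: "- (1 + a) / 2 + 1 = (1 - a) / 2" "- a / 2 - 1 + 1 = - a / 2" "- (- a / 2 - 1) - 1 = a / 2"
      by (simp_all add: field_simps)
    show ?thesis
      using nn_integral_powr_from_0[of "- (1 + a) / 2" x] nn_integral_powr_to_inf[of "- a / 2 - 1" x] a x
      by (simp only: e) (simp add: field_simps)
  qed
  also have "\<dots> = ennreal (?p * (x powr ((1 - a) / 2) / ((1 - a) / 2)) + ?q * (x powr (- a / 2) / (a / 2)))"
    using a by (simp add: ennreal_mult[symmetric] ennreal_plus[symmetric] del: ennreal_plus)
  also have "?p * (x powr ((1 - a) / 2) / ((1 - a) / 2)) = 2 / (1 - a) * x powr (- a)"
    by (simp add: powr_add[symmetric] field_simps)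
  also have "?q * (x powr (- a / 2) / (a / 2)) = 2 / a * x powr (- a)"
    by (simp add: powr_add[symmetric])
  finally show ?thesis by (simp add: distrib_right)
qed

text \<open>The interchange permutes the two entries of the minimum; it turns the weighted integral
  in y into the weighted integral in x.\<close>

lemma schur_kernel_swap: "schur_kernel a x y = schur_kernel (1 - a) y x"
proof -
  have "(1 - (1 - a)) / 2 = a / 2" "- (1 - a) / 2 = - ((1 - a) / 2)" "- (a / 2) = - a / 2" by (simp_all add: field_simps)
  then show ?thesis by (simp only: schur_kernel_def min.commute mult.commute)
qed

lemma schur_kernel_integral_left:
  assumes a: "0 < a" "a < 1" and y: "0 < y"
  shows "(\<integral>\<^sup>+x\<in>{0<..}. ennreal (schur_kernel a x y * x powr (- (1 - a))) \<partial>lborel)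
    \<le> ennreal ((2 / (1 - a) + 2 / a) * y powr (- (1 - a)))"
  using schur_kernel_integral_right[of "1 - a" y] a y
  by (subst schur_kernel_swap) (simp add: add.commute)

text \<open>This is Schur's test halted before the integration in x. Hoelder against the kernel
  bounds the r-th power of the sum by W x, a negative power of x times an integral of a kernel that
  decreases in x; hence W decreases. Integrating W completes the test. W takes extended values
  because V may be infinite.\<close>

lemma exponential_sum_majorant:
  fixes lam :: "nat \<Rightarrow> real"
  assumes sparse: "log_sparse lam" and pos: "\<And>k. 0 < lam k" and inc: "strict_mono lam"
    and summ: "summable (\<lambda>k. 1 / lam k)" and r: "1 < r"
  obtains C where "0 < C" "\<And>K a. \<exists>W \<in> borel_measurable borel.
      (\<forall>x x'. 0 < x \<longrightarrow> x \<le> x' \<longrightarrow> W x' \<le> W x) \<and>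
      (\<forall>x>0. ennreal (norm (\<Sum>k<K. a k * of_real (exp (- lam k * x)) :: complex) powr r) \<le> W x) \<and>
      (\<integral>\<^sup>+x\<in>{0<..}. W x \<partial>lborel)
        \<le> ennreal C * (\<integral>\<^sup>+x\<in>{0<..}. ennreal (norm (\<Sum>k<K. a k * of_real (exp (- lam k * x)) :: complex) powr r * exp (- x)) \<partial>lborel)"
proof -
  \<comment> \<open>With the shift 1 / r, the r-th power of f y exp (- al y) is (f y)^r exp (- y),
    which corresponds to the measure dt under t = exp (- y). The same exponent is the weight of
    Schur's test.\<close>
  define al where "al = 1 / r"
  have al: "0 < al" "al < 1" "al * r = 1" "0 \<le> al" "al * (r - 1) = 1 - al" using r by (auto simp: al_def field_simps)
  obtain C0 where C0: "0 < C0" and kernel: "\<And>K a x. 0 < x \<Longrightarrow>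
    ennreal (norm (\<Sum>k<K. a k * of_real (exp (- lam k * x)) :: complex)) \<le> ennreal C0 *
      (\<integral>\<^sup>+s\<in>{0<..}. (\<integral>\<^sup>+r\<in>{0<..}. ennreal (exp (- s * x) / (s + r)) *
         (\<integral>\<^sup>+y\<in>{0<..}. ennreal (norm (\<Sum>k<K. a k * of_real (exp (- lam k * y)) :: complex) * exp (- (al + r) * y)) \<partial>lborel)
       \<partial>lborel) \<partial>lborel)"
    using exponential_sum_kernel_bound[OF sparse pos inc summ al(4)] by blast
  define C1 where "C1 = Gamma ((1 - al) / 2) * Gamma (1 - (1 - al) / 2) + Gamma (al / 2) * Gamma (1 - al / 2)"
  have "0 < Gamma ((1 - al) / 2) * Gamma (1 - (1 - al) / 2)" "0 < Gamma (al / 2) * Gamma (1 - al / 2)"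
    using al by (auto intro!: mult_pos_pos Gamma_real_pos simp: field_simps)
  then have C1: "0 < C1" by (simp add: C1_def)
  define A where "A = 2 / (1 - al) + 2 / al"
  have A: "0 < A" using al by (simp add: A_def add_pos_pos)
  define c where "c = (C0 * C1) powr r * A powr (r - 1)"
  have c: "0 < c" using C0 C1 A by (simp add: c_def)
  have main: "\<exists>W \<in> borel_measurable borel.
      (\<forall>x x'. 0 < x \<longrightarrow> x \<le> x' \<longrightarrow> W x' \<le> W x) \<and>
      (\<forall>x>0. ennreal (norm (\<Sum>k<K. a k * of_real (exp (- lam k * x)) :: complex) powr r) \<le> W x) \<and>
      (\<integral>\<^sup>+x\<in>{0<..}. W x \<partial>lborel)
        \<le> ennreal (c * A) * (\<integral>\<^sup>+x\<in>{0<..}. ennreal (norm (\<Sum>k<K. a k * of_real (exp (- lam k * x)) :: complex) powr r * exp (- x)) \<partial>lborel)"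
    for K a
  proof -
    define f where "f y = norm (\<Sum>k<K. a k * of_real (exp (- lam k * y)) :: complex)" for y
    have [measurable]: "f \<in> borel_measurable borel" unfolding f_def by measurable
    have f: "0 \<le> f y" for y by (simp add: f_def)
    define g where "g y = f y * exp (- al * y)" for y
    have [measurable]: "g \<in> borel_measurable borel" unfolding g_def by measurable
    have g: "0 \<le> g y" for y by (simp add: g_def f)
    have g_powr: "g y powr r = f y powr r * exp (- y)" for y
    proof -
      have "exp (- al * y) powr r = exp (- y)" using al(3) by (simp add: exp_powr_real mult.commute mult.left_commute)
      then show ?thesis using f by (simp add: g_def powr_mult)
    qed
    have f_kernel: "ennreal (f x) \<le> ennreal (C0 * C1) * (\<integral>\<^sup>+y\<in>{0<..}. ennreal (schur_kernel al x y * g y) \<partial>lborel)"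
      if x: "0 < x" for x
    proof -
      have "ennreal (f x) \<le> ennreal C0 *
        (\<integral>\<^sup>+s\<in>{0<..}. (\<integral>\<^sup>+r\<in>{0<..}. ennreal (exp (- s * x) / (s + r)) *
          (\<integral>\<^sup>+y\<in>{0<..}. ennreal (f y * exp (- (al + r) * y)) \<partial>lborel) \<partial>lborel) \<partial>lborel)"
        using kernel[OF x] unfolding f_def .
      also have "(\<lambda>r y. f y * exp (- (al + r) * y)) = (\<lambda>r y. g y * exp (- r * y))"
        by (intro ext) (simp add: g_def mult.assoc exp_add[symmetric] algebra_simps)
      also have "ennreal C0 * (\<integral>\<^sup>+s\<in>{0<..}. (\<integral>\<^sup>+r\<in>{0<..}. ennreal (exp (- s * x) / (s + r)) *
          (\<integral>\<^sup>+y\<in>{0<..}. ennreal (g y * exp (- r * y)) \<partial>lborel) \<partial>lborel) \<partial>lborel)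
        \<le> ennreal C0 * (ennreal C1 * (\<integral>\<^sup>+y\<in>{0<..}. ennreal (schur_kernel al x y * g y) \<partial>lborel))"
        unfolding C1_def by (intro mult_left_mono triple_Laplace_bound al x g) auto
      finally show ?thesis using C0 C1 by (simp add: ennreal_mult mult.assoc)
    qed
    define V where "V x = (\<integral>\<^sup>+y\<in>{0<..}. ennreal (schur_kernel al x y * (y powr (1 - al) * g y powr r)) \<partial>lborel)" for x
    have [measurable]: "V \<in> borel_measurable borel" unfolding V_def by measurable
    define W where "W x = ennreal (c * x powr (- (1 - al))) * V x" for x
    have "W \<in> borel_measurable borel" unfolding W_def by measurable
    moreover have "W x' \<le> W x" if "0 < x" "x \<le> x'" for x x'
      unfolding W_def V_def
    proof (intro mult_mono ennreal_leI mult_left_mono nn_integral_mono mult_right_mono)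
      show "x' powr (- (1 - al)) \<le> x powr (- (1 - al))" using that al by (intro powr_mono2') auto
      show "schur_kernel al x' y \<le> schur_kernel al x y" for y
        using that al by (intro schur_kernel_antimono) auto
    qed (use c in \<open>auto simp: schur_kernel_nonneg\<close>)
    moreover have "ennreal (f x powr r) \<le> W x" if x: "0 < x" for x
    proof (cases "V x = top")
      case True
      then show ?thesis using c x by (simp add: W_def ennreal_mult_top)
    next
      case False
      then obtain B where B: "V x = ennreal B" "0 \<le> B" by (cases "V x") auto
      let ?i = "\<lambda>y. indicator {0<..} y :: real"
      \<comment> \<open>The factor y^(- al) y^al = 1 is inserted: the first half makes the kernel
        integrable in y, and the r-th power of g y^al, together with y^(- al), is y^(1 - al) g^r
        because al r = 1.\<close>
      have "(\<integral>\<^sup>+y. ennreal ((schur_kernel al x y * y powr (- al) * ?i y) * (g y * y powr al)) \<partial>lborel)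
          \<le> ennreal ((A * x powr (- al)) powr (1 - 1 / r) * B powr (1 / r))"
      proof (rule nn_integral_weighted_power_mean)
        have "(\<integral>\<^sup>+y. ennreal (schur_kernel al x y * y powr (- al) * ?i y) \<partial>lborel)
            = (\<integral>\<^sup>+y\<in>{0<..}. ennreal (schur_kernel al x y * y powr (- al)) \<partial>lborel)"
          by (intro nn_integral_cong) (auto split: split_indicator)
        also have "\<dots> \<le> ennreal (A * x powr (- al))"
          unfolding A_def by (rule schur_kernel_integral_right) (use al x in auto)
        finally show "(\<integral>\<^sup>+y. ennreal (schur_kernel al x y * y powr (- al) * ?i y) \<partial>lborel) \<le> ennreal (A * x powr (- al))" .
        have "(\<integral>\<^sup>+y. ennreal ((schur_kernel al x y * y powr (- al) * ?i y) * (g y * y powr al) powr r) \<partial>lborel) = V x"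
          unfolding V_def
        proof (intro nn_integral_cong)
          fix y
          have "y powr (- al) * (g y * y powr al) powr r = y powr (1 - al) * g y powr r" if "0 < y"
          proof -
            have "(g y * y powr al) powr r = g y powr r * y"
              using g al(3) that by (simp add: powr_mult powr_powr)
            moreover have "y powr (- al) * y = y powr (1 - al)"
              using that powr_add[of y "- al" 1] by simp
            ultimately show ?thesis by (metis mult.assoc mult.commute)
          qed
          then show "ennreal ((schur_kernel al x y * y powr (- al) * ?i y) * (g y * y powr al) powr r)
              = ennreal (schur_kernel al x y * (y powr (1 - al) * g y powr r)) * indicator {0<..} y"
            by (auto split: split_indicator simp: mult.assoc)
        qed
        then show "(\<integral>\<^sup>+y. ennreal ((schur_kernel al x y * y powr (- al) * ?i y) * (g y * y powr al) powr r) \<partial>lborel) \<le> ennreal B"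
          using B by simp
      qed (use schur_kernel_nonneg g r A B in \<open>auto split: split_indicator\<close>)
      also have "(\<integral>\<^sup>+y. ennreal ((schur_kernel al x y * y powr (- al) * ?i y) * (g y * y powr al)) \<partial>lborel)
          = (\<integral>\<^sup>+y\<in>{0<..}. ennreal (schur_kernel al x y * g y) \<partial>lborel)"
      proof (intro nn_integral_cong)
        fix y :: real
        show "ennreal ((schur_kernel al x y * y powr (- al) * ?i y) * (g y * y powr al))
          = ennreal (schur_kernel al x y * g y) * indicator {0<..} y"
        proof (cases "0 < y")
          case True
          then have "y powr (- al) * y powr al = 1" by (simp add: powr_add[symmetric])
          then have "schur_kernel al x y * y powr (- al) * (g y * y powr al) = schur_kernel al x y * g y"
            by (metis mult.assoc mult.commute mult.right_neutral)
          moreover have "?i y = 1" "indicator {0<..} y = (1 :: ennreal)" using True by auto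
          ultimately show ?thesis by (simp only: mult_1_right)
        qed simp
      qed
      finally have "(\<integral>\<^sup>+y\<in>{0<..}. ennreal (schur_kernel al x y * g y) \<partial>lborel)
        \<le> ennreal ((A * x powr (- al)) powr (1 - 1 / r) * B powr (1 / r))" .
      then have "ennreal (f x) \<le> ennreal (C0 * C1) * ennreal ((A * x powr (- al)) powr (1 - 1 / r) * B powr (1 / r))"
        by (intro order_trans[OF f_kernel[OF x]] mult_left_mono) auto
      then have "f x \<le> C0 * C1 * ((A * x powr (- al)) powr (1 - 1 / r) * B powr (1 / r))"
        using C0 C1 by (simp add: ennreal_mult[symmetric])
      then have "f x powr r \<le> (C0 * C1 * ((A * x powr (- al)) powr (1 - 1 / r) * B powr (1 / r))) powr r"
        using f r by (intro powr_mono2) auto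
      also have "\<dots> = (C0 * C1) powr r * ((A * x powr (- al)) powr ((1 - 1 / r) * r) * B)"
        using C0 C1 A B r by (simp add: powr_mult powr_powr mult.assoc)
      also have "(1 - 1 / r) * r = r - 1" using r by (simp add: field_simps)
      also have "(A * x powr (- al)) powr (r - 1) = A powr (r - 1) * x powr (- (1 - al))"
        using A al(5) by (simp add: powr_mult powr_powr)
      finally have "f x powr r \<le> c * x powr (- (1 - al)) * B" by (simp add: c_def mult_ac)
      then show ?thesis using c B by (simp add: W_def ennreal_mult[symmetric])
    qed
    moreover have "(\<integral>\<^sup>+x\<in>{0<..}. W x \<partial>lborel) \<le> ennreal (c * A) * (\<integral>\<^sup>+x\<in>{0<..}. ennreal (f x powr r * exp (- x)) \<partial>lborel)"
    proof -
      define i where "i = (indicator {0<..} :: real \<Rightarrow> ennreal)"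
      have [measurable]: "i \<in> borel_measurable borel" by (simp add: i_def)
      let ?k = "\<lambda>x y. ennreal (schur_kernel al x y * x powr (- (1 - al)))"
      let ?h = "\<lambda>y. ennreal (y powr (1 - al) * g y powr r) * i y"
      have "(\<integral>\<^sup>+x\<in>{0<..}. W x \<partial>lborel) = (\<integral>\<^sup>+x. ennreal c * (\<integral>\<^sup>+y. (?k x y * i x) * ?h y \<partial>lborel) \<partial>lborel)"
      proof (rule nn_integral_cong)
        fix x :: real
        have "W x * i x = ennreal c * (ennreal (x powr (- (1 - al))) * i x * V x)"
          using c by (simp add: W_def ennreal_mult mult_ac)
        also have "ennreal (x powr (- (1 - al))) * i x * V x
            = (\<integral>\<^sup>+y. ennreal (x powr (- (1 - al))) * i x * (ennreal (schur_kernel al x y * (y powr (1 - al) * g y powr r)) * indicator {0<..} y) \<partial>lborel)"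
          unfolding V_def by (rule nn_integral_cmult[symmetric]) measurable
        also have "\<dots> = (\<integral>\<^sup>+y. (?k x y * i x) * ?h y \<partial>lborel)"
          by (intro nn_integral_cong) (simp add: i_def ennreal_mult schur_kernel_nonneg mult_ac)
        finally show "W x * indicator {0<..} x = ennreal c * (\<integral>\<^sup>+y. (?k x y * i x) * ?h y \<partial>lborel)"
          by (simp add: i_def)
      qed
      also have "\<dots> = ennreal c * (\<integral>\<^sup>+x. (\<integral>\<^sup>+y. (?k x y * i x) * ?h y \<partial>lborel) \<partial>lborel)"
        by (rule nn_integral_cmult) measurable
      finally have outer: "(\<integral>\<^sup>+x\<in>{0<..}. W x \<partial>lborel)
        = ennreal c * (\<integral>\<^sup>+x. (\<integral>\<^sup>+y. (?k x y * i x) * ?h y \<partial>lborel) \<partial>lborel)" .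
      have "(\<integral>\<^sup>+x. (\<integral>\<^sup>+y. (?k x y * i x) * ?h y \<partial>lborel) \<partial>lborel)
          = (\<integral>\<^sup>+y. (\<integral>\<^sup>+x. (?k x y * i x) * ?h y \<partial>lborel) \<partial>lborel)"
        by (intro lborel_pair.Fubini') measurable
      also have "\<dots> = (\<integral>\<^sup>+y. (\<integral>\<^sup>+x. ?k x y * i x \<partial>lborel) * ?h y \<partial>lborel)"
        by (intro nn_integral_cong nn_integral_multc) measurable
      also have "\<dots> \<le> (\<integral>\<^sup>+y. ennreal A * (ennreal (f y powr r * exp (- y)) * indicator {0<..} y) \<partial>lborel)"
      proof (rule nn_integral_mono)
        fix y :: real
        show "(\<integral>\<^sup>+x. ?k x y * i x \<partial>lborel) * ?h y \<le> ennreal A * (ennreal (f y powr r * exp (- y)) * indicator {0<..} y)"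
        proof (cases "0 < y")
          case True
          have "(\<integral>\<^sup>+x. ?k x y * i x \<partial>lborel) \<le> ennreal (A * y powr (- (1 - al)))"
            unfolding i_def A_def by (rule schur_kernel_integral_left) (use al True in auto)
          then have "(\<integral>\<^sup>+x. ?k x y * i x \<partial>lborel) * ennreal (y powr (1 - al) * g y powr r)
              \<le> ennreal (A * y powr (- (1 - al))) * ennreal (y powr (1 - al) * g y powr r)"
            by (rule mult_right_mono) simp
          also have "\<dots> = ennreal (A * (y powr (- (1 - al)) * y powr (1 - al)) * g y powr r)"
            using A by (simp add: ennreal_mult[symmetric] mult_ac)
          also have "y powr (- (1 - al)) * y powr (1 - al) = 1"
            using True by (simp only: powr_add[symmetric]) simp
          finally show ?thesis using True A by (simp add: i_def g_powr ennreal_mult[symmetric])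
        qed (simp add: i_def)
      qed
      also have "\<dots> = ennreal A * (\<integral>\<^sup>+y\<in>{0<..}. ennreal (f y powr r * exp (- y)) \<partial>lborel)"
        by (rule nn_integral_cmult) measurable
      finally have "ennreal c * (\<integral>\<^sup>+x. (\<integral>\<^sup>+y. (?k x y * i x) * ?h y \<partial>lborel) \<partial>lborel)
        \<le> ennreal c * (ennreal A * (\<integral>\<^sup>+y\<in>{0<..}. ennreal (f y powr r * exp (- y)) \<partial>lborel))"
        by (rule mult_left_mono) simp
      also have "\<dots> = ennreal (c * A) * (\<integral>\<^sup>+y\<in>{0<..}. ennreal (f y powr r * exp (- y)) \<partial>lborel)"
        using A c by (simp add: ennreal_mult mult.assoc)
      finally show ?thesis unfolding outer .
    qed
    ultimately show ?thesis unfolding f_def by (intro bexI[of _ W] conjI allI impI)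
  qed
  have "0 < c * A" using c A by simp
  with main show ?thesis using that by blast
qed

section \<open>Muntz polynomials on the unit interval\<close>

lemma nn_integral_eq_set_lebesgue_integral:
  fixes h :: "real \<Rightarrow> real"
  assumes [measurable]: "h \<in> borel_measurable borel"
    and h: "\<And>t. t \<in> {0..1} \<Longrightarrow> 0 \<le> h t" "\<And>t. t \<in> {0..1} \<Longrightarrow> h t \<le> B"
  shows "(\<integral>\<^sup>+t\<in>{0..1}. ennreal (h t) \<partial>lborel) = ennreal (LINT t:{0..1}|lborel. h t)"
proof -
  have "integrable lborel (\<lambda>t. indicator {0..1} t *\<^sub>R h t)"
  proof (rule integrableI_bounded_set_indicator[where B = B])
    show "AE t in lborel. t \<in> {0..1} \<longrightarrow> norm (h t) \<le> B" using h by auto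
  qed auto
  then have "ennreal (LINT t:{0..1}|lborel. h t) = (\<integral>\<^sup>+t. ennreal (indicator {0..1} t *\<^sub>R h t) \<partial>lborel)"
    unfolding set_lebesgue_integral_def using h
    by (intro nn_integral_eq_integral[symmetric]) (auto split: split_indicator)
  also have "\<dots> = (\<integral>\<^sup>+t\<in>{0..1}. ennreal (h t) \<partial>lborel)"
    by (intro nn_integral_cong) (auto split: split_indicator)
  finally show ?thesis by simp
qed

lemma powr_le_one:
  fixes t l :: real
  assumes "t \<in> {0..1}" "0 < l"
  shows "t powr l \<le> 1"
  using assms by (intro powr_le1) auto

lemma Muntz_imp_measurable_bounded:
  assumes f: "f \<in> Muntz lam" and pos: "\<And>k. 0 < lam k"
  shows "f \<in> borel_measurable borel" "\<exists>B\<ge>0. \<forall>t\<in>{0..1}. norm (f t) \<le> B"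
proof -
  obtain K a where eq: "f = (\<lambda>t. \<Sum>k\<le>(K::nat). a k * complex_of_real (t powr lam k))"
    using f unfolding Muntz_def by blast
  show "f \<in> borel_measurable borel" unfolding eq by measurable
  have "norm (f t) \<le> (\<Sum>k\<le>K. norm (a k))" if t: "t \<in> {0..1}" for t
    unfolding eq
  proof (rule sum_norm_le)
    fix k
    show "norm (a k * complex_of_real (t powr lam k)) \<le> norm (a k)"
      using powr_le_one[OF t pos[of k]] by (simp add: norm_mult mult_left_le)
  qed
  then show "\<exists>B\<ge>0. \<forall>t\<in>{0..1}. norm (f t) \<le> B"
    by (intro exI[of _ "\<Sum>k\<le>K. norm (a k)"]) (auto intro: sum_nonneg)
qed

text \<open>The majorant W is transported by x = - ln t, which reverses monotonicity; the factor exp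
  (- x) coming from dt only lowers the integral. The endpoint t = 1 corresponds to x = 0, where
  nothing is known about W.\<close>

lemma Muntz_increasing_majorant:
  fixes lam :: "nat \<Rightarrow> real"
  assumes sparse: "log_sparse lam" and pos: "\<And>k. 0 < lam k" and inc: "strict_mono lam"
    and summ: "summable (\<lambda>k. 1 / lam k)" and r: "1 < r"
  obtains C where "0 < C" "\<And>f. f \<in> Muntz lam \<Longrightarrow> \<exists>U \<in> borel_measurable borel.
      (\<forall>t. 0 \<le> U t) \<and> (\<forall>t t'. 0 < t \<longrightarrow> t \<le> t' \<longrightarrow> t' < 1 \<longrightarrow> U t \<le> U t') \<and>
      (\<forall>t\<in>{0<..<1}. norm (f t) powr r \<le> U t) \<and>
      (\<integral>\<^sup>+t\<in>{0<..<1}. ennreal (U t) \<partial>lborel) \<le> ennreal (C * (LINT t:{0..1}|lborel. norm (f t) powr r))"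
proof -
  obtain C where C: "0 < C" and maj: "\<And>K a. \<exists>W \<in> borel_measurable borel.
      (\<forall>x x'. 0 < x \<longrightarrow> x \<le> x' \<longrightarrow> W x' \<le> W x) \<and>
      (\<forall>x>0. ennreal (norm (\<Sum>k<K. a k * of_real (exp (- lam k * x)) :: complex) powr r) \<le> W x) \<and>
      (\<integral>\<^sup>+x\<in>{0<..}. W x \<partial>lborel)
        \<le> ennreal C * (\<integral>\<^sup>+x\<in>{0<..}. ennreal (norm (\<Sum>k<K. a k * of_real (exp (- lam k * x)) :: complex) powr r * exp (- x)) \<partial>lborel)"
    using exponential_sum_majorant[OF sparse pos inc summ r] by blast
  have "\<exists>U \<in> borel_measurable borel.
      (\<forall>t. 0 \<le> U t) \<and> (\<forall>t t'. 0 < t \<longrightarrow> t \<le> t' \<longrightarrow> t' < 1 \<longrightarrow> U t \<le> U t') \<and>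
      (\<forall>t\<in>{0<..<1}. norm (f t) powr r \<le> U t) \<and>
      (\<integral>\<^sup>+t\<in>{0<..<1}. ennreal (U t) \<partial>lborel) \<le> ennreal (C * (LINT t:{0..1}|lborel. norm (f t) powr r))"
    if f: "f \<in> Muntz lam" for f
  proof -
    obtain K a where eq: "f = (\<lambda>t. \<Sum>k\<le>(K::nat). a k * complex_of_real (t powr lam k))"
      using f unfolding Muntz_def by blast
    have [measurable]: "f \<in> borel_measurable borel" using Muntz_imp_measurable_bounded[OF f pos] by blast
    obtain B where B: "0 \<le> B" "\<And>t. t \<in> {0..1} \<Longrightarrow> norm (f t) \<le> B"
      using Muntz_imp_measurable_bounded[OF f pos] by blast
    have f_exp: "f (exp (- x)) = (\<Sum>k<Suc K. a k * of_real (exp (- lam k * x)))" for x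
      unfolding eq by (simp add: lessThan_Suc_atMost exp_powr_real mult.commute)
    define N where "N = (LINT t:{0..1}|lborel. norm (f t) powr r)"
    have N0: "0 \<le> N" unfolding N_def set_lebesgue_integral_def by (intro integral_nonneg_AE) auto
    have "(\<integral>\<^sup>+x\<in>{0<..}. ennreal (norm (f (exp (- x))) powr r * exp (- x)) \<partial>lborel)
        = (\<integral>\<^sup>+t\<in>{0<..<1}. ennreal (norm (f t) powr r) \<partial>lborel)"
      by (subst nn_integral_exp_substitution) (simp_all add: ennreal_mult)
    also have "\<dots> = (\<integral>\<^sup>+t\<in>{0..1}. ennreal (norm (f t) powr r) \<partial>lborel)"
      by (rule nn_integral_cong_AE, use AE_lborel_singleton[of "0::real"] AE_lborel_singleton[of "1::real"] in eventually_elim)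
         (auto split: split_indicator)
    also have "\<dots> = ennreal N" unfolding N_def
      using B r by (intro nn_integral_eq_set_lebesgue_integral[where B = "B powr r"] powr_mono2) auto
    finally have N: "(\<integral>\<^sup>+x\<in>{0<..}. ennreal (norm (f (exp (- x))) powr r * exp (- x)) \<partial>lborel) = ennreal N" .
    obtain W where [measurable]: "W \<in> borel_measurable borel"
      and anti: "\<And>x x'. 0 < x \<Longrightarrow> x \<le> x' \<Longrightarrow> W x' \<le> W x"
      and W: "\<And>x. 0 < x \<Longrightarrow> ennreal (norm (f (exp (- x))) powr r) \<le> W x"
      and int: "(\<integral>\<^sup>+x\<in>{0<..}. W x \<partial>lborel)
        \<le> ennreal C * (\<integral>\<^sup>+x\<in>{0<..}. ennreal (norm (f (exp (- x))) powr r * exp (- x)) \<partial>lborel)"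
      using maj[where K = "Suc K" and a = a] unfolding f_exp by blast
    have int': "(\<integral>\<^sup>+x\<in>{0<..}. W x \<partial>lborel) \<le> ennreal (C * N)"
      using int unfolding N using C N0 by (simp add: ennreal_mult)
    \<comment> \<open>By monotonicity x W x is at most the integral of W over (0, x]; finiteness
      makes the passage to real values by \<open>enn2real\<close> faithful.\<close>
    have fin: "W x < top" if x: "0 < x" for x
    proof -
      have "W x * ennreal x = (\<integral>\<^sup>+y. W x * indicator {0<..x} y \<partial>lborel)"
        using x by (simp add: nn_integral_cmult_indicator)
      also have "\<dots> \<le> (\<integral>\<^sup>+y\<in>{0<..}. W y \<partial>lborel)"
        using anti by (intro nn_integral_mono) (auto split: split_indicator)
      also have "\<dots> \<le> ennreal (C * N)" by (rule int')
      finally have "W x * ennreal x < top" by (rule le_less_trans) simp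
      then show ?thesis using x by (auto simp: ennreal_mult_less_top less_top[symmetric] ennreal_mult_eq_top_iff top_unique)
    qed
    define U where "U t = enn2real (W (- ln t))" for t
    have EU: "ennreal (U t) = W (- ln t)" if "0 < t" "t < 1" for t
      unfolding U_def using fin[of "- ln t"] that by (intro ennreal_enn2real) (simp add: ln_less_zero)
    have "U \<in> borel_measurable borel" unfolding U_def by measurable
    moreover have "0 \<le> U t" for t by (simp add: U_def)
    moreover have "U t \<le> U t'" if t: "0 < t" "t \<le> t'" "t' < 1" for t t'
    proof -
      have "W (- ln t) \<le> W (- ln t')" using t by (intro anti) auto
      then show ?thesis unfolding U_def using fin[of "- ln t'"] t by (intro enn2real_mono) auto
    qed
    moreover have "norm (f t) powr r \<le> U t" if t: "t \<in> {0<..<1}" for t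
    proof -
      have "ennreal (norm (f t) powr r) \<le> ennreal (U t)"
        using W[of "- ln t"] t EU[of t] by simp
      then show ?thesis by (simp add: U_def)
    qed
    moreover have "(\<integral>\<^sup>+t\<in>{0<..<1}. ennreal (U t) \<partial>lborel) \<le> ennreal (C * N)"
    proof -
      have "(\<integral>\<^sup>+t\<in>{0<..<1}. ennreal (U t) \<partial>lborel) = (\<integral>\<^sup>+t\<in>{0<..<1}. W (- ln t) \<partial>lborel)"
        using EU by (intro nn_integral_cong) (auto split: split_indicator)
      also have "\<dots> = (\<integral>\<^sup>+x\<in>{0<..}. W x * ennreal (exp (- x)) \<partial>lborel)"
        by (subst nn_integral_exp_substitution) auto
      also have "\<dots> \<le> (\<integral>\<^sup>+x\<in>{0<..}. W x \<partial>lborel)"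
      proof (rule nn_integral_mono)
        fix x :: real
        show "W x * ennreal (exp (- x)) * indicator {0<..} x \<le> W x * indicator {0<..} x"
          using mult_left_mono[of "ennreal (exp (- x))" 1 "W x"]
          by (auto split: split_indicator)
      qed
      finally show ?thesis using int' by simp
    qed
    ultimately show ?thesis unfolding N_def by blast
  qed
  with C show ?thesis using that by blast
qed

text \<open>Reflection and the substitution t = exp (- x) turn the integral into the length of a
  half-line.\<close>

lemma nn_integral_inverse_one_minus: "(\<integral>\<^sup>+t\<in>{0<..<1}. ennreal (1 / (1 - t)) \<partial>lborel) = \<infinity>"
proof -
  have "(\<integral>\<^sup>+t\<in>{0<..<1}. ennreal (1 / (1 - t)) \<partial>lborel)
      = (\<integral>\<^sup>+t. ennreal (1 / (1 - t)) * indicator {0<..<1} (1 - t) \<partial>lborel)"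
    by (intro nn_integral_cong) (auto split: split_indicator)
  also have "\<dots> = (\<integral>\<^sup>+t\<in>{0<..<1}. ennreal (1 / t) \<partial>lborel)"
    by (rule nn_integral_reflect_shift) simp
  also have "\<dots> = (\<integral>\<^sup>+x\<in>{0<..}. ennreal (1 / exp (- x)) * ennreal (exp (- x)) \<partial>lborel)"
    by (rule nn_integral_exp_substitution) simp
  also have "\<dots> = (\<integral>\<^sup>+x. indicator {0<..} (x::real) \<partial>lborel)"
    by (intro nn_integral_cong) (simp add: ennreal_mult[symmetric])
  also have "\<dots> = \<infinity>"
  proof -
    have "emeasure lborel {0::real<..} = top"
    proof (rule ccontr)
      assume "emeasure lborel {0::real<..} \<noteq> top"
      then obtain c where c: "emeasure lborel {0::real<..} = ennreal c" "0 \<le> c"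
        by (cases "emeasure lborel {0::real<..}") auto
      have "emeasure lborel {0<..<c + 1} \<le> emeasure lborel {0::real<..}" by (intro emeasure_mono) auto
      then show False using c by simp
    qed
    then show ?thesis by simp
  qed
  finally show ?thesis .
qed

section \<open>The three implications\<close>

text \<open>The majorant controls f only inside (0, 1), so the point 1 must be negligible. A mass m
  there would make the inner integral at least m / (1 - \<rho>), and as the exponent 1 / (1 -
  \<beta>) exceeds 1 the outer integral would diverge.\<close>

lemma Carleson_integral_imp_null_endpoint:
  fixes nu :: "real measure" and \<beta> :: real
  assumes fin: "finite_measure nu" and sets [measurable_cong]: "sets nu = sets borel"
    and beta: "0 < \<beta>" "\<beta> < 1"
    and I: "(\<integral>\<^sup>+\<rho>\<in>{0..1}. ennpowr (\<integral>\<^sup>+t. ennreal (1 / (1 - \<rho> * t)) \<partial>nu) (1 / (1 - \<beta>)) \<partial>lborel) < \<infinity>"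
  shows "AE t in nu. t \<noteq> 1"
proof -
  interpret finite_measure nu by fact
  define m where "m = measure nu {1}"
  define s where "s = 1 / (1 - \<beta>)"
  have s: "1 < s" using beta by (simp add: s_def)
  have "m = 0"
  proof (rule ccontr)
    assume "m \<noteq> 0"
    then have m: "0 < m" by (simp add: m_def zero_less_measure_iff)
    have "(\<integral>\<^sup>+\<rho>. ennreal (m powr s) * (ennreal (1 / (1 - \<rho>)) * indicator {0<..<1} \<rho>) \<partial>lborel)
        \<le> (\<integral>\<^sup>+\<rho>\<in>{0..1}. ennpowr (\<integral>\<^sup>+t. ennreal (1 / (1 - \<rho> * t)) \<partial>nu) s \<partial>lborel)"
    proof (rule nn_integral_mono)
      fix \<rho> :: real
      show "ennreal (m powr s) * (ennreal (1 / (1 - \<rho>)) * indicator {0<..<1} \<rho>)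
          \<le> ennpowr (\<integral>\<^sup>+t. ennreal (1 / (1 - \<rho> * t)) \<partial>nu) s * indicator {0..1} \<rho>"
      proof (cases "\<rho> \<in> {0<..<1}")
        case True
        let ?G = "\<integral>\<^sup>+t. ennreal (1 / (1 - \<rho> * t)) \<partial>nu"
        have "ennreal (m / (1 - \<rho>)) = ennreal (1 / (1 - \<rho>)) * emeasure nu {1}"
          using True m by (simp add: m_def emeasure_eq_measure ennreal_mult[symmetric])
        also have "\<dots> = (\<integral>\<^sup>+t. ennreal (1 / (1 - \<rho>)) * indicator {1} t \<partial>nu)"
          by (rule nn_integral_cmult_indicator[symmetric]) (simp add: sets)
        also have "\<dots> \<le> ?G" by (intro nn_integral_mono) (auto split: split_indicator)
        finally have G: "ennreal (m / (1 - \<rho>)) \<le> ?G" .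
        show ?thesis
        proof (cases "?G = top")
          case False
          then obtain g where g: "?G = ennreal g" "0 \<le> g" by (cases ?G) auto
          have "m powr s * (1 / (1 - \<rho>)) \<le> m powr s * (1 / (1 - \<rho>)) powr s"
            using True s powr_mono[of 1 s "1 / (1 - \<rho>)"] by (intro mult_left_mono) auto
          also have "\<dots> = (m / (1 - \<rho>)) powr s" using True m by (subst powr_mult[symmetric]) auto
          also have "\<dots> \<le> g powr s" using G g True m s by (intro powr_mono2) auto
          finally show ?thesis using True g m by (auto simp: ennpowr_def ennreal_mult[symmetric] intro!: ennreal_leI)
        qed (use True in \<open>simp add: ennpowr_def\<close>)
      qed simp
    qed
    also have "(\<integral>\<^sup>+\<rho>. ennreal (m powr s) * (ennreal (1 / (1 - \<rho>)) * indicator {0<..<1} \<rho>) \<partial>lborel) = \<infinity>"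
      using m by (subst nn_integral_cmult) (simp_all add: nn_integral_inverse_one_minus ennreal_mult_top)
    finally show False using I unfolding s_def by simp
  qed
  then have "emeasure nu {1} = 0" by (simp add: m_def emeasure_eq_measure)
  then show ?thesis by (intro AE_I[of _ _ "{1}"]) (auto simp: sets)
qed

text \<open>Only the part \<rho> >= t is kept: there U \<rho> >= U t and 1 - \<rho> t <= 1 - t^2, on
  an interval of length 1 - t. What remains is U t / (1 + t), whence the factor 2.\<close>

lemma increasing_le_Cauchy_average:
  fixes U :: "real \<Rightarrow> real"
  assumes mono: "\<And>r. t \<le> r \<Longrightarrow> r < 1 \<Longrightarrow> U t \<le> U r" and U: "0 \<le> U t" and t: "0 < t" "t < 1"
  shows "ennreal (U t) \<le> 2 * (\<integral>\<^sup>+\<rho>\<in>{0<..<1}. ennreal (U \<rho> / (1 - \<rho> * t)) \<partial>lborel)"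
proof -
  have pos: "0 < 1 - \<rho> * t" if "\<rho> \<in> {t..<1}" for \<rho>
  proof -
    have "\<rho> * t < 1 * 1" using that t by (intro mult_strict_mono) auto
    then show ?thesis by simp
  qed
  have c: "0 < 1 - t * t" using pos[of t] t by simp
  define A where "A = U t / (1 - t * t)"
  have A: "0 \<le> A" using U c by (simp add: A_def)
  have "ennreal (U t) \<le> ennreal (2 * (A * (1 - t)))"
  proof (rule ennreal_leI)
    have "1 - t * t = (1 - t) * (1 + t)" by (simp add: algebra_simps)
    then have "U t / (1 - t * t) * (1 - t) = U t / (1 + t)" using t by simp
    moreover have "U t / 2 \<le> U t / (1 + t)" using U t by (intro divide_left_mono) auto
    ultimately show "U t \<le> 2 * (A * (1 - t))" unfolding A_def by linarith
  qed
  also have "\<dots> = 2 * (\<integral>\<^sup>+\<rho>. ennreal A * indicator {t..<1} \<rho> \<partial>lborel)"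
    using A t by (simp add: nn_integral_cmult_indicator ennreal_mult)
  also have "\<dots> \<le> 2 * (\<integral>\<^sup>+\<rho>\<in>{0<..<1}. ennreal (U \<rho> / (1 - \<rho> * t)) \<partial>lborel)"
  proof (intro mult_left_mono nn_integral_mono)
    fix \<rho> :: real
    show "ennreal A * indicator {t..<1} \<rho> \<le> ennreal (U \<rho> / (1 - \<rho> * t)) * indicator {0<..<1} \<rho>"
    proof (cases "\<rho> \<in> {t..<1}")
      case True
      have "U t / (1 - t * t) \<le> U \<rho> / (1 - \<rho> * t)"
        using True mono[of \<rho>] U t pos[OF True] by (intro frac_le) (auto intro: mult_right_mono)
      then show ?thesis using True t by (auto simp: A_def intro: ennreal_leI)
    qed simp
  qed simp
  finally show ?thesis .
qed

text \<open>With r = p / \<beta>, |f|^p = (|f|^r)^\<beta> is at most U^\<beta>, which is again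
  increasing, so it is bounded by its Cauchy average. After Fubini, Hoelder with exponents 1 /
  \<beta> and 1 / (1 - \<beta>) separates the integral of U from the integral in (i).\<close>

lemma integral_condition_imp_embedding:
  fixes nu :: "real measure" and \<beta> p :: real and lam :: "nat \<Rightarrow> real"
  assumes fin: "finite_measure nu" and sets [measurable_cong]: "sets nu = sets borel"
    and supp: "AE t in nu. t \<in> {0..1}" and beta: "0 < \<beta>" "\<beta> < 1"
    and sparse: "log_sparse lam" and pos: "\<And>k. 0 < lam k" and inc: "strict_mono lam"
    and summ: "summable (\<lambda>k. 1 / lam k)" and p: "1 \<le> p"
    and I: "(\<integral>\<^sup>+\<rho>\<in>{0..1}. ennpowr (\<integral>\<^sup>+t. ennreal (1 / (1 - \<rho> * t)) \<partial>nu) (1 / (1 - \<beta>)) \<partial>lborel) < \<infinity>"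
  shows "\<exists>C>0. \<forall>f\<in>Muntz lam. (\<integral>t. norm (f t) powr p \<partial>nu) powr (1 / p)
               \<le> C * (LINT t:{0..1}|lborel. norm (f t) powr (p / \<beta>)) powr (\<beta> / p)"
proof -
  interpret finite_measure nu by fact
  interpret pair_sigma_finite nu lborel ..
  define r where "r = p / \<beta>"
  have r: "1 < r" using p beta by (simp add: r_def divide_simps)
  define s where "s = 1 / (1 - \<beta>)"
  have s: "1 < s" using beta by (simp add: s_def)
  obtain C where C: "0 < C" and maj: "\<And>f. f \<in> Muntz lam \<Longrightarrow> \<exists>U \<in> borel_measurable borel.
      (\<forall>t. 0 \<le> U t) \<and> (\<forall>t t'. 0 < t \<longrightarrow> t \<le> t' \<longrightarrow> t' < 1 \<longrightarrow> U t \<le> U t') \<and>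
      (\<forall>t\<in>{0<..<1}. norm (f t) powr r \<le> U t) \<and>
      (\<integral>\<^sup>+t\<in>{0<..<1}. ennreal (U t) \<partial>lborel) \<le> ennreal (C * (LINT t:{0..1}|lborel. norm (f t) powr r))"
    using Muntz_increasing_majorant[OF sparse pos inc summ r] by blast
  have not_1: "AE t in nu. t \<noteq> 1"
    by (rule Carleson_integral_imp_null_endpoint[OF fin sets beta I])
  define G where "G \<rho> = (\<integral>\<^sup>+t. ennreal (1 / (1 - \<rho> * t)) \<partial>nu)" for \<rho>
  have [measurable]: "G \<in> borel_measurable borel" unfolding G_def by measurable
  have G_fin: "G \<rho> < top" if "0 < \<rho>" "\<rho> < 1" for \<rho>
  proof -
    have "G \<rho> \<le> (\<integral>\<^sup>+t. ennreal (1 / (1 - \<rho>)) \<partial>nu)"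
      unfolding G_def
    proof (rule nn_integral_mono_AE)
      show "AE t in nu. ennreal (1 / (1 - \<rho> * t)) \<le> ennreal (1 / (1 - \<rho>))"
        using supp
      proof eventually_elim
        case (elim t)
        then have "\<rho> * t \<le> \<rho>" using that by (simp add: mult_left_le)
        then show ?case using that by (intro ennreal_leI frac_le) auto
      qed
    qed
    also have "\<dots> < top" by (simp add: ennreal_mult_less_top emeasure_eq_measure)
    finally show ?thesis .
  qed
  define J where "J = enn2real (\<integral>\<^sup>+\<rho>\<in>{0..1}. ennpowr (G \<rho>) s \<partial>lborel)"
  have J: "(\<integral>\<^sup>+\<rho>\<in>{0..1}. ennpowr (G \<rho>) s \<partial>lborel) = ennreal J"
    unfolding J_def using I by (simp add: G_def s_def less_top)
  have bound: "(\<integral>t. norm (f t) powr p \<partial>nu) \<le> 2 * ((C * (LINT t:{0..1}|lborel. norm (f t) powr r)) powr \<beta> * J powr (1 - \<beta>))"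
    if f: "f \<in> Muntz lam" for f
  proof -
    have [measurable]: "f \<in> borel_measurable borel" using Muntz_imp_measurable_bounded[OF f pos] by blast
    define N where "N = (LINT t:{0..1}|lborel. norm (f t) powr r)"
    have N0: "0 \<le> N" unfolding N_def set_lebesgue_integral_def by (intro integral_nonneg_AE) auto
    obtain U where [measurable]: "U \<in> borel_measurable borel" and U0: "\<And>t. 0 \<le> U t"
      and mono: "\<And>t t'. 0 < t \<Longrightarrow> t \<le> t' \<Longrightarrow> t' < 1 \<Longrightarrow> U t \<le> U t'"
      and fU: "\<And>t. t \<in> {0<..<1} \<Longrightarrow> norm (f t) powr r \<le> U t"
      and int: "(\<integral>\<^sup>+t\<in>{0<..<1}. ennreal (U t) \<partial>lborel) \<le> ennreal (C * N)"
      using maj[OF f] unfolding N_def by blast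
    \<comment> \<open>Here \<open>0 powr lam k = 0\<close> is used. The point 0 is treated apart,
      since U is known to be monotone on the open interval.\<close>
    have f0: "f 0 = 0" using f unfolding Muntz_def by auto
    define i where "i = (indicator {0<..<1} :: real \<Rightarrow> real)"
    have [measurable]: "i \<in> borel_measurable borel" by (simp add: i_def)
    have "(\<integral>\<^sup>+t. ennreal (norm (f t) powr p) \<partial>nu)
        \<le> (\<integral>\<^sup>+t. 2 * (\<integral>\<^sup>+\<rho>. ennreal (U \<rho> powr \<beta> * i \<rho>) * ennreal (1 / (1 - \<rho> * t)) \<partial>lborel) \<partial>nu)"
    proof (rule nn_integral_mono_AE)
      show "AE t in nu. ennreal (norm (f t) powr p)
        \<le> 2 * (\<integral>\<^sup>+\<rho>. ennreal (U \<rho> powr \<beta> * i \<rho>) * ennreal (1 / (1 - \<rho> * t)) \<partial>lborel)"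
        using supp not_1
      proof eventually_elim
        case (elim t)
        show ?case
        proof (cases "t = 0")
          case True
          then show ?thesis using f0 p by simp
        next
          case False
          then have t: "0 < t" "t < 1" using elim by auto
          have "norm (f t) powr p = (norm (f t) powr r) powr \<beta>"
            using beta by (simp add: powr_powr r_def)
          also have "\<dots> \<le> U t powr \<beta>" using fU[of t] t beta by (intro powr_mono2) auto
          finally have "ennreal (norm (f t) powr p) \<le> ennreal (U t powr \<beta>)" by (rule ennreal_leI)
          also have "\<dots> \<le> 2 * (\<integral>\<^sup>+\<rho>\<in>{0<..<1}. ennreal (U \<rho> powr \<beta> / (1 - \<rho> * t)) \<partial>lborel)"
            using t beta U0 by (intro increasing_le_Cauchy_average powr_mono2 mono) auto
          also have "(\<integral>\<^sup>+\<rho>\<in>{0<..<1}. ennreal (U \<rho> powr \<beta> / (1 - \<rho> * t)) \<partial>lborel)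
              = (\<integral>\<^sup>+\<rho>. ennreal (U \<rho> powr \<beta> * i \<rho>) * ennreal (1 / (1 - \<rho> * t)) \<partial>lborel)"
          proof (rule nn_integral_cong)
            fix \<rho>
            show "ennreal (U \<rho> powr \<beta> / (1 - \<rho> * t)) * indicator {0<..<1} \<rho>
              = ennreal (U \<rho> powr \<beta> * i \<rho>) * ennreal (1 / (1 - \<rho> * t))"
            proof (cases "\<rho> \<in> {0<..<1}")
              case True
              then have "ennreal (U \<rho> powr \<beta> * 1) * ennreal (1 / (1 - \<rho> * t)) = ennreal (U \<rho> powr \<beta> * 1 * (1 / (1 - \<rho> * t)))"
                by (intro ennreal_mult'[symmetric]) auto
              then show ?thesis using True by (simp add: i_def)
            qed (simp add: i_def)
          qed
          finally show ?thesis .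
        qed
      qed
    qed
    also have "\<dots> = 2 * (\<integral>\<^sup>+t. (\<integral>\<^sup>+\<rho>. ennreal (U \<rho> powr \<beta> * i \<rho>) * ennreal (1 / (1 - \<rho> * t)) \<partial>lborel) \<partial>nu)"
      by (rule nn_integral_cmult) measurable
    also have "(\<integral>\<^sup>+t. (\<integral>\<^sup>+\<rho>. ennreal (U \<rho> powr \<beta> * i \<rho>) * ennreal (1 / (1 - \<rho> * t)) \<partial>lborel) \<partial>nu)
        = (\<integral>\<^sup>+\<rho>. (\<integral>\<^sup>+t. ennreal (U \<rho> powr \<beta> * i \<rho>) * ennreal (1 / (1 - \<rho> * t)) \<partial>nu) \<partial>lborel)"
      by (rule Fubini'[symmetric]) measurable
    also have "\<dots> = (\<integral>\<^sup>+\<rho>. ennreal (U \<rho> powr \<beta> * i \<rho> * (enn2real (G \<rho>) * i \<rho>)) \<partial>lborel)"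
    proof (rule nn_integral_cong)
      fix \<rho> :: real
      have "(\<integral>\<^sup>+t. ennreal (U \<rho> powr \<beta> * i \<rho>) * ennreal (1 / (1 - \<rho> * t)) \<partial>nu) = ennreal (U \<rho> powr \<beta> * i \<rho>) * G \<rho>"
        unfolding G_def by (rule nn_integral_cmult) measurable
      also have "\<dots> = ennreal (U \<rho> powr \<beta> * i \<rho> * (enn2real (G \<rho>) * i \<rho>))"
      proof (cases "\<rho> \<in> {0<..<1}")
        case True
        then have "G \<rho> = ennreal (enn2real (G \<rho>))" using G_fin[of \<rho>] by simp
        then have "ennreal (U \<rho> powr \<beta> * 1) * G \<rho> = ennreal (U \<rho> powr \<beta> * 1 * (enn2real (G \<rho>) * 1))"
          by (metis ennreal_mult' enn2real_nonneg mult.right_neutral mult.commute)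
        then show ?thesis using True by (simp add: i_def)
      qed (simp add: i_def)
      finally show "(\<integral>\<^sup>+t. ennreal (U \<rho> powr \<beta> * i \<rho>) * ennreal (1 / (1 - \<rho> * t)) \<partial>nu)
        = ennreal (U \<rho> powr \<beta> * i \<rho> * (enn2real (G \<rho>) * i \<rho>))" .
    qed
    finally have f_le: "(\<integral>\<^sup>+t. ennreal (norm (f t) powr p) \<partial>nu)
        \<le> 2 * (\<integral>\<^sup>+\<rho>. ennreal (U \<rho> powr \<beta> * i \<rho> * (enn2real (G \<rho>) * i \<rho>)) \<partial>lborel)" .
    have "(\<integral>\<^sup>+\<rho>. ennreal (U \<rho> powr \<beta> * i \<rho> * (enn2real (G \<rho>) * i \<rho>)) \<partial>lborel)
        \<le> ennreal ((C * N) powr (1 / (1 / \<beta>)) * J powr (1 / s))"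
    proof (rule nn_integral_Holder)
      have "(\<integral>\<^sup>+\<rho>. ennreal ((U \<rho> powr \<beta> * i \<rho>) powr (1 / \<beta>)) \<partial>lborel) = (\<integral>\<^sup>+t\<in>{0<..<1}. ennreal (U t) \<partial>lborel)"
        using U0 beta by (intro nn_integral_cong) (auto simp: i_def powr_powr split: split_indicator)
      then show "(\<integral>\<^sup>+\<rho>. ennreal ((U \<rho> powr \<beta> * i \<rho>) powr (1 / \<beta>)) \<partial>lborel) \<le> ennreal (C * N)"
        using int by simp
      have "(\<integral>\<^sup>+\<rho>. ennreal ((enn2real (G \<rho>) * i \<rho>) powr s) \<partial>lborel) \<le> (\<integral>\<^sup>+\<rho>\<in>{0..1}. ennpowr (G \<rho>) s \<partial>lborel)"
        using s by (intro nn_integral_mono) (auto simp: i_def ennpowr_def split: split_indicator)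
      then show "(\<integral>\<^sup>+\<rho>. ennreal ((enn2real (G \<rho>) * i \<rho>) powr s) \<partial>lborel) \<le> ennreal J"
        unfolding J .
      show "1 / (1 / \<beta>) + 1 / s = 1" by (simp add: s_def)
    qed (use s beta C N0 in \<open>auto simp: i_def J_def\<close>)
    then have "2 * (\<integral>\<^sup>+\<rho>. ennreal (U \<rho> powr \<beta> * i \<rho> * (enn2real (G \<rho>) * i \<rho>)) \<partial>lborel)
        \<le> 2 * ennreal ((C * N) powr (1 / (1 / \<beta>)) * J powr (1 / s))"
      by (rule mult_left_mono) simp
    also have "\<dots> = ennreal (2 * ((C * N) powr \<beta> * J powr (1 - \<beta>)))"
      by (simp add: s_def ennreal_mult)
    finally have "(\<integral>\<^sup>+t. ennreal (norm (f t) powr p) \<partial>nu) \<le> ennreal (2 * ((C * N) powr \<beta> * J powr (1 - \<beta>)))"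
      using f_le by (rule order_trans[rotated])
    then have "enn2real (\<integral>\<^sup>+t. ennreal (norm (f t) powr p) \<partial>nu) \<le> 2 * ((C * N) powr \<beta> * J powr (1 - \<beta>))"
      by (intro enn2real_leI) auto
    then show ?thesis unfolding N_def by (subst integral_eq_nn_integral) auto
  qed
  define D where "D = 2 * (C powr \<beta> * J powr (1 - \<beta>))"
  show ?thesis
  \<comment> \<open>D can vanish, for instance when the measure is zero; adding 1 keeps the constant
    positive.\<close>
  proof (intro exI[of _ "D powr (1 / p) + 1"] conjI ballI)
    show "0 < D powr (1 / p) + 1" by (simp add: add_nonneg_pos)
    fix f assume f: "f \<in> Muntz lam"
    define N where "N = (LINT t:{0..1}|lborel. norm (f t) powr r)"
    have N0: "0 \<le> N" unfolding N_def set_lebesgue_integral_def by (intro integral_nonneg_AE) auto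
    have "(\<integral>t. norm (f t) powr p \<partial>nu) \<le> 2 * ((C * N) powr \<beta> * J powr (1 - \<beta>))"
      using bound[OF f] by (simp add: N_def)
    also have "\<dots> = D * N powr \<beta>" using C N0 by (simp add: D_def powr_mult)
    finally have "(\<integral>t. norm (f t) powr p \<partial>nu) powr (1 / p) \<le> (D * N powr \<beta>) powr (1 / p)"
      using p by (intro powr_mono2) auto
    also have "\<dots> = D powr (1 / p) * N powr (\<beta> / p)" by (simp add: D_def powr_mult powr_powr)
    also have "\<dots> \<le> (D powr (1 / p) + 1) * N powr (\<beta> / p)" by (intro mult_right_mono) auto
    finally show "(\<integral>t. norm (f t) powr p \<partial>nu) powr (1 / p)
       \<le> (D powr (1 / p) + 1) * (LINT t:{0..1}|lborel. norm (f t) powr (p / \<beta>)) powr (\<beta> / p)"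
      by (simp add: N_def r_def)
  qed
qed

text \<open>The coefficients make a_k m_k and a_k^(1 / \<beta>) / lam_k equal, the equality case of
  Hoelder, and both are the k-th term of the series. For a partial sum S the embedding then reads S
  <= C (D S)^\<beta>; S is finite and \<beta> < 1, so a power of S cancels and S is bounded
  independently of K.\<close>

lemma embedding_imp_summable:
  fixes nu :: "real measure" and \<beta> :: real and lam :: "nat \<Rightarrow> real"
  assumes fin: "finite_measure nu" and sets [measurable_cong]: "sets nu = sets borel"
    and supp: "AE t in nu. t \<in> {0..1}" and beta: "0 < \<beta>" "\<beta> < 1"
    and sparse: "log_sparse lam" and pos: "\<And>k. 0 < lam k"
    and emb: "\<exists>C>0. \<forall>f\<in>Muntz lam. (\<integral>t. norm (f t) \<partial>nu)
               \<le> C * (LINT t:{0..1}|lborel. norm (f t) powr (1 / \<beta>)) powr \<beta>"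
  shows "summable (\<lambda>k. lam k powr (\<beta> / (1 - \<beta>)) * (\<integral>t. t powr lam k \<partial>nu) powr (1 / (1 - \<beta>)))"
proof -
  interpret finite_measure nu by fact
  obtain C where C: "0 < C" and emb: "\<And>f. f \<in> Muntz lam \<Longrightarrow> (\<integral>t. norm (f t) \<partial>nu)
               \<le> C * (LINT t:{0..1}|lborel. norm (f t) powr (1 / \<beta>)) powr \<beta>"
    using emb by blast
  define e where "e = \<beta> / (1 - \<beta>)"
  define s where "s = 1 / (1 - \<beta>)"
  have es: "0 < e" "1 < s" "e + 1 = s" "e / \<beta> = s" "(1 - \<beta>) * s = 1"
    using beta by (auto simp: e_def s_def field_simps)
  define m where "m k = (\<integral>t. t powr lam k \<partial>nu)" for k
  have m0: "0 \<le> m k" for k unfolding m_def by (intro integral_nonneg_AE) auto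
  have int: "integrable nu (\<lambda>t. t powr lam k)" for k
  proof (rule integrable_const_bound[where B = 1])
    show "AE t in nu. norm (t powr lam k) \<le> 1" using supp
      by eventually_elim (auto intro: powr_le_one pos)
  qed measurable
  define a where "a k = (lam k * m k) powr e" for k
  have a0: "0 \<le> a k" for k by (simp add: a_def)
  have am: "a k * m k = lam k powr e * m k powr s" for k
  proof -
    have "m k powr e * m k = m k powr s"
      using m0[of k] es(3) powr_add[of "m k" e 1] by (cases "m k = 0") auto
    then show ?thesis using pos[of k] m0[of k] by (simp add: a_def powr_mult mult.assoc)
  qed
  have as: "a k powr (1 / \<beta>) / lam k = lam k powr e * m k powr s" for k
  proof -
    have "a k powr (1 / \<beta>) = (lam k * m k) powr s" by (simp add: a_def powr_powr es)
    also have "\<dots> = lam k powr s * m k powr s" using pos[of k] m0[of k] by (simp add: powr_mult)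
    also have "lam k powr s = lam k powr e * lam k"
      using pos[of k] powr_add[of "lam k" e 1] by (simp add: es)
    finally show ?thesis using pos[of k] by simp
  qed
  obtain D where D: "0 \<le> D" and hardy: "\<And>K a. (\<And>k. 0 \<le> a k) \<Longrightarrow>
    (\<integral>\<^sup>+t\<in>{0..1}. ennreal ((\<Sum>k<K. a k * t powr lam k) powr (1 / \<beta>)) \<partial>lborel)
      \<le> ennreal (D * (\<Sum>k<K. a k powr (1 / \<beta>) / lam k))"
    using Muntz_norm_upper_bound[OF sparse pos, of "1 / \<beta>"] beta by auto
  have partial: "(\<Sum>k<Suc K. lam k powr e * m k powr s) \<le> (C * D powr \<beta>) powr s" for K
  proof -
    define S where "S = (\<Sum>k<Suc K. lam k powr e * m k powr s)"
    have S0: "0 \<le> S" unfolding S_def by (intro sum_nonneg) auto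
    define f where "f t = (\<Sum>k\<le>K. complex_of_real (a k) * complex_of_real (t powr lam k))" for t
    have f: "f \<in> Muntz lam" unfolding Muntz_def f_def by (auto intro!: exI[of _ K] exI[of _ "\<lambda>k. complex_of_real (a k)"])
    have norm_f: "norm (f t) = (\<Sum>k<Suc K. a k * t powr lam k)" for t
    proof -
      have "f t = of_real (\<Sum>k<Suc K. a k * t powr lam k)" by (simp add: f_def lessThan_Suc_atMost)
      then show ?thesis using a0 by (simp only: norm_of_real) (intro abs_of_nonneg sum_nonneg, simp)
    qed
    have "S = (\<integral>t. norm (f t) \<partial>nu)"
      unfolding norm_f S_def am[symmetric] using int by (subst Bochner_Integration.integral_sum) (auto simp: m_def)
    also have "\<dots> \<le> C * (LINT t:{0..1}|lborel. norm (f t) powr (1 / \<beta>)) powr \<beta>"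
      by (rule emb[OF f])
    also have "\<dots> \<le> C * (D * S) powr \<beta>"
    proof (intro mult_left_mono powr_mono2)
      show "0 \<le> (LINT t:{0..1}|lborel. norm (f t) powr (1 / \<beta>))"
        unfolding set_lebesgue_integral_def by (intro integral_nonneg_AE) auto
      have "ennreal (LINT t:{0..1}|lborel. norm (f t) powr (1 / \<beta>)) = (\<integral>\<^sup>+t\<in>{0..1}. ennreal (norm (f t) powr (1 / \<beta>)) \<partial>lborel)"
      proof -
        have [measurable]: "f \<in> borel_measurable borel" using Muntz_imp_measurable_bounded[OF f pos] by blast
        obtain B where B: "0 \<le> B" "\<And>t. t \<in> {0..1} \<Longrightarrow> norm (f t) \<le> B"
          using Muntz_imp_measurable_bounded[OF f pos] by blast
        show ?thesis using B beta
          by (intro nn_integral_eq_set_lebesgue_integral[symmetric, where B = "B powr (1 / \<beta>)"] powr_mono2) auto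
      qed
      also have "\<dots> \<le> ennreal (D * (\<Sum>k<Suc K. a k powr (1 / \<beta>) / lam k))"
        unfolding norm_f by (rule hardy[OF a0])
      also have "\<dots> = ennreal (D * S)" by (simp only: as S_def)
      finally show "(LINT t:{0..1}|lborel. norm (f t) powr (1 / \<beta>)) \<le> D * S"
        using D S0 by (subst (asm) ennreal_le_iff) auto
    qed (use C beta in auto)
    also have "\<dots> = C * D powr \<beta> * S powr \<beta>" using D S0 by (simp add: powr_mult)
    finally have le: "S \<le> C * D powr \<beta> * S powr \<beta>" .
    show ?thesis unfolding S_def[symmetric]
    proof (cases "S = 0")
      case False
      then have S: "0 < S" using S0 by simp
      have "S powr (1 - \<beta>) * S powr \<beta> = S" using S by (simp add: powr_add[symmetric])
      with le have "S powr (1 - \<beta>) * S powr \<beta> \<le> C * D powr \<beta> * S powr \<beta>" by simp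
      then have "S powr (1 - \<beta>) \<le> C * D powr \<beta>" using S by simp
      then have "(S powr (1 - \<beta>)) powr s \<le> (C * D powr \<beta>) powr s" using es by (intro powr_mono2) auto
      then show "S \<le> (C * D powr \<beta>) powr s" using S es(5) by (simp add: powr_powr)
    qed simp
  qed
  have "summable (\<lambda>k. lam k powr e * m k powr s)"
  proof (rule summableI_nonneg_bounded)
    fix n show "(\<Sum>k<n. lam k powr e * m k powr s) \<le> (C * D powr \<beta>) powr s"
      using partial[of n] by (rule order_trans[rotated]) simp
  qed auto
  then show ?thesis by (simp add: e_def s_def m_def)
qed

text \<open>On [0, 1] a larger exponent gives a smaller power, so the case p = 1 of (iii) implies
  all others.\<close>

lemma summable_imp_summable_powr:
  fixes nu :: "real measure" and \<beta> p :: real and lam :: "nat \<Rightarrow> real"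
  assumes fin: "finite_measure nu" and sets [measurable_cong]: "sets nu = sets borel"
    and supp: "AE t in nu. t \<in> {0..1}" and beta: "0 < \<beta>" "\<beta> < 1" and pos: "\<And>k. 0 < lam k" and p: "1 \<le> p"
    and summ: "summable (\<lambda>k. lam k powr (\<beta> / (1 - \<beta>)) * (\<integral>t. t powr lam k \<partial>nu) powr (1 / (1 - \<beta>)))"
  shows "summable (\<lambda>k. lam k powr (\<beta> / (1 - \<beta>)) * (\<integral>t. t powr (p * lam k) \<partial>nu) powr (1 / (1 - \<beta>)))"
proof (rule summable_comparison_test'[OF summ, of 0])
  interpret finite_measure nu by fact
  fix k :: nat
  have int: "integrable nu (\<lambda>t. t powr l)" if "0 < l" for l
  proof (rule integrable_const_bound[where B = 1])
    show "AE t in nu. norm (t powr l) \<le> 1" using supp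
      by eventually_elim (auto intro: powr_le_one that)
  qed measurable
  have "(\<integral>t. t powr (p * lam k) \<partial>nu) \<le> (\<integral>t. t powr lam k \<partial>nu)"
  proof (rule integral_mono_AE)
    show "AE t in nu. t powr (p * lam k) \<le> t powr lam k"
      using supp by eventually_elim (use p pos[of k] in \<open>auto intro!: powr_mono'\<close>)
  qed (use int pos p in auto)
  moreover have "0 \<le> (\<integral>t. t powr (p * lam k) \<partial>nu)" by (intro integral_nonneg_AE) auto
  ultimately show "norm (lam k powr (\<beta> / (1 - \<beta>)) * (\<integral>t. t powr (p * lam k) \<partial>nu) powr (1 / (1 - \<beta>)))
      \<le> lam k powr (\<beta> / (1 - \<beta>)) * (\<integral>t. t powr lam k \<partial>nu) powr (1 / (1 - \<beta>))"
    using beta by (auto intro!: mult_left_mono powr_mono2)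
qed

text \<open>A single term suffices. For y = 1 / (1 - \<tau>) take k with lam_k <= y < lam_(k+1). The
  subgeometric bound gives y <= C lam_k, and for \<tau> >= 1/2 the inequality - ln \<tau> <= 2 (1 -
  \<tau>) gives \<tau>^lam_k >= exp (- 2). The condition on lam K ensures k < K.\<close>

lemma Cauchy_kernel_le_exponential_sum:
  fixes lam :: "nat \<Rightarrow> real"
  assumes pos: "\<And>k. 0 < lam k" and inc: "strict_mono lam" and sg: "subgeometric lam"
  obtains c where "0 < c" "\<And>\<tau> K. 0 \<le> \<tau> \<Longrightarrow> \<tau> < 1 \<Longrightarrow> 1 / (1 - \<tau>) < lam K \<Longrightarrow>
    1 / (1 - \<tau>) \<le> c * (1 + (\<Sum>k<K. lam k * \<tau> powr lam k))"
proof -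
  obtain C where C: "0 < C" "\<And>k. lam (Suc k) \<le> C * lam k" using sg unfolding subgeometric_def by blast
  \<comment> \<open>One summand for each case: y < 2, y < lam 0, and the remaining one.\<close>
  define c where "c = 2 + lam 0 + C * exp 2"
  have c: "2 \<le> c" "lam 0 \<le> c" "C * exp 2 \<le> c" using C pos[of 0] by (auto simp: c_def)
  have "1 / (1 - \<tau>) \<le> c * (1 + (\<Sum>k<K. lam k * \<tau> powr lam k))"
    if \<tau>: "0 \<le> \<tau>" "\<tau> < 1" and K: "1 / (1 - \<tau>) < lam K" for \<tau> K
  proof -
    define y where "y = 1 / (1 - \<tau>)"
    have y: "0 < y" using \<tau> by (simp add: y_def)
    let ?S = "\<Sum>k<K. lam k * \<tau> powr lam k"
    have S0: "0 \<le> ?S" using pos by (intro sum_nonneg) (simp add: less_imp_le)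
    have cS: "c \<le> c * (1 + ?S)" using S0 c by (simp add: algebra_simps)
    show ?thesis
    proof (cases "y < 2 \<or> y < lam 0")
      case True
      then have "y \<le> c" using c by auto
      then show ?thesis using cS by (simp add: y_def)
    next
      case False
      then have half: "1 / 2 \<le> \<tau>" using \<tau> by (auto simp: y_def field_simps)
      define n where "n = (LEAST j. y < lam j)"
      have n: "y < lam n" unfolding n_def by (rule LeastI[where P = "\<lambda>j. y < lam j" and k = K]) (use K in \<open>simp add: y_def\<close>)
      have nK: "n \<le> K" unfolding n_def by (rule Least_le) (use K in \<open>simp add: y_def\<close>)
      have "n \<noteq> 0" using False n by (cases n) auto
      then obtain k where k: "n = Suc k" by (cases n) auto
      have lk: "lam k \<le> y" using not_less_Least[of k "\<lambda>j. y < lam j"] k by (simp add: n_def)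
      have "ln (1 / \<tau>) \<le> 1 / \<tau> - 1" using half by (intro ln_le_minus_one) auto
      also have "\<dots> \<le> 2 * (1 - \<tau>)"
      proof -
        have "1 / \<tau> - 1 = (1 - \<tau>) * (1 / \<tau>)" using half by (simp add: field_simps)
        also have "\<dots> \<le> (1 - \<tau>) * 2" using half \<tau> by (intro mult_left_mono) (auto simp: field_simps)
        finally show ?thesis by simp
      qed
      finally have "- ln \<tau> \<le> 2 * (1 - \<tau>)" using half by (simp add: ln_div)
      then have "lam k * (- ln \<tau>) \<le> y * (2 * (1 - \<tau>))"
        using lk pos[of k] \<tau> half y by (intro mult_mono) auto
      also have "\<dots> = 2" using \<tau> by (simp add: y_def divide_simps)
      finally have "exp (- 2) \<le> \<tau> powr lam k" using half by (simp add: powr_def)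
      then have "1 \<le> exp 2 * \<tau> powr lam k" by (simp add: exp_minus field_simps)
      then have "C * lam k * 1 \<le> C * lam k * (exp 2 * \<tau> powr lam k)"
        using C pos[of k] by (intro mult_left_mono) auto
      moreover have "y \<le> C * lam k" using n C(2)[of k] k by simp
      ultimately have "y \<le> C * exp 2 * (lam k * \<tau> powr lam k)" by (simp add: mult_ac)
      also have "\<dots> \<le> c * (lam k * \<tau> powr lam k)" using c pos[of k] by (intro mult_right_mono) auto
      also have "\<dots> \<le> c * (1 + ?S)"
      proof (intro mult_left_mono)
        have "lam k * \<tau> powr lam k \<le> ?S"
          using nK k pos by (intro member_le_sum) (auto simp: less_imp_le)
        then show "lam k * \<tau> powr lam k \<le> 1 + ?S" by simp
      qed (use c in auto)
      finally show ?thesis by (simp add: y_def)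
    qed
  qed
  moreover have "0 < c" using c by simp
  ultimately show ?thesis using that by blast
qed

text \<open>Integrating the kernel bound in t replaces t^lam_k by its moment m_k and leaves a sum P
  in \<rho> with coefficients b_k = lam_k m_k >= 0. Since b_k^s / lam_k is the k-th term of the
  given series, the norm estimate bounds P uniformly in K.\<close>

lemma summable_imp_integral_condition:
  fixes nu :: "real measure" and \<beta> :: real and lam :: "nat \<Rightarrow> real"
  assumes fin: "finite_measure nu" and sets [measurable_cong]: "sets nu = sets borel"
    and supp: "AE t in nu. t \<in> {0..1}" and beta: "0 < \<beta>" "\<beta> < 1"
    and sparse: "log_sparse lam" and pos: "\<And>k. 0 < lam k" and inc: "strict_mono lam"
    and lam_sum: "summable (\<lambda>k. 1 / lam k)" and sg: "subgeometric lam"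
    and summ: "summable (\<lambda>k. lam k powr (\<beta> / (1 - \<beta>)) * (\<integral>t. t powr lam k \<partial>nu) powr (1 / (1 - \<beta>)))"
  shows "(\<integral>\<^sup>+\<rho>\<in>{0..1}. ennpowr (\<integral>\<^sup>+t. ennreal (1 / (1 - \<rho> * t)) \<partial>nu) (1 / (1 - \<beta>)) \<partial>lborel) < \<infinity>"
proof -
  interpret finite_measure nu by fact
  define s where "s = 1 / (1 - \<beta>)"
  define e where "e = \<beta> / (1 - \<beta>)"
  have es: "1 < s" "e + 1 = s" using beta by (auto simp: e_def s_def field_simps)
  obtain c where c: "0 < c" and kernel: "\<And>\<tau> K. 0 \<le> \<tau> \<Longrightarrow> \<tau> < 1 \<Longrightarrow> 1 / (1 - \<tau>) < lam K \<Longrightarrow>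
    1 / (1 - \<tau>) \<le> c * (1 + (\<Sum>k<K. lam k * \<tau> powr lam k))"
    using Cauchy_kernel_le_exponential_sum[OF pos inc sg] by blast
  obtain D where D: "0 \<le> D" and hardy: "\<And>K a. (\<And>k. 0 \<le> a k) \<Longrightarrow>
    (\<integral>\<^sup>+t\<in>{0..1}. ennreal ((\<Sum>k<K. a k * t powr lam k) powr s) \<partial>lborel)
      \<le> ennreal (D * (\<Sum>k<K. a k powr s / lam k))"
    using Muntz_norm_upper_bound[OF sparse pos es(1)] by blast
  define m where "m k = (\<integral>t. t powr lam k \<partial>nu)" for k
  have m0: "0 \<le> m k" for k unfolding m_def by (intro integral_nonneg_AE) auto
  have int: "integrable nu (\<lambda>t. t powr lam k)" for k
  proof (rule integrable_const_bound[where B = 1])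
    show "AE t in nu. norm (t powr lam k) \<le> 1" using supp
      by eventually_elim (auto intro: powr_le_one pos)
  qed measurable
  define b where "b k = lam k * m k" for k
  have b0: "0 \<le> b k" for k using pos[of k] m0[of k] by (simp add: b_def)
  define M where "M = measure nu UNIV"
  have sp: "space nu = UNIV" using sets_eq_imp_space_eq[OF sets] by simp
  define P where "P K \<rho> = (\<Sum>k<K. b k * \<rho> powr lam k)" for K \<rho>
  have P0: "0 \<le> P K \<rho>" for K \<rho> unfolding P_def using b0 by (intro sum_nonneg) auto
  define G where "G \<rho> = (\<integral>\<^sup>+t. ennreal (1 / (1 - \<rho> * t)) \<partial>nu)" for \<rho>
  \<comment> \<open>K works for all t at once because \<rho> t <= \<rho>, but it depends on \<rho>.
    A supremum over K, handled by monotone convergence, is therefore needed below.\<close>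
  have G_le: "\<exists>K. G \<rho> \<le> ennreal (c * (M + P K \<rho>))" if \<rho>: "0 < \<rho>" "\<rho> < 1" for \<rho>
  proof -
    have "eventually (\<lambda>k. 1 / lam k < 1 - \<rho>) sequentially"
      using summable_LIMSEQ_zero[OF lam_sum] \<rho> by (intro order_tendstoD) auto
    then obtain K where "1 / lam K < 1 - \<rho>" by (auto simp: eventually_sequentially)
    then have K: "1 / (1 - \<rho>) < lam K" using \<rho> pos[of K] by (simp add: field_simps)
    have "G \<rho> \<le> (\<integral>\<^sup>+t. ennreal (c * (1 + (\<Sum>k<K. lam k * (\<rho> powr lam k * t powr lam k)))) \<partial>nu)"
      unfolding G_def
    proof (rule nn_integral_mono_AE)
      show "AE t in nu. ennreal (1 / (1 - \<rho> * t)) \<le> ennreal (c * (1 + (\<Sum>k<K. lam k * (\<rho> powr lam k * t powr lam k))))"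
        using supp
      proof eventually_elim
        case (elim t)
        have le: "\<rho> * t \<le> \<rho>" using elim \<rho> by (simp add: mult_left_le)
        then have "1 / (1 - \<rho> * t) \<le> 1 / (1 - \<rho>)" using \<rho> by (intro frac_le) auto
        then have "1 / (1 - \<rho> * t) < lam K" using K by simp
        then have "1 / (1 - \<rho> * t) \<le> c * (1 + (\<Sum>k<K. lam k * (\<rho> * t) powr lam k))"
          using elim \<rho> order.strict_trans1[OF le \<rho>(2)] by (intro kernel) auto
        then show ?case using elim \<rho> by (simp add: powr_mult ennreal_leI)
      qed
    qed
    also have "\<dots> = ennreal (\<integral>t. c * (1 + (\<Sum>k<K. lam k * (\<rho> powr lam k * t powr lam k))) \<partial>nu)"
      using int c pos by (intro nn_integral_eq_integral)
        (auto intro!: mult_nonneg_nonneg add_nonneg_nonneg sum_nonneg simp: less_imp_le)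
    also have "(\<integral>t. c * (1 + (\<Sum>k<K. lam k * (\<rho> powr lam k * t powr lam k))) \<partial>nu) = c * (M + P K \<rho>)"
      using int by (simp add: Bochner_Integration.integral_add Bochner_Integration.integral_sum M_def P_def b_def m_def sp mult_ac)
    finally show ?thesis by blast
  qed
  define Q where "Q = (2 * c) powr s"
  \<comment> \<open>M + x is at most twice the maximum of M and x, and a power of a maximum is at
    most the sum of the powers.\<close>
  have powr_le: "(c * (M + x)) powr s \<le> Q * (M powr s + x powr s)" if "0 \<le> x" for x
  proof -
    have M0: "0 \<le> M" by (simp add: M_def)
    have "(c * (M + x)) powr s \<le> (2 * c * max M x) powr s"
      using c that M0 es by (intro powr_mono2) (auto simp: max_def)
    also have "\<dots> = Q * max M x powr s" using c M0 by (simp add: Q_def powr_mult)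
    also have "\<dots> \<le> Q * (M powr s + x powr s)"
      by (intro mult_left_mono) (auto simp: max_def Q_def)
    finally show ?thesis .
  qed
  have "(\<integral>\<^sup>+\<rho>\<in>{0..1}. ennpowr (G \<rho>) s \<partial>lborel)
      \<le> (\<integral>\<^sup>+\<rho>. ennreal Q * (ennreal (M powr s) * indicator {0..1} \<rho> + (SUP K. ennreal (P K \<rho> powr s) * indicator {0..1} \<rho>)) \<partial>lborel)"
  proof (rule nn_integral_mono_AE)
    show "AE \<rho> in lborel. ennpowr (G \<rho>) s * indicator {0..1} \<rho>
      \<le> ennreal Q * (ennreal (M powr s) * indicator {0..1} \<rho> + (SUP K. ennreal (P K \<rho> powr s) * indicator {0..1} \<rho>))"
      using AE_lborel_singleton[of "0::real"] AE_lborel_singleton[of "1::real"]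
    proof eventually_elim
      case (elim \<rho>)
      show ?case
      proof (cases "\<rho> \<in> {0..1}")
        case True
        then have \<rho>: "0 < \<rho>" "\<rho> < 1" using elim by auto
        obtain K where K: "G \<rho> \<le> ennreal (c * (M + P K \<rho>))" using G_le[OF \<rho>] by blast
        then have "G \<rho> \<noteq> \<infinity>" by (auto simp: top_unique)
        then have "ennpowr (G \<rho>) s = ennreal (enn2real (G \<rho>) powr s)" by (simp add: ennpowr_def)
        also have "\<dots> \<le> ennreal ((c * (M + P K \<rho>)) powr s)"
          using K c P0[of K \<rho>] es by (intro ennreal_leI powr_mono2 enn2real_leI) (auto simp: M_def)
        also have "\<dots> \<le> ennreal (Q * (M powr s + P K \<rho> powr s))" by (intro ennreal_leI powr_le P0)
        also have "\<dots> = ennreal Q * (ennreal (M powr s) + ennreal (P K \<rho> powr s))"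
          by (simp add: Q_def ennreal_mult)
        also have "\<dots> \<le> ennreal Q * (ennreal (M powr s) + (SUP K. ennreal (P K \<rho> powr s)))"
          by (intro mult_left_mono add_left_mono SUP_upper) auto
        finally show ?thesis using True by simp
      qed simp
    qed
  qed
  also have "\<dots> = ennreal Q * (ennreal (M powr s) + (\<integral>\<^sup>+\<rho>. (SUP K. ennreal (P K \<rho> powr s) * indicator {0..1} \<rho>) \<partial>lborel))"
    unfolding P_def by (simp add: nn_integral_cmult nn_integral_add)
  also have "(\<integral>\<^sup>+\<rho>. (SUP K. ennreal (P K \<rho> powr s) * indicator {0..1} \<rho>) \<partial>lborel)
      = (SUP K. \<integral>\<^sup>+\<rho>. ennreal (P K \<rho> powr s) * indicator {0..1} \<rho> \<partial>lborel)"
  proof (rule nn_integral_monotone_convergence_SUP)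
    show "incseq (\<lambda>K \<rho>. ennreal (P K \<rho> powr s) * indicator {0..1} \<rho>)"
    proof (intro incseq_SucI le_funI mult_right_mono ennreal_leI powr_mono2)
      fix K \<rho> show "P K \<rho> \<le> P (Suc K) \<rho>" using b0[of K] by (simp add: P_def)
    qed (use P0 es in auto)
    show "(\<lambda>\<rho>. ennreal (P K \<rho> powr s) * indicator {0..1} \<rho>) \<in> borel_measurable lborel" for K
      unfolding P_def by measurable
  qed
  finally have G_int: "(\<integral>\<^sup>+\<rho>\<in>{0..1}. ennpowr (G \<rho>) s \<partial>lborel)
    \<le> ennreal Q * (ennreal (M powr s) + (SUP K. \<integral>\<^sup>+\<rho>. ennreal (P K \<rho> powr s) * indicator {0..1} \<rho> \<partial>lborel))" .
  define T where "T = (\<Sum>k. lam k powr e * m k powr s)"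
  have "(SUP K. \<integral>\<^sup>+\<rho>. ennreal (P K \<rho> powr s) * indicator {0..1} \<rho> \<partial>lborel) \<le> ennreal (D * T)"
  proof (rule SUP_least)
    fix K
    have "b k powr s / lam k = lam k powr e * m k powr s" for k
    proof -
      have "lam k powr s = lam k powr e * lam k"
        using pos[of k] powr_add[of "lam k" e 1] by (simp add: es)
      then show ?thesis using pos[of k] m0[of k] by (simp add: b_def powr_mult)
    qed
    then have "(\<integral>\<^sup>+\<rho>. ennreal (P K \<rho> powr s) * indicator {0..1} \<rho> \<partial>lborel) \<le> ennreal (D * (\<Sum>k<K. lam k powr e * m k powr s))"
      using hardy[of b K, OF b0] by (simp add: P_def)
    also have "\<dots> \<le> ennreal (D * T)"
      unfolding T_def using summ D
      by (intro ennreal_leI mult_left_mono sum_le_suminf) (auto simp: e_def s_def m_def)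
    finally show "(\<integral>\<^sup>+\<rho>. ennreal (P K \<rho> powr s) * indicator {0..1} \<rho> \<partial>lborel) \<le> ennreal (D * T)" .
  qed
  then have "(\<integral>\<^sup>+\<rho>\<in>{0..1}. ennpowr (G \<rho>) s \<partial>lborel) \<le> ennreal Q * (ennreal (M powr s) + ennreal (D * T))"
    by (intro order_trans[OF G_int] mult_left_mono add_left_mono) auto
  also have "\<dots> < \<infinity>" by (simp add: ennreal_mult_less_top)
  finally show ?thesis by (simp add: G_def s_def)
qed

theorem mainTheorem2:
  fixes lam :: "nat \<Rightarrow> real" and q :: real and N :: nat
    and \<mu> :: "real measure" and \<beta> :: real
  assumes mu_sets: "sets \<mu> = sets (restrict_space borel {0..1})"
    and mu_fin: "finite_measure \<mu>"
    and beta: "0 < \<beta>" "\<beta> < 1"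
    and lam_pos: "\<And>k. 0 < lam k"
    and lam_inc: "strict_mono lam"
    and lam_sum: "summable (\<lambda>k. 1 / lam k)"
    and ql: "quasi_lacunary lam q N"
    and sg: "subgeometric lam"
  shows "((\<integral>\<^sup>+ \<rho>\<in>{0..1}.
             ennpowr (\<integral>\<^sup>+ t. ennreal (1 / (1 - \<rho> * t)) \<partial>\<mu>) (1 / (1 - \<beta>)) \<partial>lborel) < \<infinity>
          \<longleftrightarrow>
          (\<forall>p::real. p \<ge> 1 \<longrightarrow> (\<exists>C>0. \<forall>f\<in>Muntz lam.
             (\<integral> t. norm (f t) powr p \<partial>\<mu>) powr (1 / p)
               \<le> C * (LINT t:{0..1}|lborel. norm (f t) powr (p / \<beta>)) powr (\<beta> / p))))
       \<and>
         ((\<forall>p::real. p \<ge> 1 \<longrightarrow> (\<exists>C>0. \<forall>f\<in>Muntz lam.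
             (\<integral> t. norm (f t) powr p \<partial>\<mu>) powr (1 / p)
               \<le> C * (LINT t:{0..1}|lborel. norm (f t) powr (p / \<beta>)) powr (\<beta> / p)))
          \<longleftrightarrow>
          (\<forall>p::real. p \<ge> 1 \<longrightarrow>
             summable (\<lambda>k. lam k powr (\<beta> / (1 - \<beta>))
                 * (\<integral> t. t powr (p * lam k) \<partial>\<mu>) powr (1 / (1 - \<beta>)))))"
proof -
  \<comment> \<open>The push-forward along the inclusion of [0, 1] lives on all Borel sets of the
    line, so functions on the line are measurable for it without restriction; its support condition
    holds almost everywhere.\<close>
  define nu where "nu = distr \<mu> borel (\<lambda>t. t)"
  have id_meas [measurable]: "(\<lambda>t. t) \<in> \<mu> \<rightarrow>\<^sub>M borel"
    using measurable_restrict_space1[of "\<lambda>t. t" borel borel "{0..1}"] measurable_cong_sets[OF mu_sets refl] by auto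
  have sets_nu: "sets nu = sets borel" by (simp add: nu_def)
  have fin: "finite_measure nu"
    unfolding nu_def by (rule finite_measure.finite_measure_distr[OF mu_fin id_meas])
  have "space \<mu> = {0..1}" using sets_eq_imp_space_eq[OF mu_sets] by (simp add: space_restrict_space)
  then have supp: "AE t in nu. t \<in> {0..1}"
    unfolding nu_def by (subst AE_distr_iff[OF id_meas]) auto
  have nn: "(\<integral>\<^sup>+t. ennreal (1 / (1 - \<rho> * t)) \<partial>\<mu>) = (\<integral>\<^sup>+t. ennreal (1 / (1 - \<rho> * t)) \<partial>nu)" for \<rho>
    unfolding nu_def by (rule nn_integral_distr[symmetric]) (use id_meas in auto)
  have moment: "(\<integral>t. t powr l \<partial>\<mu>) = (\<integral>t. t powr l \<partial>nu)" for l
    unfolding nu_def by (rule integral_distr[symmetric]) (use id_meas in auto)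
  have norm_int: "(\<integral>t. norm (f t) powr p \<partial>\<mu>) = (\<integral>t. norm (f t) powr p \<partial>nu)" if "f \<in> Muntz lam" for f p
  proof -
    have [measurable]: "f \<in> borel_measurable borel" using Muntz_imp_measurable_bounded[OF that lam_pos] by blast
    show ?thesis unfolding nu_def by (rule integral_distr[symmetric]) (use id_meas in auto)
  qed
  have sparse: "log_sparse lam" by (rule quasi_lacunary_log_sparse[OF ql lam_pos lam_inc])
  let ?emb = "\<lambda>p. \<exists>C>0. \<forall>f\<in>Muntz lam. (\<integral>t. norm (f t) powr p \<partial>\<mu>) powr (1 / p)
      \<le> C * (LINT t:{0..1}|lborel. norm (f t) powr (p / \<beta>)) powr (\<beta> / p)"
  let ?sum = "\<lambda>p. summable (\<lambda>k. lam k powr (\<beta> / (1 - \<beta>)) * (\<integral>t. t powr (p * lam k) \<partial>\<mu>) powr (1 / (1 - \<beta>)))"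
  let ?int = "(\<integral>\<^sup>+\<rho>\<in>{0..1}. ennpowr (\<integral>\<^sup>+t. ennreal (1 / (1 - \<rho> * t)) \<partial>\<mu>) (1 / (1 - \<beta>)) \<partial>lborel) < \<infinity>"
  \<comment> \<open>The cycle: (i) gives (ii) for each p, (ii) at p = 1 gives (iii) for every p, and
    (iii) at p = 1 gives (i).\<close>
  have "?emb p" if "?int" "1 \<le> p" for p
    using integral_condition_imp_embedding[OF fin sets_nu supp beta sparse lam_pos lam_inc lam_sum that(2)] that(1)
    by (simp add: nn norm_int)
  moreover have "?sum p" if emb: "?emb 1" and p: "1 \<le> p" for p
  proof -
    have "\<exists>C>0. \<forall>f\<in>Muntz lam. (\<integral>t. norm (f t) \<partial>nu)
        \<le> C * (LINT t:{0..1}|lborel. norm (f t) powr (1 / \<beta>)) powr \<beta>"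
      using emb by (simp add: norm_int[where p = 1, simplified])
    from embedding_imp_summable[OF fin sets_nu supp beta sparse lam_pos this]
    show ?thesis
      using summable_imp_summable_powr[OF fin sets_nu supp beta lam_pos p] by (simp add: moment)
  qed
  moreover have "?int" if "?sum 1"
    using summable_imp_integral_condition[OF fin sets_nu supp beta sparse lam_pos lam_inc lam_sum sg] that
    by (simp add: nn moment)
  ultimately show ?thesis by (meson order_refl)
qed

end
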